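(* Let $m\ge 2$ be an integer and $r\in(0,1)$ be fixed. For each prime $p$ let $G$ be the set of roots of $g(X)=X^{p^m}+X^p+X$ (an additive group), let $H=\mathbb{F}_{p^m}^\times$, let $n=|\langle G,H\rangle|$, and let $\mathcal{C}=\mathcal{C}(G,H;r,n)$ be the associated evaluation code of length $n$ with global degree parameter $D=n$ (all defined in the context). Then, as $p\to\infty$, the codes $\mathcal{C}$ form a family of expander codes (in the sense of the context) such that: 1. The left and right local codes have lengths $|G|=p^m$ and $|H|=p^m-1$ respectively, both of which are $\Theta(n^{\frac{1}{m+1}})$; the local codes have rate at most $r+o(1)$ and relative minimum distance at least $1-r-o(1)$. 2. The relative minimum distance $\delta$ of $\mathcal{C}$ satisfies asymptotically $\delta\ge(1-r)^2$, i.e. $\liminf_{p\to\infty}\delta\ge(1-r)^2$. 3. The rate $R=\dim_{\mathbb{F}}(\mathcal{C})/n$ satisfies asymptotically $R\ge\frac{r^{2m+1}}{(2m+1)!}$, i.e. $\liminf_{p\to\infty}R\ge\frac{r^{2m+1}}{(2m+1)!}$. Here $o(1)$ denotes quantities tending to $0$ as $p\to\infty$ with $m,r$ fixed.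
   Context: Groups and field. $m\ge2$ is fixed, $p$ is a prime. $g(X)=X^{p^m}+X^p+X$; $G$ is its set of roots in its splitting field over $\mathbb{F}_p$, an additive group of order $p^m$. $H=\mathbb{F}_{p^m}^\times$. Let $\mathbb{F}$ be a finite extension field of $\mathbb{F}_p$ containing $G$ and $H$. Identify $G$ with the translation group $\{x\mapsto x+a: a\in G\}$ and $H$ with the scaling group $\{x\mapsto hx: h\in H\}$, both subgroups of $\mathrm{AGL}(1,\mathbb{F})=\{x\mapsto ax+b: a\in\mathbb{F}^\times, b\in\mathbb{F}\}$, and let $A=\langle G,H\rangle$ be the subgroup they generate; $\mathbb{F}$ is assumed large enough that $|\mathbb{F}|\ge|A|$. Put $h(X)=X^{|H|}$. Evaluation set. Since $|\mathbb{F}|\ge|A|$, there is $\alpha\in\mathbb{F}$ with trivial stabilizer in $A$; fix such an $\alpha$ and let $\Omega=\{\phi(\alpha):\phi\in A\}$, so $n:=|\Omega|=|A|$. Base-$u$ degree. For a nonconstant $u\in\mathbb{F}[X]$, every $f\in\mathbb{F}[X]$ has a unique expansion $f=\sum_i c_i u^i$ with $\deg c_i<\deg u$; $\deg_u(f):=\max_i\deg(c_i)$, with $\deg(0)=-\infty$. Code. For an integer $D\le n$, $\mathcal{W}_{r,D}=\{f\in\mathbb{F}[X]:\deg f<D,\ \deg_g(f)<r|G|,\ \deg_h(f)<r|H|\}$ and $\mathcal{C}(G,H;r,D)=\{(f(\beta))_{\beta\in\Omega}: f\in\mathcal{W}_{r,D}\}\subseteq\mathbb{F}^{\Omega}$.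 Graph and expander codes. The bipartite coset graph $\mathsf{B}(G,H)$ has left vertices the right cosets $G\phi$, right vertices the right cosets $H\phi$ ($\phi\in A$), and one edge for each $\phi\in A$, joining $G\phi$ to $H\phi$. Identifying $\phi\in A$ with $\phi(\alpha)\in\Omega$, edges are the code coordinates, left vertices are the $G$-orbits in $\Omega$ and right vertices are the $H$-orbits in $\Omega$. The left (resp. right) local code at an orbit $O$ is the Reed--Solomon code of evaluations on $O$ of polynomials of degree $<r|G|$ (resp. $<r|H|$). The Tanner code is the set of all $c\in\mathbb{F}^\Omega$ whose restriction to every $G$-orbit and every $H$-orbit in $\Omega$ lies in the corresponding local code. With $D=n$, "family of expander codes" means: $\mathcal{C}$ equals this Tanner code, and the second largest singular value of the normalized bi-adjacency matrix $\frac{1}{\sqrt{|G||H|}}\big(|G\phi\cap H\psi|\big)_{G\phi,H\psi}$ tends to $0$ as $p\to\infty$. The relative minimum distance is the minimum distance divided by the length. *)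

theory Defs
  imports
    "HOL-Algebra.Polynomial_Divisibility"
    "HOL-Algebra.Bij"
    "HOL-Algebra.Group_Action"
    "HOL-Algebra.Elementary_Groups"
    "HOL-Computational_Algebra.Primes"
    "HOL-Library.Extended_Real"
    "HOL-Library.Landau_Symbols"
    "Jordan_Normal_Form.Missing_VectorSpace"
    "Jordan_Normal_Form.Char_Poly"
begin

hide_const (open) Divisibility.prime

definition primes_at_top :: "nat filter" where
  "primes_at_top = inf at_top (principal {p. prime p})"

section \<open>Degrees\<close>

text \<open>Polynomials over a ring are the coefficient lists of \<^theory>\<open>HOL-Algebra.Polynomials\<close>, so the
  zero polynomial is \<open>[]\<close>. The library degree of \<open>[]\<close> is \<open>0\<close>; here it has to be \<open>-\<infinity>\<close>.\<close>

definition pdeg :: "'a list \<Rightarrow> ereal" where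
  "pdeg f = (if f = [] then -\<infinity> else ereal (real (Polynomials.degree f)))"

context ring
begin

definition is_base_expansion :: "'a list \<Rightarrow> 'a list \<Rightarrow> (nat \<Rightarrow> 'a list) \<Rightarrow> bool" where
  "is_base_expansion u f c \<longleftrightarrow>
     (\<forall>i. c i \<in> carrier (poly_ring R) \<and> pdeg (c i) < pdeg u) \<and>
     finite {i. c i \<noteq> []} \<and>
     f = (\<Oplus>\<^bsub>poly_ring R\<^esub> i \<in> {i. c i \<noteq> []}. c i \<otimes>\<^bsub>poly_ring R\<^esub> (u [^]\<^bsub>poly_ring R\<^esub> i))"

definition base_deg :: "'a list \<Rightarrow> 'a list \<Rightarrow> ereal" where
  "base_deg u f = (SUP i. pdeg ((THE c. is_base_expansion u f c) i))"


section \<open>The groups\<close>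

definition g_poly :: "nat \<Rightarrow> nat \<Rightarrow> 'a list" where
  "g_poly p m = X [^]\<^bsub>poly_ring R\<^esub> (p ^ m) \<oplus>\<^bsub>poly_ring R\<^esub> X [^]\<^bsub>poly_ring R\<^esub> p \<oplus>\<^bsub>poly_ring R\<^esub> X"

definition g_roots :: "nat \<Rightarrow> nat \<Rightarrow> 'a set" where
  "g_roots p m = {x \<in> carrier R. eval (g_poly p m) x = \<zero>}"

definition h_poly :: "'a set \<Rightarrow> 'a list" where
  "h_poly H = X [^]\<^bsub>poly_ring R\<^esub> card H"

definition AGL1 :: "('a \<Rightarrow> 'a) monoid" where
  "AGL1 = BijGroup (carrier R)
     \<lparr>carrier := {\<lambda>x\<in>carrier R. a \<otimes> x \<oplus> b | a b. a \<in> carrier R - {\<zero>} \<and> b \<in> carrier R}\<rparr>"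

definition translation_maps :: "'a set \<Rightarrow> ('a \<Rightarrow> 'a) set" where
  "translation_maps G = (\<lambda>a. \<lambda>x\<in>carrier R. x \<oplus> a) ` G"

definition scaling_maps :: "'a set \<Rightarrow> ('a \<Rightarrow> 'a) set" where
  "scaling_maps H = (\<lambda>c. \<lambda>x\<in>carrier R. c \<otimes> x) ` H"

definition aff_group :: "'a set \<Rightarrow> 'a set \<Rightarrow> ('a \<Rightarrow> 'a) monoid" where
  "aff_group G H = subgroup_generated AGL1 (translation_maps G \<union> scaling_maps H)"

definition eval_set :: "'a set \<Rightarrow> 'a set \<Rightarrow> 'a \<Rightarrow> 'a set" where
  "eval_set G H \<alpha> = orbit (aff_group G H) (\<lambda>\<phi>. \<phi>) \<alpha>"

definition left_orbits :: "'a set \<Rightarrow> 'a set \<Rightarrow> 'a \<Rightarrow> 'a set set" where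
  "left_orbits G H \<alpha> =
     orbits ((aff_group G H)\<lparr>carrier := translation_maps G\<rparr>) (eval_set G H \<alpha>) (\<lambda>\<phi>. \<phi>)"

definition right_orbits :: "'a set \<Rightarrow> 'a set \<Rightarrow> 'a \<Rightarrow> 'a set set" where
  "right_orbits G H \<alpha> =
     orbits ((aff_group G H)\<lparr>carrier := scaling_maps H\<rparr>) (eval_set G H \<alpha>) (\<lambda>\<phi>. \<phi>)"


section \<open>The codes\<close>

text \<open>A code of length \<open>card S\<close> is a set of extensional functions from the coordinate set \<open>S\<close> to the
  field, i.e. a subset of the carrier of \<^term>\<open>func_space S\<close>.\<close>

definition evaluations :: "'a set \<Rightarrow> 'a list set \<Rightarrow> ('a \<Rightarrow> 'a) set" where
  "evaluations S P = (\<lambda>f. \<lambda>x\<in>S. eval f x) ` P"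

definition RS_code :: "'a set \<Rightarrow> real \<Rightarrow> ('a \<Rightarrow> 'a) set" where
  "RS_code S k = evaluations S {f \<in> carrier (poly_ring R). pdeg f < ereal k}"

definition W_space :: "nat \<Rightarrow> nat \<Rightarrow> 'a set \<Rightarrow> real \<Rightarrow> nat \<Rightarrow> 'a list set" where
  "W_space p m H r D =
     {f \<in> carrier (poly_ring R). pdeg f < ereal (real D)
        \<and> base_deg (g_poly p m) f < ereal (r * real (card (g_roots p m)))
        \<and> base_deg (h_poly H) f < ereal (r * real (card H))}"

definition coset_code :: "nat \<Rightarrow> nat \<Rightarrow> 'a set \<Rightarrow> 'a \<Rightarrow> real \<Rightarrow> nat \<Rightarrow> ('a \<Rightarrow> 'a) set" where
  "coset_code p m H \<alpha> r D = evaluations (eval_set (g_roots p m) H \<alpha>) (W_space p m H r D)"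

definition tanner_code :: "'a set \<Rightarrow> 'a set \<Rightarrow> 'a \<Rightarrow> real \<Rightarrow> ('a \<Rightarrow> 'a) set" where
  "tanner_code G H \<alpha> r =
     {c \<in> eval_set G H \<alpha> \<rightarrow>\<^sub>E carrier R.
        (\<forall>S \<in> left_orbits G H \<alpha>. restrict c S \<in> RS_code S (r * real (card G))) \<and>
        (\<forall>S \<in> right_orbits G H \<alpha>. restrict c S \<in> RS_code S (r * real (card H)))}"

definition code_rate :: "'a set \<Rightarrow> ('a \<Rightarrow> 'a) set \<Rightarrow> real" where
  "code_rate S C = real (vectorspace.dim R ((func_space S)\<lparr>carrier := C\<rparr>)) / real (card S)"

end

definition min_dist :: "'b set \<Rightarrow> ('b \<Rightarrow> 'a) set \<Rightarrow> nat" where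
  "min_dist S C = Min {card {x \<in> S. c x \<noteq> d x} | c d. c \<in> C \<and> d \<in> C \<and> c \<noteq> d}"

definition rel_min_dist :: "'b set \<Rightarrow> ('b \<Rightarrow> 'a) set \<Rightarrow> real" where
  "rel_min_dist S C = real (min_dist S C) / real (card S)"


section \<open>Singular values\<close>

text \<open>Square roots of the eigenvalues of \<open>M\<^sup>T M\<close> with algebraic multiplicity, in decreasing order. The
  list has one entry per column, so for a matrix with fewer rows than columns it ends in additional
  zeros.\<close>

definition singular_values :: "real mat \<Rightarrow> real list" where
  "singular_values M =
     rev (sorted_list_of_multiset (image_mset sqrt (proots (char_poly (transpose_mat M * M)))))"

text \<open>A matrix is indexed by positions, so the cosets are enumerated by an arbitrary list; the
  singular values do not depend on this choice.\<close>

definition enumeration :: "'b set \<Rightarrow> 'b list" where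
  "enumeration S = (SOME xs. distinct xs \<and> set xs = S)"

definition (in ring) biadjacency :: "'a set \<Rightarrow> 'a set \<Rightarrow> real mat" where
  "biadjacency G H =
     (let A = aff_group G H;
          ls = enumeration (rcosets\<^bsub>A\<^esub> (translation_maps G));
          rs = enumeration (rcosets\<^bsub>A\<^esub> (scaling_maps H))
      in mat (length ls) (length rs)
           (\<lambda>(i, j). real (card (ls ! i \<inter> rs ! j)) / sqrt (real (card G) * real (card H))))"


section \<open>Standing assumptions on the ambient field\<close>

text \<open>\<open>R\<close> is a finite field of characteristic \<open>p\<close> over which the polynomial \<open>g\<close> splits and which
  contains the field \<open>K\<close> with \<open>p ^ m\<close> elements (unique as a subfield of \<open>R\<close>).\<close>

locale coset_code_setup = field R for R (structure) +
  fixes p m :: nat and K :: "'a set" and \<alpha> :: 'a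
  assumes p_prime: "prime p"
    and finite_carrier: "finite (carrier R)"
    and characteristic: "[p] \<cdot> \<one> = \<zero>"
    and contains_g_roots: "splitted (g_poly p m)"
    and K_subfield: "subfield K R"
    and K_card: "card K = p ^ m"
    and large: "Coset.order R \<ge> Coset.order (aff_group (g_roots p m) (K - {\<zero>}))"
    and \<alpha>_carrier: "\<alpha> \<in> carrier R"
    and \<alpha>_stabilizer:
      "stabilizer (aff_group (g_roots p m) (K - {\<zero>})) (\<lambda>\<phi>. \<phi>) \<alpha>
         = {\<one>\<^bsub>aff_group (g_roots p m) (K - {\<zero>})\<^esub>}"

end

theory Submission
  imports Defs
begin

text \<open>Write \<open>q = p\<^sup>m\<close> and let \<open>V\<close> be the \<open>K\<close>-span of \<open>G\<close>. On \<open>G\<close> the \<open>p\<close>-th power map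
  agrees with a \<open>K\<close>-linear map, so a basis
  of \<open>G\<close> over the prime field stays independent over \<open>K\<close> and \<open>|V| = q\<^sup>m\<close>. The group generated by \<open>G\<close> and \<open>H\<close>
  consists of the maps \<open>x \<mapsto> a x + b\<close> with \<open>a \<in> H\<close> and \<open>b \<in> V\<close>. The \<open>G\<close>-orbits and \<open>H\<close>-orbits are the fibres of
  \<open>g\<close> and \<open>h\<close> on the evaluation set; counting zeros of the coefficients of the base-\<open>u\<close> expansion
  (regrouped by powers of \<open>X\<close>) shows that a polynomial of degree below \<open>n\<close> has small base degree if and only if
  it restricts to a Reed-Solomon word on every fibre, so the code is the Tanner code.

  For expansion, let \<open>P\<^sub>a\<close> be the averaging operator over \<open>a G\<close> on functions on \<open>V\<close>. These are commuting orthogonal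
  projections, and for a joint eigenvector of mean zero the scalars \<open>a\<close> with \<open>P\<^sub>a x = x\<close> lie in a
  proper additive subgroup of \<open>K\<close>. Hence \<open>\<Sum>\<^sub>a |P\<^sub>a x|\<^sup>2 \<le> (q - 1)/p * |x|\<^sup>2\<close> for every \<open>x\<close> of mean zero, which bounds the second
  singular value by \<open>1 / sqrt p\<close>. The edge count of the expander mixing argument then gives the distance.

  For the rate, let \<open>\<phi>\<close> be the \<open>p\<close>-th and \<open>\<tau>\<close> the \<open>q\<close>-th power map. The polynomials \<open>L\<^sub>i\<^sub>j = \<phi>\<^sup>i (1 + \<tau>)\<^sup>j X\<close> with
  \<open>i < m\<close> and \<open>j \<le> m\<close> have the degrees \<open>p\<^sup>i\<^sup>+\<^sup>m\<^sup>j\<close>, so their products with exponents below \<open>p\<close> have pairwise distinct degrees.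
  Only \<open>2 m + 1\<close> of them have a base degree of order \<open>p\<^sup>m\<^sup>-\<^sup>1\<close>, and it suffices that the exponents of these
  add up to slightly less than \<open>r p\<close>, which holds for a fraction \<open>r\<^sup>2\<^sup>m\<^sup>+\<^sup>1 / (2 m + 1)!\<close> of all exponents.\<close>

section \<open>Frobenius maps\<close>

text \<open>Why the powers of \<open>1 + \<tau>\<close>: in base \<open>h\<close> every
  \<open>X^(p^i q^a)\<close> costs only \<open>p^i\<close>, so a combination of powers of
  \<open>\<tau>\<close> is as cheap as a single one, and base \<open>g\<close> dictates the choice.
  As \<open>\<tau> X\<close> is \<open>-(1 + \<phi>) X\<close> modulo \<open>g\<close>, the plain
  \<open>\<phi>^i \<tau>^j X\<close> would spread over all exponents from \<open>i\<close> to
  \<open>i + j\<close> and, for large p, meet the expensive \<open>X^(p^(m-1))\<close> for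
  quadratically many pairs \<open>(i, j)\<close>. The operator \<open>1 + \<tau>\<close> becomes the
  single term \<open>-\<phi>\<close>, which leaves only linearly many expensive pairs. The index
  range supplies m(m+1) digits in base p, and \<open>p^(m(m+1)) = q^(m+1)\<close> barely exceeds the
  length \<open>(q - 1) q^m\<close>; every degree below the length thus belongs to exactly one
  product. Costs add under multiplication, so one bound on the sum of the expensive exponents
  controls both base degrees, and the constant of the rate is the volume of the simplex x_1 + ... +
  x_(2m+1) <= r. Dimensions are obtained by counting: over a finite field the number of words
  determines the dimension, and no basis of a code is ever written down.\<close>

context cring
begin

lemma binomial_expansion:
  fixes n :: nat
  assumes x: "x \<in> carrier R" and y: "y \<in> carrier R"
  shows "(x \<oplus> y) [^] n = (\<Oplus>k\<in>{..n}. [(n choose k)] \<cdot> (x [^] k \<otimes> y [^] (n - k)))"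
proof (induction n)
  case 0
  then show ?case using x y by simp
next
  case (Suc n)
  define u where "u k = x [^] k \<otimes> y [^] (Suc n - k)" for k
  have uc [simp]: "u k \<in> carrier R" for k using x y by (simp add: u_def)
  let ?S = "\<Oplus>k\<in>{..n}. [(n choose k)] \<cdot> (x [^] k \<otimes> y [^] (n - k))"
  have tc: "[(n choose k)] \<cdot> (x [^] k \<otimes> y [^] (n - k)) \<in> carrier R" for k
    using x y by simp
  have Sc: "?S \<in> carrier R" using tc by (intro finsum_closed) auto
  have "(x \<oplus> y) [^] Suc n = ?S \<otimes> x \<oplus> ?S \<otimes> y"
    using Suc x y Sc by (simp add: r_distr)
  also have "?S \<otimes> x = (\<Oplus>k\<in>{..n}. ([(n choose k)] \<cdot> (x [^] k \<otimes> y [^] (n - k))) \<otimes> x)"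
    using tc x by (intro finsum_ldistr) auto
  also have "\<dots> = (\<Oplus>k\<in>{..n}. [(n choose k)] \<cdot> u (Suc k))"
    using x y by (intro finsum_cong') (auto simp: u_def add_pow_rdistr m_ac)
  also have "\<dots> = (\<Oplus>k\<in>{..Suc n}. if k = 0 then \<zero> else [(n choose (k - 1))] \<cdot> u k)"
    by (subst finsum_Suc2) auto
  also have "?S \<otimes> y = (\<Oplus>k\<in>{..n}. ([(n choose k)] \<cdot> (x [^] k \<otimes> y [^] (n - k))) \<otimes> y)"
    using tc y by (intro finsum_ldistr) auto
  also have "\<dots> = (\<Oplus>k\<in>{..n}. [(n choose k)] \<cdot> u k)"
    using x y by (intro finsum_cong') (auto simp: u_def add_pow_rdistr m_ac Suc_diff_le)
  also have "\<dots> = (\<Oplus>k\<in>{..Suc n}. [(n choose k)] \<cdot> u k)"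
    by (subst finsum_Suc) (auto intro!: finsum_closed simp: binomial_eq_0)
  also have "(\<Oplus>k\<in>{..Suc n}. if k = 0 then \<zero> else [(n choose (k - 1))] \<cdot> u k) \<oplus> \<dots>
      = (\<Oplus>k\<in>{..Suc n}. (if k = 0 then \<zero> else [(n choose (k - 1))] \<cdot> u k) \<oplus> [(n choose k)] \<cdot> u k)"
    by (subst finsum_addf) auto
  also have "\<dots> = (\<Oplus>k\<in>{..Suc n}. [(Suc n choose k)] \<cdot> u k)"
  proof (intro finsum_cong')
    fix k assume "k \<in> {..Suc n}"
    show "(if k = 0 then \<zero> else [(n choose (k - 1))] \<cdot> u k) \<oplus> [(n choose k)] \<cdot> u k
      = [(Suc n choose k)] \<cdot> u k"
      by (cases k) (auto simp: add.nat_pow_mult)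
  qed auto
  finally show ?case by (simp add: u_def)
qed

lemma add_pow_char_dvd:
  assumes "[p] \<cdot> \<one> = \<zero>" "p dvd k" "x \<in> carrier R"
  shows "[(k::nat)] \<cdot> x = \<zero>"
proof -
  obtain j where j: "k = p * j" using assms(2) by auto
  have "[p] \<cdot> x = ([p] \<cdot> \<one>) \<otimes> x"
    using assms(3) add_pow_ldistr[of \<one> x p] by simp
  then have "[p] \<cdot> x = \<zero>" using assms by simp
  then show ?thesis using assms(3) j add.nat_pow_pow[of x j p] by simp
qed

text \<open>All inner binomial coefficients are divisible by p. The setting is a commutative ring
  and not a field, since the rule is also applied in \<open>poly_ring R\<close>.\<close>

lemma frobenius_add:
  assumes p: "prime p" and char: "[p] \<cdot> \<one> = \<zero>"
    and x: "x \<in> carrier R" and y: "y \<in> carrier R"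
  shows "(x \<oplus> y) [^] p = x [^] p \<oplus> y [^] (p::nat)"
proof -
  have p0: "0 < p" using p prime_gt_0_nat by blast
  let ?t = "\<lambda>k. [(p choose k)] \<cdot> (x [^] k \<otimes> y [^] (p - k))"
  have tc: "?t k \<in> carrier R" for k using x y by simp
  have "(\<Oplus>k\<in>{..p}. ?t k) = (\<Oplus>k\<in>{0,p}. ?t k)"
  proof (rule add.finprod_mono_neutral_cong_right)
    fix i assume i: "i \<in> {..p} - {0,p}"
    have "p dvd (p choose i)" using i p by (intro dvd_choose_prime) auto
    then show "?t i = \<zero>" by (rule add_pow_char_dvd[OF char]) (use x y in simp)
  qed (use tc in auto)
  also have "\<dots> = x [^] p \<oplus> y [^] p" using x y p0 by (simp add: a_comm)
  finally show ?thesis using binomial_expansion[OF x y, of p] by simp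
qed

lemma frobenius_pow_add:
  assumes p: "prime p" and char: "[p] \<cdot> \<one> = \<zero>"
    and x: "x \<in> carrier R" and y: "y \<in> carrier R"
  shows "(x \<oplus> y) [^] (p ^ k) = x [^] (p ^ k) \<oplus> y [^] ((p::nat) ^ k)"
proof (induction k)
  case (Suc k)
  have "(x \<oplus> y) [^] (p ^ Suc k) = ((x \<oplus> y) [^] (p ^ k)) [^] p"
    using x y by (simp add: nat_pow_pow mult.commute)
  then show ?case using Suc x y by (simp add: frobenius_add[OF p char] nat_pow_pow mult.commute)
qed (use x y in simp)

lemma frobenius_hom:
  assumes p: "prime p" and char: "[p] \<cdot> \<one> = \<zero>"
  shows "ring_hom_ring R R (\<lambda>x. x [^] ((p::nat) ^ k))"
  by (rule ring_hom_ringI[OF ring_axioms ring_axioms])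
     (auto simp: nat_pow_distrib frobenius_pow_add[OF p char])

lemma frobenius_pow_minus:
  assumes p: "prime p" and char: "[p] \<cdot> \<one> = \<zero>"
    and x: "x \<in> carrier R" and y: "y \<in> carrier R"
  shows "(x \<ominus> y) [^] (p ^ k) = x [^] (p ^ k) \<ominus> y [^] ((p::nat) ^ k)"
proof -
  interpret ring_hom_ring R R "\<lambda>x. x [^] ((p::nat) ^ k)" by (rule frobenius_hom[OF p char])
  show ?thesis using x y by (simp add: a_minus_def)
qed

end

section \<open>Interpolation and base expansions\<close>

text \<open>From here on bounds are put on \<open>length\<close>, which is the degree plus one and
  covers the zero polynomial \<open>[]\<close> without a case distinction.\<close>

lemma pdeg_less_iff: "0 < k \<Longrightarrow> pdeg f < ereal k \<longleftrightarrow> real (length f) < k + 1"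
  by (cases f) (auto simp: pdeg_def)

lemma pdeg_less_pdeg_iff: "u \<noteq> [] \<Longrightarrow> pdeg f < pdeg u \<longleftrightarrow> length f < length u"
  by (cases f; cases u) (auto simp: pdeg_def)

context field
begin

lemma poly_ring_domain: "domain (poly_ring R)"
  by (rule univ_poly_is_domain[OF carrier_is_subring])

lemma poly_ring_simps:
  "\<zero>\<^bsub>poly_ring R\<^esub> = []" "\<one>\<^bsub>poly_ring R\<^esub> = [\<one>]"
  "x \<oplus>\<^bsub>poly_ring R\<^esub> y = poly_add x y" "x \<otimes>\<^bsub>poly_ring R\<^esub> y = poly_mult x y"
  by (auto simp: univ_poly_zero univ_poly_one univ_poly_add univ_poly_mult)

lemma poly_ring_closed [simp]:
  assumes "f \<in> carrier (poly_ring R)"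
  shows "f [^]\<^bsub>poly_ring R\<^esub> (n::nat) \<in> carrier (poly_ring R)"
    and "\<ominus>\<^bsub>poly_ring R\<^esub> f \<in> carrier (poly_ring R)"
    and "g \<in> carrier (poly_ring R) \<Longrightarrow> f \<oplus>\<^bsub>poly_ring R\<^esub> g \<in> carrier (poly_ring R)"
    and "g \<in> carrier (poly_ring R) \<Longrightarrow> f \<otimes>\<^bsub>poly_ring R\<^esub> g \<in> carrier (poly_ring R)"
    and "g \<in> carrier (poly_ring R) \<Longrightarrow> f \<ominus>\<^bsub>poly_ring R\<^esub> g \<in> carrier (poly_ring R)"
proof -
  interpret P: domain "poly_ring R" by (rule poly_ring_domain)
  show "f [^]\<^bsub>poly_ring R\<^esub> (n::nat) \<in> carrier (poly_ring R)"
    and "\<ominus>\<^bsub>poly_ring R\<^esub> f \<in> carrier (poly_ring R)"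
    and "g \<in> carrier (poly_ring R) \<Longrightarrow> f \<oplus>\<^bsub>poly_ring R\<^esub> g \<in> carrier (poly_ring R)"
    and "g \<in> carrier (poly_ring R) \<Longrightarrow> f \<otimes>\<^bsub>poly_ring R\<^esub> g \<in> carrier (poly_ring R)"
    and "g \<in> carrier (poly_ring R) \<Longrightarrow> f \<ominus>\<^bsub>poly_ring R\<^esub> g \<in> carrier (poly_ring R)"
    using assms by auto
qed

lemma poly_ring_const_closed [simp]:
  "[] \<in> carrier (poly_ring R)" "[\<one>] \<in> carrier (poly_ring R)"
  by (auto simp: univ_poly_carrier[symmetric] polynomial_def)

lemma poly_Nil_simps [simp]:
  assumes "f \<in> carrier (poly_ring R)"
  shows "f \<oplus>\<^bsub>poly_ring R\<^esub> [] = f" "[] \<oplus>\<^bsub>poly_ring R\<^esub> f = f"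
    "f \<otimes>\<^bsub>poly_ring R\<^esub> [] = []" "[] \<otimes>\<^bsub>poly_ring R\<^esub> f = []"
proof -
  interpret P: domain "poly_ring R" by (rule poly_ring_domain)
  show "f \<oplus>\<^bsub>poly_ring R\<^esub> [] = f" "[] \<oplus>\<^bsub>poly_ring R\<^esub> f = f"
    "f \<otimes>\<^bsub>poly_ring R\<^esub> [] = []" "[] \<otimes>\<^bsub>poly_ring R\<^esub> f = []"
    using P.r_zero[OF assms] P.l_zero[OF assms] P.r_null[OF assms] P.l_null[OF assms]
    by (simp_all add: poly_ring_simps(1))
qed

lemma poly_carrier_set: "f \<in> carrier (poly_ring R) \<Longrightarrow> set f \<subseteq> carrier R"
  using univ_poly_carrier polynomial_incl by blast

lemma eval_closed [simp]:
  "\<lbrakk>f \<in> carrier (poly_ring R); x \<in> carrier R\<rbrakk> \<Longrightarrow> eval f x \<in> carrier R"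
  using eval_in_carrier poly_carrier_set by blast

lemma eval_add [simp]:
  "\<lbrakk>f \<in> carrier (poly_ring R); g \<in> carrier (poly_ring R); x \<in> carrier R\<rbrakk>
    \<Longrightarrow> eval (f \<oplus>\<^bsub>poly_ring R\<^esub> g) x = eval f x \<oplus> eval g x"
  using eval_poly_add poly_carrier_set by (simp add: univ_poly_add)

lemma eval_mult [simp]:
  "\<lbrakk>f \<in> carrier (poly_ring R); g \<in> carrier (poly_ring R); x \<in> carrier R\<rbrakk>
    \<Longrightarrow> eval (f \<otimes>\<^bsub>poly_ring R\<^esub> g) x = eval f x \<otimes> eval g x"
  using eval_poly_mult poly_carrier_set by (simp add: univ_poly_mult)

lemma eval_minus [simp]:
  assumes "f \<in> carrier (poly_ring R)" "g \<in> carrier (poly_ring R)" "x \<in> carrier R"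
  shows "eval (f \<ominus>\<^bsub>poly_ring R\<^esub> g) x = eval f x \<ominus> eval g x"
proof -
  interpret ev: ring_hom_ring "poly_ring R" R "\<lambda>f. eval f x"
    by (rule eval_ring_hom[OF carrier_is_subring assms(3)])
  show ?thesis using assms by (simp add: a_minus_def)
qed

lemma eval_pow [simp]:
  assumes "f \<in> carrier (poly_ring R)" "x \<in> carrier R"
  shows "eval (f [^]\<^bsub>poly_ring R\<^esub> (n::nat)) x = eval f x [^] n"
proof -
  interpret P: domain "poly_ring R" by (rule poly_ring_domain)
  show ?thesis
    by (induction n) (use assms in \<open>auto simp: poly_ring_simps(2)\<close>)
qed

lemma length_add_le: "length (f \<oplus>\<^bsub>poly_ring R\<^esub> g) \<le> max (length f) (length g)"
  using poly_add_length_le by (simp add: univ_poly_add)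

lemma length_minus_le:
  assumes "g \<in> carrier (poly_ring R)"
  shows "length (f \<ominus>\<^bsub>poly_ring R\<^esub> g) \<le> max (length f) (length g)"
  using length_add_le[of f "\<ominus>\<^bsub>poly_ring R\<^esub> g"]
    univ_poly_a_inv_length[OF carrier_is_subring assms] by (simp add: a_minus_def)

lemma length_mult:
  assumes "f \<in> carrier (poly_ring R)" "g \<in> carrier (poly_ring R)" "f \<noteq> []" "g \<noteq> []"
  shows "length (f \<otimes>\<^bsub>poly_ring R\<^esub> g) = length f + length g - 1"
    and "f \<otimes>\<^bsub>poly_ring R\<^esub> g \<noteq> []"
proof -
  show ne: "f \<otimes>\<^bsub>poly_ring R\<^esub> g \<noteq> []"
    using domain.integral_iff[OF poly_ring_domain] assms by (auto simp: poly_ring_simps(1))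
  have "Polynomials.degree (f \<otimes>\<^bsub>poly_ring R\<^esub> g) = Polynomials.degree f + Polynomials.degree g"
    using poly_mult_degree_eq[OF carrier_is_subring, of f g] assms univ_poly_carrier
    by (auto simp: univ_poly_mult)
  moreover have "length f > 0" "length g > 0" "length (f \<otimes>\<^bsub>poly_ring R\<^esub> g) > 0"
    using assms ne by auto
  ultimately show "length (f \<otimes>\<^bsub>poly_ring R\<^esub> g) = length f + length g - 1" by linarith
qed

lemma mult_Nil_iff:
  assumes "f \<in> carrier (poly_ring R)" "g \<in> carrier (poly_ring R)"
  shows "f \<otimes>\<^bsub>poly_ring R\<^esub> g = [] \<longleftrightarrow> f = [] \<or> g = []"
  using domain.integral_iff[OF poly_ring_domain] assms by (auto simp: poly_ring_simps(1))

lemma length_mult_le: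
  assumes "f \<in> carrier (poly_ring R)" "g \<in> carrier (poly_ring R)"
  shows "length (f \<otimes>\<^bsub>poly_ring R\<^esub> g) \<le> length f + length g - 1"
  using length_mult(1)[OF assms] mult_Nil_iff[OF assms] by (cases "f = [] \<or> g = []") auto

lemma card_zeros_less:
  assumes f: "f \<in> carrier (poly_ring R)" "f \<noteq> []"
  shows "finite {x \<in> carrier R. eval f x = \<zero>}"
    and "card {x \<in> carrier R. eval f x = \<zero>} < length f"
proof -
  have eq: "{x \<in> carrier R. eval f x = \<zero>} = set_mset (roots f)"
    using roots_mem_iff_is_root[OF f(1)] f by (auto simp: is_root_def)
  show "finite {x \<in> carrier R. eval f x = \<zero>}" unfolding eq by simp
  have "card (set_mset (roots f)) \<le> size (roots f)"
    by (metis mset_set_set_mset_msubset size_mset_mono size_mset_set)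
  also have "\<dots> \<le> Polynomials.degree f" by (rule size_roots_le_degree[OF f(1)])
  also have "\<dots> < length f" using f by (cases f) auto
  finally show "card {x \<in> carrier R. eval f x = \<zero>} < length f" unfolding eq .
qed

lemma poly_zero_if_many_zeros:
  assumes f: "f \<in> carrier (poly_ring R)" and S: "S \<subseteq> carrier R" "finite S"
    and "length f \<le> card S" and "\<And>x. x \<in> S \<Longrightarrow> eval f x = \<zero>"
  shows "f = []"
proof (rule ccontr)
  assume "f \<noteq> []"
  from card_zeros_less[OF f this] have "card S < length f"
    using card_mono[of "{x \<in> carrier R. eval f x = \<zero>}" S] assms by fastforce
  then show False using assms by simp
qed

lemma poly_eq_if_agree:
  assumes f: "f \<in> carrier (poly_ring R)" and g: "g \<in> carrier (poly_ring R)"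
    and S: "S \<subseteq> carrier R" "finite S"
    and len: "length f \<le> card S" "length g \<le> card S"
    and agree: "\<And>x. x \<in> S \<Longrightarrow> eval f x = eval g x"
  shows "f = g"
proof -
  interpret P: domain "poly_ring R" by (rule poly_ring_domain)
  have "f \<ominus>\<^bsub>poly_ring R\<^esub> g = []"
    using f g S agree len length_minus_le[OF g, of f]
    by (intro poly_zero_if_many_zeros[OF _ S]) (auto simp: subset_iff)
  then show ?thesis using f g P.r_right_minus_eq by (simp add: poly_ring_simps(1))
qed

lemma poly_of_const_closed [simp]: "a \<in> carrier R \<Longrightarrow> poly_of_const a \<in> carrier (poly_ring R)"
  using ring_hom_closed[OF canonical_embedding_is_hom[OF carrier_is_subring]] by simp

lemma eval_poly_of_const [simp]: "a \<in> carrier R \<Longrightarrow> eval (poly_of_const a) x = a"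
  by (auto simp: poly_of_const_def)

lemma length_poly_of_const_le: "length (poly_of_const a) \<le> 1"
  by (auto simp: poly_of_const_def)

lemma lin_closed: "a \<in> carrier R \<Longrightarrow> [\<one>, \<ominus> a] \<in> carrier (poly_ring R)"
  by (simp add: univ_poly_carrier[symmetric] polynomial_def)

lemma var_poly_closed [simp]: "X \<in> carrier (poly_ring R)"
  by (rule var_closed(1)[OF carrier_is_subring])

lemma interpolation_exists:
  assumes "finite S" "S \<subseteq> carrier R" "\<And>x. x \<in> S \<Longrightarrow> c x \<in> carrier R"
  shows "\<exists>f \<in> carrier (poly_ring R). length f \<le> card S \<and> (\<forall>x\<in>S. eval f x = c x)"
proof -
  interpret P: domain "poly_ring R" by (rule poly_ring_domain)
  \<comment> \<open>Newton interpolation: the induction carries along a polynomial \<open>z\<close>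
    that vanishes exactly on \<open>S\<close>. At a new point \<open>a\<close> the value of
    \<open>z\<close> is invertible, so a multiple of \<open>z\<close> corrects \<open>f\<close>
    there without disturbing the old values.\<close>
  have "\<exists>f \<in> carrier (poly_ring R). \<exists>z \<in> carrier (poly_ring R).
      length f \<le> card S \<and> length z = card S + 1 \<and> (\<forall>x\<in>S. eval f x = c x)
      \<and> (\<forall>x\<in>carrier R. eval z x = \<zero> \<longleftrightarrow> x \<in> S)"
    using assms
  proof (induction S rule: finite_induct)
    case empty
    then show ?case
      by (intro bexI[of _ "[]"] bexI[of _ "[\<one>]"])
         (auto simp: univ_poly_carrier[symmetric] polynomial_def)
  next
    case (insert a S)
    then obtain f z where fz: "f \<in> carrier (poly_ring R)" "z \<in> carrier (poly_ring R)"
      "length f \<le> card S" "length z = card S + 1" "\<forall>x\<in>S. eval f x = c x"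
      "\<forall>x\<in>carrier R. eval z x = \<zero> \<longleftrightarrow> x \<in> S" by auto
    have a: "a \<in> carrier R" and ca: "c a \<in> carrier R" and S: "S \<subseteq> carrier R"
      using insert.prems by auto
    have za: "eval z a \<noteq> \<zero>" using fz(6) a insert.hyps by auto
    define t where "t = (c a \<ominus> eval f a) \<otimes> inv (eval z a)"
    have zaU: "eval z a \<in> Units R" using za a fz(2) by (simp add: field_Units)
    have tc: "t \<in> carrier R" using a ca fz zaU by (simp add: t_def)
    define f' where "f' = f \<oplus>\<^bsub>poly_ring R\<^esub> (poly_of_const t \<otimes>\<^bsub>poly_ring R\<^esub> z)"
    define z' where "z' = [\<one>, \<ominus> a] \<otimes>\<^bsub>poly_ring R\<^esub> z"
    have ev: "eval f' x = eval f x \<oplus> t \<otimes> eval z x" if "x \<in> carrier R" for x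
      using that fz tc by (simp add: f'_def)
    have tz: "t \<otimes> eval z a = c a \<ominus> eval f a"
      using zaU a ca fz by (simp add: t_def m_assoc)
    show ?case
    proof (rule bexI[of _ f'], rule bexI[of _ z'], intro conjI ballI)
      show "length f' \<le> card (insert a S)"
        using length_add_le[of f "poly_of_const t \<otimes>\<^bsub>poly_ring R\<^esub> z"]
          length_mult_le[of "poly_of_const t" z] length_poly_of_const_le[of t] fz tc insert.hyps
        by (auto simp: f'_def)
      show "length z' = card (insert a S) + 1"
      proof -
        have "z \<noteq> []" using fz(4) by auto
        then show ?thesis
          using length_mult(1)[OF lin_closed[OF a] fz(2)] fz(4) insert.hyps by (simp add: z'_def)
      qed
      show "eval f' x = c x" if "x \<in> insert a S" for x
      proof (cases "x = a")
        case True
        have "eval f a \<oplus> (c a \<ominus> eval f a) = c a"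
          using a ca fz(1) by (simp add: a_minus_def a_lcomm r_neg)
        then show ?thesis using True tz ev[OF a] by simp
      next
        case False
        then have "x \<in> S" using that by simp
        then have "eval z x = \<zero>" "x \<in> carrier R" "eval f x = c x" using fz(5,6) S by auto
        then show ?thesis using ev[of x] tc insert.prems(2)[of x] \<open>x \<in> S\<close> by simp
      qed
      show "(eval z' x = \<zero>) = (x \<in> insert a S)" if x: "x \<in> carrier R" for x
      proof -
        have "eval [\<one>, \<ominus> a] x = x \<ominus> a" using a x by (simp add: a_minus_def)
        then have "eval z' x = (x \<ominus> a) \<otimes> eval z x"
          using x fz(2) lin_closed[OF a] by (simp only: z'_def eval_mult)
        then show ?thesis using x a fz by (simp add: integral_iff)
      qed
      show "z' \<in> carrier (poly_ring R)"
        using lin_closed[OF a] fz(2) by (simp add: z'_def)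
      show "f' \<in> carrier (poly_ring R)" using fz tc by (simp add: f'_def)
    qed
  qed
  then show ?thesis by blast
qed

text \<open>A base-\<open>u\<close> expansion as a list of digits, lowest first, with no bound on
  the digits. The Horner form turns statements about expansions into list inductions and also makes
  sense when \<open>u\<close> is replaced by a constant.\<close>

fun horner :: "'a list \<Rightarrow> 'a list list \<Rightarrow> 'a list" where
  "horner u [] = []"
| "horner u (c # cs) = c \<oplus>\<^bsub>poly_ring R\<^esub> (u \<otimes>\<^bsub>poly_ring R\<^esub> horner u cs)"

lemma horner_closed [simp]:
  "\<lbrakk>u \<in> carrier (poly_ring R); set cs \<subseteq> carrier (poly_ring R)\<rbrakk> \<Longrightarrow> horner u cs \<in> carrier (poly_ring R)"
proof -
  interpret P: domain "poly_ring R" by (rule poly_ring_domain)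
  show "\<lbrakk>u \<in> carrier (poly_ring R); set cs \<subseteq> carrier (poly_ring R)\<rbrakk> \<Longrightarrow> horner u cs \<in> carrier (poly_ring R)"
    by (induction cs) (auto simp: univ_poly_zero_closed)
qed

lemma horner_snoc:
  assumes "u \<in> carrier (poly_ring R)" "set cs \<subseteq> carrier (poly_ring R)" "d \<in> carrier (poly_ring R)"
  shows "horner u (cs @ [d]) = horner u cs \<oplus>\<^bsub>poly_ring R\<^esub> (d \<otimes>\<^bsub>poly_ring R\<^esub> u [^]\<^bsub>poly_ring R\<^esub> length cs)"
proof -
  interpret P: domain "poly_ring R" by (rule poly_ring_domain)
  show ?thesis using assms
    by (induction cs) (auto simp: P.a_assoc P.r_distr P.m_ac)
qed

lemma horner_eq_finsum:
  assumes "u \<in> carrier (poly_ring R)" "\<And>i. c i \<in> carrier (poly_ring R)"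
  shows "horner u (map c [0..<N])
    = (\<Oplus>\<^bsub>poly_ring R\<^esub> i\<in>{..<N}. c i \<otimes>\<^bsub>poly_ring R\<^esub> u [^]\<^bsub>poly_ring R\<^esub> i)"
proof -
  interpret P: domain "poly_ring R" by (rule poly_ring_domain)
  have [simp]: "set (map c xs) \<subseteq> carrier (poly_ring R)" for xs using assms(2) by auto
  show ?thesis
  proof (induction N)
    case (Suc N)
    then show ?case
      using assms horner_snoc[OF assms(1), of "map c [0..<N]" "c N"]
      by (auto simp: lessThan_Suc P.a_comm)
  qed (simp add: poly_ring_simps(1))
qed

lemma is_base_expansion_horner:
  assumes u: "u \<in> carrier (poly_ring R)" "u \<noteq> []" and "is_base_expansion u f c"
  obtains N where "\<And>i. N \<le> i \<Longrightarrow> c i = []" "f = horner u (map c [0..<N])"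
proof -
  interpret P: domain "poly_ring R" by (rule poly_ring_domain)
  have c: "c i \<in> carrier (poly_ring R)" and fin: "finite {i. c i \<noteq> []}" for i
    using assms(3) by (auto simp: is_base_expansion_def)
  obtain N where N: "{i. c i \<noteq> []} \<subseteq> {..<N}" using fin finite_nat_iff_bounded by auto
  have "f = (\<Oplus>\<^bsub>poly_ring R\<^esub> i\<in>{i. c i \<noteq> []}. c i \<otimes>\<^bsub>poly_ring R\<^esub> u [^]\<^bsub>poly_ring R\<^esub> i)"
    using assms(3) by (simp add: is_base_expansion_def)
  also have "\<dots> = (\<Oplus>\<^bsub>poly_ring R\<^esub> i\<in>{..<N}. c i \<otimes>\<^bsub>poly_ring R\<^esub> u [^]\<^bsub>poly_ring R\<^esub> i)"
  proof (rule P.add.finprod_mono_neutral_cong_left)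
    fix i assume "i \<in> {..<N} - {i. c i \<noteq> []}"
    then have "c i = \<zero>\<^bsub>poly_ring R\<^esub>" by (simp add: poly_ring_simps(1))
    then show "c i \<otimes>\<^bsub>poly_ring R\<^esub> u [^]\<^bsub>poly_ring R\<^esub> i = \<zero>\<^bsub>poly_ring R\<^esub>" using u by simp
  qed (use N c u in auto)
  also have "\<dots> = horner u (map c [0..<N])" using horner_eq_finsum[OF u(1), of c N] c by simp
  finally show thesis using N by (intro that[of N]) auto
qed

text \<open>The difference of the two remainders is a multiple of \<open>u\<close> that is shorter
  than \<open>u\<close>, hence zero.\<close>

lemma division_unique:
  assumes u: "u \<in> carrier (poly_ring R)" "u \<noteq> []"
    and c: "c \<in> carrier (poly_ring R)" "d \<in> carrier (poly_ring R)" "length c < length u" "length d < length u"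
    and h: "h \<in> carrier (poly_ring R)" "k \<in> carrier (poly_ring R)"
    and eq: "c \<oplus>\<^bsub>poly_ring R\<^esub> (u \<otimes>\<^bsub>poly_ring R\<^esub> h) = d \<oplus>\<^bsub>poly_ring R\<^esub> (u \<otimes>\<^bsub>poly_ring R\<^esub> k)"
  shows "c = d \<and> h = k"
proof -
  interpret P: domain "poly_ring R" by (rule poly_ring_domain)
  let ?e = "h \<ominus>\<^bsub>poly_ring R\<^esub> k"
  have "u \<otimes>\<^bsub>poly_ring R\<^esub> ?e = d \<ominus>\<^bsub>poly_ring R\<^esub> c"
  proof -
    have "u \<otimes>\<^bsub>poly_ring R\<^esub> ?e \<oplus>\<^bsub>poly_ring R\<^esub> (c \<oplus>\<^bsub>poly_ring R\<^esub> u \<otimes>\<^bsub>poly_ring R\<^esub> k) = c \<oplus>\<^bsub>poly_ring R\<^esub> (u \<otimes>\<^bsub>poly_ring R\<^esub> h)"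
      using u c h by algebra
    also note eq
    also have "d \<oplus>\<^bsub>poly_ring R\<^esub> (u \<otimes>\<^bsub>poly_ring R\<^esub> k) = (d \<ominus>\<^bsub>poly_ring R\<^esub> c) \<oplus>\<^bsub>poly_ring R\<^esub> (c \<oplus>\<^bsub>poly_ring R\<^esub> u \<otimes>\<^bsub>poly_ring R\<^esub> k)"
      using u c h by algebra
    finally show ?thesis using u c h by (subst (asm) P.add.right_cancel) auto
  qed
  moreover have "length (d \<ominus>\<^bsub>poly_ring R\<^esub> c) < length u"
    using length_minus_le[OF c(1), of d] c by linarith
  moreover have "length (u \<otimes>\<^bsub>poly_ring R\<^esub> ?e) \<ge> length u" if "?e \<noteq> []"
    using length_mult(1)[OF u(1) P.minus_closed[OF h] u(2) that] that by (cases ?e) auto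
  ultimately have e: "?e = []" by fastforce
  then have hk: "h = k" using P.r_right_minus_eq[OF h] by (simp add: poly_ring_simps(1))
  then have "c = d" using eq u c h by (simp add: P.add.right_cancel)
  then show ?thesis using hk by simp
qed

lemma horner_inj:
  assumes u: "u \<in> carrier (poly_ring R)" "u \<noteq> []"
  shows "length cs = length ds \<Longrightarrow>
    set cs \<subseteq> {c \<in> carrier (poly_ring R). length c < length u} \<Longrightarrow>
    set ds \<subseteq> {c \<in> carrier (poly_ring R). length c < length u} \<Longrightarrow>
    horner u cs = horner u ds \<Longrightarrow> cs = ds"
proof (induction cs ds rule: list_induct2)
  case (Cons c cs d ds)
  have sub: "set cs \<subseteq> carrier (poly_ring R)" "set ds \<subseteq> carrier (poly_ring R)"
    using Cons.prems by auto
  have "c = d \<and> horner u cs = horner u ds"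
    using Cons.prems sub u by (intro division_unique[of u]) auto
  then show ?case using Cons by auto
qed simp

text \<open>Each of \<open>M\<close> long divisions strips one digit. The number of digits is fixed
  in advance by the length of \<open>f\<close>, because the fibre argument has to compare it with
  the number of fibres.\<close>

lemma horner_expansion_exists:
  assumes u: "u \<in> carrier (poly_ring R)" "u \<noteq> []"
  shows "f \<in> carrier (poly_ring R) \<Longrightarrow> length f \<le> M * Polynomials.degree u \<Longrightarrow>
    \<exists>cs. length cs = M \<and> set cs \<subseteq> {c \<in> carrier (poly_ring R). length c < length u} \<and> f = horner u cs"
proof (induction M arbitrary: f)
  case 0
  then show ?case by auto
next
  case (Suc M)
  interpret P: domain "poly_ring R" by (rule poly_ring_domain)
  let ?q = "f pdiv u" and ?r = "f pmod u"
  have q: "?q \<in> carrier (poly_ring R)" and r: "?r \<in> carrier (poly_ring R)"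
    using long_division_closed[OF carrier_is_subfield Suc.prems(1) u(1)] by auto
  have feq: "f = (u \<otimes>\<^bsub>poly_ring R\<^esub> ?q) \<oplus>\<^bsub>poly_ring R\<^esub> ?r"
    by (rule pdiv_pmod[OF carrier_is_subfield Suc.prems(1) u(1)])
  have rlen: "length ?r < length u"
    using pmod_degree[OF carrier_is_subfield Suc.prems(1) u] u(2) by (cases ?r; cases u) auto
  have "length ?q \<le> M * Polynomials.degree u"
  proof (cases "?q = []")
    case False
    have "u \<otimes>\<^bsub>poly_ring R\<^esub> ?q = f \<ominus>\<^bsub>poly_ring R\<^esub> ?r"
      using arg_cong[OF feq, of "\<lambda>z. z \<ominus>\<^bsub>poly_ring R\<^esub> ?r"] u q r
      by (simp add: a_minus_def P.a_assoc P.r_neg)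
    then have "length (u \<otimes>\<^bsub>poly_ring R\<^esub> ?q) \<le> max (length f) (length ?r)"
      using length_minus_le[OF r] by simp
    moreover have "length (u \<otimes>\<^bsub>poly_ring R\<^esub> ?q) = length u + length ?q - 1"
      using length_mult(1)[OF u(1) q u(2) False] .
    moreover have "length ?q > 0" "length u > 0" using False u by auto
    ultimately have "Polynomials.degree u + length ?q \<le> length f" using rlen by arith
    then show ?thesis using Suc.prems(2) by simp
  qed auto
  from Suc.IH[OF q this] obtain cs where cs: "length cs = M"
    "set cs \<subseteq> {c \<in> carrier (poly_ring R). length c < length u}" "?q = horner u cs" by auto
  have "f = horner u (?r # cs)" using feq u q r by (simp add: cs(3)[symmetric] P.a_comm)
  then show ?case using cs r rlen by (intro exI[of _ "?r # cs"]) auto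
qed

lemma horner_append_zeros:
  assumes "u \<in> carrier (poly_ring R)" "set cs \<subseteq> carrier (poly_ring R)"
  shows "horner u (cs @ replicate n []) = horner u cs"
proof -
  interpret P: domain "poly_ring R" by (rule poly_ring_domain)
  have [simp]: "horner u (replicate n []) = []" for n
    using assms(1) by (induction n) auto
  show ?thesis by (induction cs) auto
qed

text \<open>\<open>base_deg\<close> refers to the expansion through \<open>THE\<close> and to the
  digits through a supremum over all indices. Uniqueness of the expansion removes the first, and
  finiteness of the set of digit degrees turns the supremum into a maximum, so that a strict bound
  can be checked digit by digit.\<close>

lemma base_deg_less_iff:
  assumes u: "u \<in> carrier (poly_ring R)" "u \<noteq> []"
    and cs: "set cs \<subseteq> {c \<in> carrier (poly_ring R). length c < length u}" and k: "0 < k"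
  shows "base_deg u (horner u cs) < ereal k \<longleftrightarrow> (\<forall>c\<in>set cs. real (length c) < k + 1)"
proof -
  interpret P: domain "poly_ring R" by (rule poly_ring_domain)
  define c0 where "c0 i = (if i < length cs then cs ! i else [])" for i
  have c0: "c0 i \<in> carrier (poly_ring R)" "length (c0 i) < length u" for i
    using subsetD[OF cs nth_mem[of i cs]] u P.zero_closed by (auto simp: c0_def poly_ring_simps(1))
  have map0: "map c0 [0..<N] = cs @ replicate (N - length cs) []" if "length cs \<le> N" for N
    using that by (intro nth_equalityI) (auto simp: c0_def nth_append)
  have unique: "c = c0" if e: "is_base_expansion u (horner u cs) c" for c
  proof -
    obtain N where N: "\<And>i. N \<le> i \<Longrightarrow> c i = []" "horner u cs = horner u (map c [0..<N])"
      using is_base_expansion_horner[OF u e] by auto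
    have cl: "c i \<in> carrier (poly_ring R)" "length (c i) < length u" for i
      using e u by (auto simp: is_base_expansion_def pdeg_less_pdeg_iff)
    \<comment> \<open>Padding with zero digits brings both expansions to a common length, as
      \<open>horner_inj\<close> requires.\<close>
    let ?M = "max N (length cs)"
    have 1: "map c [0..<?M] = map c [0..<N] @ replicate (?M - N) []"
      using N(1) by (intro nth_equalityI) (auto simp: nth_append)
    have "horner u (map c [0..<?M]) = horner u cs"
      unfolding 1 N(2) using cl u by (intro horner_append_zeros) auto
    also have "\<dots> = horner u (map c0 [0..<?M])"
    proof -
      have "set cs \<subseteq> carrier (poly_ring R)" using cs by auto
      then show ?thesis by (subst map0) (simp_all add: horner_append_zeros[OF u(1)])
    qed
    finally have eq: "map c [0..<?M] = map c0 [0..<?M]"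
      using cl c0 by (intro horner_inj[OF u]) auto
    show ?thesis
    proof
      fix i
      show "c i = c0 i"
      proof (cases "i < ?M")
        case True
        then show ?thesis using arg_cong[OF eq, of "\<lambda>l. l ! i"] by simp
      next
        case False
        then show ?thesis using N(1)[of i] by (auto simp: c0_def)
      qed
    qed
  qed
  have fin: "finite {i. c0 i \<noteq> []}"
    by (rule finite_subset[of _ "{..<length cs}"]) (auto simp: c0_def)
  have "is_base_expansion u (horner u cs) c0"
  proof -
    let ?t = "\<lambda>i. c0 i \<otimes>\<^bsub>poly_ring R\<^esub> u [^]\<^bsub>poly_ring R\<^esub> i"
    have "horner u cs = horner u (map c0 [0..<length cs])" using map0[of "length cs"] by simp
    also have "\<dots> = (\<Oplus>\<^bsub>poly_ring R\<^esub> i\<in>{..<length cs}. ?t i)"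
      using c0 u by (intro horner_eq_finsum) auto
    also have "\<dots> = (\<Oplus>\<^bsub>poly_ring R\<^esub> i\<in>{i. c0 i \<noteq> []}. ?t i)"
    proof (rule P.add.finprod_mono_neutral_cong_right)
      fix i assume "i \<in> {..<length cs} - {i. c0 i \<noteq> []}"
      then have "c0 i = \<zero>\<^bsub>poly_ring R\<^esub>" by (simp add: poly_ring_simps(1))
      then show "?t i = \<zero>\<^bsub>poly_ring R\<^esub>" using u by simp
    qed (use c0 u in \<open>auto simp: c0_def split: if_splits\<close>)
    finally show ?thesis
      using c0 u fin by (simp add: is_base_expansion_def pdeg_less_pdeg_iff)
  qed
  from this unique have "(THE c. is_base_expansion u (horner u cs) c) = c0"
    by (rule the_equality)
  then have bd: "base_deg u (horner u cs) = (SUP i. pdeg (c0 i))" by (simp add: base_deg_def)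
  \<comment> \<open>The value \<open>-\<infinity>\<close> is always attained, by the zero digits
    beyond the end of \<open>cs\<close>.\<close>
  have rng: "range (\<lambda>i. pdeg (c0 i)) = insert (-\<infinity>) (pdeg ` set cs)"
  proof (intro equalityI subsetI)
    fix y assume "y \<in> range (\<lambda>i. pdeg (c0 i))"
    then show "y \<in> insert (-\<infinity>) (pdeg ` set cs)"
      by (auto simp: c0_def pdeg_def[of "[]"])
  next
    fix y assume "y \<in> insert (-\<infinity>) (pdeg ` set cs)"
    then consider "y = -\<infinity>" | c where "c \<in> set cs" "y = pdeg c" by auto
    then show "y \<in> range (\<lambda>i. pdeg (c0 i))"
    proof cases
      case 1
      then have "y = pdeg (c0 (length cs))" by (simp add: c0_def pdeg_def)
      then show ?thesis by blast
    next
      case 2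
      then obtain i where "i < length cs" "cs ! i = c" by (auto simp: in_set_conv_nth)
      then have "y = pdeg (c0 i)" using 2 by (simp add: c0_def)
      then show ?thesis by blast
    qed
  qed
  have "base_deg u (horner u cs) = Max (insert (-\<infinity>) (pdeg ` set cs))"
    unfolding bd rng by (rule Max_Sup[symmetric]) auto
  also have "\<dots> < ereal k \<longleftrightarrow> (\<forall>c\<in>set cs. pdeg c < ereal k)"
    by (subst Max_less_iff) auto
  also have "\<dots> \<longleftrightarrow> (\<forall>c\<in>set cs. real (length c) < k + 1)"
    by (simp add: pdeg_less_iff[OF k])
  finally show ?thesis .
qed

lemma eval_horner:
  assumes "u \<in> carrier (poly_ring R)" "x \<in> carrier R"
  shows "set cs \<subseteq> carrier (poly_ring R) \<Longrightarrow> eval (horner u cs) x = eval (horner (poly_of_const (eval u x)) cs) x"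
  using assms by (induction cs) auto

lemma length_horner_const_le:
  assumes "y \<in> carrier R"
  shows "set cs \<subseteq> carrier (poly_ring R) \<Longrightarrow> (\<And>c. c \<in> set cs \<Longrightarrow> length c \<le> B) \<Longrightarrow>
    length (horner (poly_of_const y) cs) \<le> B"
proof (induction cs)
  case (Cons c cs)
  have "length (poly_of_const y \<otimes>\<^bsub>poly_ring R\<^esub> horner (poly_of_const y) cs) \<le> B"
    using length_mult_le[of "poly_of_const y" "horner (poly_of_const y) cs"]
      length_poly_of_const_le[of y] Cons assms by fastforce
  then show ?case
    using length_add_le[of c "poly_of_const y \<otimes>\<^bsub>poly_ring R\<^esub> horner (poly_of_const y) cs"]
      Cons.prems(2)[of c] by simp
qed simp

lemma coeff_add:
  assumes "f \<in> carrier (poly_ring R)" "g \<in> carrier (poly_ring R)"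
  shows "coeff (f \<oplus>\<^bsub>poly_ring R\<^esub> g) t = coeff f t \<oplus> coeff g t"
  using poly_add_coeff[of f g] assms poly_carrier_set by (simp add: univ_poly_add)

lemma coeff_const_mult:
  assumes "a \<in> carrier R" "f \<in> carrier (poly_ring R)"
  shows "coeff (poly_of_const a \<otimes>\<^bsub>poly_ring R\<^esub> f) t = a \<otimes> coeff f t"
proof -
  have f: "set f \<subseteq> carrier R" using assms poly_carrier_set by blast
  have "poly_of_const a \<otimes>\<^bsub>poly_ring R\<^esub> f = normalize (map ((\<otimes>) a) f)"
    using poly_mult_normalize[of "[a]" f] poly_mult_const'[OF f assms(1)] f assms(1)
    by (simp add: univ_poly_mult poly_of_const_def)
  then have "coeff (poly_of_const a \<otimes>\<^bsub>poly_ring R\<^esub> f) = coeff (map ((\<otimes>) a) f)"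
    using normalize_coeff[of "map ((\<otimes>) a) f"] by simp
  also have "\<dots> = (\<lambda>i. a \<otimes> coeff f i)" by (rule scalar_coeff[OF assms(1)])
  finally show ?thesis by simp
qed

lemma coeff_poly_closed [simp]: "f \<in> carrier (poly_ring R) \<Longrightarrow> coeff f t \<in> carrier R"
  using poly_carrier_set coeff_in_carrier by blast

text \<open>Change of viewpoint: a fixed coefficient of the sum of the \<open>c_i y^i\<close> is a
  polynomial in \<open>y\<close>. The \<open>rev\<close> is needed because \<open>eval\<close>
  expects the leading coefficient first, while \<open>horner\<close> takes the lowest digit
  first.\<close>

lemma coeff_horner_const:
  assumes y: "y \<in> carrier R"
  shows "set cs \<subseteq> carrier (poly_ring R) \<Longrightarrow>
    coeff (horner (poly_of_const y) cs) t = eval (map (\<lambda>c. coeff c t) (rev cs)) y"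
proof (induction cs)
  case (Cons c cs)
  have s: "set (map (\<lambda>c. coeff c t) (rev cs)) \<subseteq> carrier R" using Cons.prems by auto
  have "eval (map (\<lambda>c. coeff c t) (rev (c # cs))) y
    = eval (map (\<lambda>c. coeff c t) (rev cs)) y \<otimes> y \<oplus> coeff c t"
    using eval_append_aux[OF s _ y, of "coeff c t"] Cons.prems by simp
  also have "\<dots> = coeff c t \<oplus> y \<otimes> eval (map (\<lambda>c. coeff c t) (rev cs)) y"
    using eval_in_carrier[OF s y] Cons.prems y by (simp add: a_comm m_comm)
  finally show ?case
    using Cons y by (simp add: coeff_add coeff_const_mult)
qed simp

text \<open>On the fibre \<open>u = y\<close> the polynomial \<open>f\<close> agrees with
  \<open>h y\<close>, the sum of the \<open>c_i y^i\<close>, whose degree is at most that of the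
  largest digit. Conversely, if every \<open>h y\<close> is short, then a high coefficient of
  \<open>h y\<close>, read as a polynomial in \<open>y\<close> with at most \<open>card Y\<close>
  coefficients, vanishes on all of \<open>Y\<close>; hence the corresponding coefficient of every
  digit is zero.\<close>

lemma base_deg_less_iff_fibres:
  assumes u: "u \<in> carrier (poly_ring R)" and d: "0 < Polynomials.degree u"
    and Y: "finite Y" "Y \<subseteq> carrier R"
    and S: "\<And>y. y \<in> Y \<Longrightarrow> S y \<subseteq> carrier R" "\<And>y. y \<in> Y \<Longrightarrow> card (S y) = Polynomials.degree u"
      "\<And>y x. y \<in> Y \<Longrightarrow> x \<in> S y \<Longrightarrow> eval u x = y"
    and f: "f \<in> carrier (poly_ring R)" "length f \<le> card Y * Polynomials.degree u"
    and k: "0 < k" "k \<le> real (Polynomials.degree u)"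
  shows "base_deg u f < ereal k \<longleftrightarrow>
    (\<forall>y\<in>Y. \<exists>g\<in>carrier (poly_ring R). real (length g) < k + 1 \<and> (\<forall>x\<in>S y. eval g x = eval f x))"
proof -
  have u0: "u \<noteq> []" using d by auto
  have lenu: "length u = Suc (Polynomials.degree u)" using u0 by (cases u) auto
  obtain cs where cs: "length cs = card Y"
      "set cs \<subseteq> {c \<in> carrier (poly_ring R). length c < length u}" "f = horner u cs"
    using horner_expansion_exists[OF u u0 f] by auto
  have csP: "set cs \<subseteq> carrier (poly_ring R)" using cs(2) by auto
  define h where "h y = horner (poly_of_const y) cs" for y
  have hc: "h y \<in> carrier (poly_ring R)" if "y \<in> Y" for y
    using that Y csP by (auto simp: h_def)
  have hf: "eval (h y) x = eval f x" if "y \<in> Y" "x \<in> S y" for x y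
  proof -
    have "x \<in> carrier R" "eval u x = y" using S(1,3) that by auto
    then show ?thesis using eval_horner[OF u _ csP, of x] cs(3) by (simp add: h_def)
  qed
  have hlen: "length (h y) \<le> B" if "y \<in> Y" "\<And>c. c \<in> set cs \<Longrightarrow> length c \<le> B" for y B
    unfolding h_def using that Y csP by (intro length_horner_const_le) auto
  \<comment> \<open>Both polynomials have length at most \<open>degree u\<close>, which is the size
    of the fibre; for \<open>g\<close> this comes from \<open>k \<le> degree u\<close>.\<close>
  have hunique: "g = h y" if "y \<in> Y" "g \<in> carrier (poly_ring R)" "real (length g) < k + 1"
      "\<forall>x\<in>S y. eval g x = eval f x" for g y
  proof (rule poly_eq_if_agree[OF that(2) hc[OF that(1)] S(1)[OF that(1)]])
    show "finite (S y)" using S(2)[OF that(1)] d card_ge_0_finite by metis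
    show "length g \<le> card (S y)" using that(3) k(2) S(2)[OF that(1)] by simp
    show "length (h y) \<le> card (S y)" using S(2)[OF that(1)] cs(2) lenu by (intro hlen[OF that(1)]) auto
  qed (use that hf in auto)
  show ?thesis unfolding cs(3) base_deg_less_iff[OF u u0 cs(2) k(1)]
  proof (intro iffI ballI)
    fix y assume all: "\<forall>c\<in>set cs. real (length c) < k + 1" and y: "y \<in> Y"
    have "real (length (h y)) < k + 1"
    proof (cases "cs = []")
      case True
      then show ?thesis using k by (simp add: h_def)
    next
      case False
      have "length (h y) \<le> Max (length ` set cs)" by (rule hlen[OF y]) auto
      moreover have "Max (length ` set cs) \<in> length ` set cs" using False by (intro Max_in) auto
      ultimately show ?thesis using all by fastforce
    qed
    then show "\<exists>g\<in>carrier (poly_ring R). real (length g) < k + 1 \<and> (\<forall>x\<in>S y. eval g x = eval (horner u cs) x)"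
      using hc[OF y] hf[OF y] cs(3) by auto
  next
    fix c assume g: "\<forall>y\<in>Y. \<exists>g\<in>carrier (poly_ring R). real (length g) < k + 1 \<and>
        (\<forall>x\<in>S y. eval g x = eval (horner u cs) x)" and c: "c \<in> set cs"
    have len: "real (length (h y)) < k + 1" if "y \<in> Y" for y
      using g hunique[OF that] that cs(3) by auto
    show "real (length c) < k + 1"
    proof (rule ccontr)
      assume big: "\<not> real (length c) < k + 1"
      \<comment> \<open>The degree of the digit that is supposed to be too long. It is too high to
        occur in any \<open>h y\<close>, so all \<open>h y\<close> have zero coefficient
        there.\<close>
      define t where "t = Polynomials.degree c"
      have cne: "c \<noteq> []" using big k by auto
      have tlen: "length c = Suc t" using cne by (cases c) (auto simp: t_def)
      let ?L = "map (\<lambda>c. coeff c t) (rev cs)"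
      have L: "set ?L \<subseteq> carrier R" using csP by auto
      have ev: "eval ?L y = \<zero>" if "y \<in> Y" for y
      proof -
        have "length (h y) \<le> t" using len[OF that] big tlen by linarith
        then have "coeff (h y) t = \<zero>" by (rule coeff_length)
        then show ?thesis using coeff_horner_const[of y cs t] csP Y that by (auto simp: h_def)
      qed
      \<comment> \<open>The list may begin with zeros, so it has to be normalized before zeros of
        polynomials can be counted.\<close>
      have "ring.normalize R ?L = []"
      proof (rule poly_zero_if_many_zeros[OF _ Y(2,1)])
        show "ring.normalize R ?L \<in> carrier (poly_ring R)"
          using normalize_gives_polynomial[OF L] univ_poly_carrier by blast
        show "length (ring.normalize R ?L) \<le> card Y" using normalize_length_le[of ?L] cs(1) by simp
        show "eval (ring.normalize R ?L) x = \<zero>" if "x \<in> Y" for x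
          using eval_normalize[OF L, of x] ev[OF that] that Y by auto
      qed
      then have "coeff ?L = (\<lambda>_. \<zero>)" using normalize_coeff[of ?L] by simp
      then have "set ?L \<subseteq> {\<zero>}" using coeff_img_restrict[of ?L] by auto
      then have "coeff c t = \<zero>" using c by auto
      moreover have "polynomial (carrier R) c" using c csP univ_poly_carrier by blast
      ultimately show False using cne lead_coeff_simp[OF cne] by (auto simp: t_def polynomial_def)
    qed
  qed
qed

text \<open>The digits need not be shorter than \<open>u\<close>. This makes the sets a filtration
  compatible with products; the comparison with the true base degree is postponed to
  \<open>bounded_base_base_deg\<close>.\<close>

definition bounded_base :: "'a list \<Rightarrow> nat \<Rightarrow> 'a list set" where
  "bounded_base u d = horner u ` {cs. set cs \<subseteq> {c \<in> carrier (poly_ring R). length c \<le> Suc d}}"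

context
  fixes u assumes u: "u \<in> carrier (poly_ring R)"
begin

lemma bounded_base_closed [simp]: "f \<in> bounded_base u d \<Longrightarrow> f \<in> carrier (poly_ring R)"
  using u by (auto simp: bounded_base_def intro!: horner_closed)

lemma bounded_base_mono: "f \<in> bounded_base u d \<Longrightarrow> d \<le> d' \<Longrightarrow> f \<in> bounded_base u d'"
  unfolding bounded_base_def by fastforce

lemma Nil_bounded_base: "[] \<in> bounded_base u d"
  unfolding bounded_base_def by (rule image_eqI[of _ _ "[]"]) auto

lemma bounded_base_induct [consumes 1, case_names Nil Cons]:
  assumes "f \<in> bounded_base u d" and "P []"
    and "\<And>c h. c \<in> carrier (poly_ring R) \<Longrightarrow> length c \<le> Suc d \<Longrightarrow> h \<in> bounded_base u d \<Longrightarrow> P h \<Longrightarrow>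
      P (c \<oplus>\<^bsub>poly_ring R\<^esub> (u \<otimes>\<^bsub>poly_ring R\<^esub> h))"
  shows "P f"
proof -
  have "set cs \<subseteq> {c \<in> carrier (poly_ring R). length c \<le> Suc d} \<Longrightarrow> P (horner u cs)" for cs
    by (induction cs) (use assms(2,3) in \<open>auto simp: bounded_base_def simp del: bounded_base_closed\<close>)
  then show ?thesis using assms(1) by (auto simp: bounded_base_def simp del: bounded_base_closed)
qed

lemma bounded_base_Cons:
  assumes "c \<in> carrier (poly_ring R)" "length c \<le> Suc d" "h \<in> bounded_base u d"
  shows "c \<oplus>\<^bsub>poly_ring R\<^esub> (u \<otimes>\<^bsub>poly_ring R\<^esub> h) \<in> bounded_base u d"
proof -
  obtain cs where cs: "set cs \<subseteq> {c \<in> carrier (poly_ring R). length c \<le> Suc d}" "h = horner u cs"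
    using assms(3) by (auto simp: bounded_base_def simp del: bounded_base_closed)
  show ?thesis unfolding bounded_base_def
    by (rule image_eqI[of _ _ "c # cs"]) (use cs assms in \<open>auto simp del: bounded_base_closed\<close>)
qed

lemma bounded_base_low:
  assumes "c \<in> carrier (poly_ring R)" "length c \<le> Suc d"
  shows "c \<in> bounded_base u d"
  using bounded_base_Cons[OF assms Nil_bounded_base] assms u by simp

lemma bounded_base_mult_u:
  assumes "f \<in> bounded_base u d"
  shows "u \<otimes>\<^bsub>poly_ring R\<^esub> f \<in> bounded_base u d"
  using bounded_base_Cons[of "[]" d f] assms u by simp

lemma bounded_base_add:
  assumes f: "f \<in> bounded_base u d" and g: "g \<in> bounded_base u d"
  shows "f \<oplus>\<^bsub>poly_ring R\<^esub> g \<in> bounded_base u d"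
proof -
  interpret P: domain "poly_ring R" by (rule poly_ring_domain)
  have "\<forall>g \<in> bounded_base u d. f \<oplus>\<^bsub>poly_ring R\<^esub> g \<in> bounded_base u d"
    using f
  proof (induction f rule: bounded_base_induct)
    case Nil
    then show ?case by simp
  next
    case (Cons c h)
    note IH = Cons.IH
    show ?case
    proof
      fix g assume "g \<in> bounded_base u d"
      then show "c \<oplus>\<^bsub>poly_ring R\<^esub> u \<otimes>\<^bsub>poly_ring R\<^esub> h \<oplus>\<^bsub>poly_ring R\<^esub> g \<in> bounded_base u d"
      proof (induction g rule: bounded_base_induct)
        case Nil
        then show ?case
          using Cons u bounded_base_Cons by simp
      next
        case (Cons c' h')
        have "c \<oplus>\<^bsub>poly_ring R\<^esub> u \<otimes>\<^bsub>poly_ring R\<^esub> h \<oplus>\<^bsub>poly_ring R\<^esub> (c' \<oplus>\<^bsub>poly_ring R\<^esub> u \<otimes>\<^bsub>poly_ring R\<^esub> h')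
          = (c \<oplus>\<^bsub>poly_ring R\<^esub> c') \<oplus>\<^bsub>poly_ring R\<^esub> u \<otimes>\<^bsub>poly_ring R\<^esub> (h \<oplus>\<^bsub>poly_ring R\<^esub> h')"
          using \<open>c \<in> carrier (poly_ring R)\<close> \<open>h \<in> bounded_base u d\<close> Cons u bounded_base_closed
          by (simp add: P.r_distr P.a_ac)
        moreover have "length (c \<oplus>\<^bsub>poly_ring R\<^esub> c') \<le> Suc d"
          using length_add_le[of c c'] Cons \<open>length c \<le> Suc d\<close> by simp
        ultimately show ?case
          using \<open>c \<in> carrier (poly_ring R)\<close> IH Cons bounded_base_Cons by simp
      qed
    qed
  qed
  then show ?thesis using g by blast
qed

text \<open>Multiplication by \<open>u\<close> only shifts digits, so in a product the digit degrees
  add. No carries arise because long digits are permitted.\<close>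

lemma bounded_base_mult:
  assumes f: "f \<in> bounded_base u d" and g: "g \<in> bounded_base u e"
  shows "f \<otimes>\<^bsub>poly_ring R\<^esub> g \<in> bounded_base u (d + e)"
proof -
  interpret P: domain "poly_ring R" by (rule poly_ring_domain)
  have low: "c \<otimes>\<^bsub>poly_ring R\<^esub> g \<in> bounded_base u (d + e)"
    if c: "c \<in> carrier (poly_ring R)" "length c \<le> Suc d" for c
    using g
  proof (induction g rule: bounded_base_induct)
    case Nil
    then show ?case using c Nil_bounded_base by simp
  next
    case (Cons c' h)
    have "c \<otimes>\<^bsub>poly_ring R\<^esub> (c' \<oplus>\<^bsub>poly_ring R\<^esub> u \<otimes>\<^bsub>poly_ring R\<^esub> h)
      = c \<otimes>\<^bsub>poly_ring R\<^esub> c' \<oplus>\<^bsub>poly_ring R\<^esub> u \<otimes>\<^bsub>poly_ring R\<^esub> (c \<otimes>\<^bsub>poly_ring R\<^esub> h)"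
      using c u Cons bounded_base_closed by (simp add: P.r_distr P.m_ac)
    moreover have "length (c \<otimes>\<^bsub>poly_ring R\<^esub> c') \<le> Suc (d + e)"
      using length_mult_le[of c c'] c Cons by simp
    ultimately show ?case using bounded_base_Cons c Cons by simp
  qed
  show ?thesis using f
  proof (induction f rule: bounded_base_induct)
    case Nil
    then show ?case using g Nil_bounded_base by simp
  next
    case (Cons c h)
    have "(c \<oplus>\<^bsub>poly_ring R\<^esub> u \<otimes>\<^bsub>poly_ring R\<^esub> h) \<otimes>\<^bsub>poly_ring R\<^esub> g
      = c \<otimes>\<^bsub>poly_ring R\<^esub> g \<oplus>\<^bsub>poly_ring R\<^esub> u \<otimes>\<^bsub>poly_ring R\<^esub> (h \<otimes>\<^bsub>poly_ring R\<^esub> g)"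
      using u Cons bounded_base_closed bounded_base_closed[OF g] by (simp add: P.l_distr P.r_distr P.m_ac)
    then show ?case using low Cons bounded_base_add bounded_base_mult_u by simp
  qed
qed

lemma bounded_base_minus:
  assumes "f \<in> bounded_base u d"
  shows "\<ominus>\<^bsub>poly_ring R\<^esub> f \<in> bounded_base u d"
proof -
  interpret P: domain "poly_ring R" by (rule poly_ring_domain)
  have "length (\<ominus>\<^bsub>poly_ring R\<^esub> \<one>\<^bsub>poly_ring R\<^esub>) \<le> Suc 0"
    using univ_poly_a_inv_length[OF carrier_is_subring P.one_closed] by (simp add: poly_ring_simps(2))
  then have "\<ominus>\<^bsub>poly_ring R\<^esub> \<one>\<^bsub>poly_ring R\<^esub> \<otimes>\<^bsub>poly_ring R\<^esub> f \<in> bounded_base u (0 + d)"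
    using assms by (intro bounded_base_mult bounded_base_low[of _ 0]) auto
  then show ?thesis using bounded_base_closed[OF assms] by (simp add: P.l_minus)
qed

lemma bounded_base_pow:
  assumes "f \<in> bounded_base u d"
  shows "f [^]\<^bsub>poly_ring R\<^esub> (n::nat) \<in> bounded_base u (n * d)"
proof -
  interpret P: domain "poly_ring R" by (rule poly_ring_domain)
  show ?thesis
  proof (induction n)
    case 0
    then show ?case using bounded_base_low[of "\<one>\<^bsub>poly_ring R\<^esub>" 0] by (simp add: poly_ring_simps(2))
  next
    case (Suc n)
    then show ?case using bounded_base_mult[OF Suc assms] by (simp add: add.commute)
  qed
qed

text \<open>Powers of \<open>u\<close> cost nothing; this is what makes large powers of
  \<open>X\<close> cheap once they are rewritten through \<open>g\<close> or
  \<open>h\<close>.\<close>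

lemma pow_u_bounded_base: "u [^]\<^bsub>poly_ring R\<^esub> (n::nat) \<in> bounded_base u 0"
proof -
  interpret P: domain "poly_ring R" by (rule poly_ring_domain)
  show ?thesis
  proof (induction n)
    case 0
    then show ?case using bounded_base_low[of "\<one>\<^bsub>poly_ring R\<^esub>" 0] by (simp add: poly_ring_simps(2))
  next
    case (Suc n)
    then show ?case using bounded_base_mult_u[OF Suc] u by (simp add: P.m_comm)
  qed
qed

text \<open>Only when the total digit bound stays below the degree of \<open>u\<close> is the Horner
  form the genuine base expansion.\<close>

lemma bounded_base_base_deg:
  assumes "f \<in> bounded_base u d" "d < Polynomials.degree u" "real d < k"
  shows "base_deg u f < ereal k"
proof -
  obtain cs where cs: "set cs \<subseteq> {c \<in> carrier (poly_ring R). length c \<le> Suc d}" "f = horner u cs"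
    using assms(1) by (auto simp: bounded_base_def simp del: bounded_base_closed)
  have u0: "u \<noteq> []" using assms(2) by auto
  have sub: "set cs \<subseteq> {c \<in> carrier (poly_ring R). length c < length u}"
    using cs(1) assms(2) by fastforce
  have "real (length c) < k + 1" if "c \<in> set cs" for c
    using that cs(1) assms(3) by fastforce
  moreover have "0 < k" using assms(3) by linarith
  ultimately show ?thesis
    unfolding cs(2) using base_deg_less_iff[OF u u0 sub] by blast
qed

end

end

section \<open>The additive group G and its span over K\<close>

lemma (in domain) nat_pow_eq_zero: "x \<in> carrier R \<Longrightarrow> x [^] (n::nat) = \<zero> \<Longrightarrow> x = \<zero>"
  by (induction n) (auto simp: integral_iff)

lemma (in field) frobenius_inj:
  assumes p: "prime p" and char: "[p] \<cdot> \<one> = \<zero>"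
    and x: "x \<in> carrier R" and y: "y \<in> carrier R" and eq: "x [^] (p ^ k) = y [^] ((p::nat) ^ k)"
  shows "x = y"
proof -
  have "(x \<ominus> y) [^] (p ^ k) = \<zero>"
    using frobenius_pow_minus[OF p char x y, of k] eq x y by simp
  then have "x \<ominus> y = \<zero>"
    by (rule nat_pow_eq_zero[of _ "p ^ k", rotated]) (use x y in simp)
  then show ?thesis using x y by simp
qed

lemma (in ring) card_Span:
  assumes K: "subfield K R" and indep: "independent K Us" and Us: "set Us \<subseteq> carrier R" and fin: "finite K"
  shows "card (Span K Us) = card K ^ length Us"
proof -
  have "bij_betw (\<lambda>Ks. combine Ks Us) {Ks. set Ks \<subseteq> K \<and> length Ks = length Us} (Span K Us)"
    unfolding bij_betw_def inj_on_def
  proof (intro conjI ballI impI)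
    fix Ks Ls
    assume *: "Ks \<in> {Ks. set Ks \<subseteq> K \<and> length Ks = length Us}" "Ls \<in> {Ks. set Ks \<subseteq> K \<and> length Ks = length Us}"
      "combine Ks Us = combine Ls Us"
    have "combine Ks Us \<in> Span K Us" using * Span_eq_combine_set_length_version[OF K Us] by auto
    then show "Ks = Ls" using unique_decomposition[OF K indep] * by blast
  qed (use Span_eq_combine_set_length_version[OF K Us] in auto)
  then have "card (Span K Us) = card {Ks. set Ks \<subseteq> K \<and> length Ks = length Us}"
    by (simp add: bij_betw_same_card)
  then show ?thesis using card_lists_length_eq[OF fin] by simp
qed

locale coset_code_setup_ge2 = coset_code_setup +
  assumes m_ge_2: "2 \<le> m"
begin

definition q :: nat where "q = p ^ m"
definition G :: "'a set" where "G = g_roots p m"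
definition H :: "'a set" where "H = K - {\<zero>}"

lemma p_ge_2: "2 \<le> p" using p_prime prime_ge_2_nat by blast

lemma q_ge: "p * p \<le> q" "p < q" "4 \<le> q"
proof -
  have "p ^ 2 \<le> p ^ m" using p_ge_2 m_ge_2 by (intro power_increasing) auto
  then show 1: "p * p \<le> q" by (simp add: q_def power2_eq_square)
  have "2 * p \<le> p * p" "2 * 2 \<le> p * p" using p_ge_2 mult_le_mono[of 2 p p p] mult_le_mono[of 2 p 2 p] by auto
  then show "p < q" "4 \<le> q" using 1 p_ge_2 by linarith+
qed

lemma K_carrier: "K \<subseteq> carrier R" and K_subring: "subring K R"
  using subfieldE[OF K_subfield] by auto

lemma K_closed:
  "\<zero> \<in> K" "\<one> \<in> K" "x \<in> K \<Longrightarrow> \<ominus> x \<in> K"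
  "x \<in> K \<Longrightarrow> y \<in> K \<Longrightarrow> x \<otimes> y \<in> K" "x \<in> K \<Longrightarrow> y \<in> K \<Longrightarrow> x \<oplus> y \<in> K"
  using subringE[OF K_subring] by auto

lemma K_nat_pow: "x \<in> K \<Longrightarrow> x [^] (n::nat) \<in> K"
  by (induction n) (auto intro: K_closed)

lemma H_Units: "x \<in> H \<Longrightarrow> x \<in> carrier R \<and> x \<noteq> \<zero> \<and> x \<in> Units R \<and> x \<in> K"
  using K_carrier by (auto simp: H_def field_Units)

lemma H_inv: "x \<in> H \<Longrightarrow> inv x \<in> H" "x \<in> H \<Longrightarrow> x \<otimes> inv x = \<one>" "x \<in> H \<Longrightarrow> inv x \<otimes> x = \<one>"
  using subfield_m_inv[OF K_subfield] by (auto simp: H_def)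

lemma H_mult: assumes "x \<in> H" "y \<in> H" shows "x \<otimes> y \<in> H"
  using H_Units[OF assms(1)] H_Units[OF assms(2)] K_closed(4)[of x y] integral_iff[of x y]
  unfolding H_def by blast

lemma one_H: "\<one> \<in> H" using K_closed by (auto simp: H_def)

lemma finite_K: "finite K" and finite_H: "finite H"
  using finite_subset[OF K_carrier finite_carrier] by (auto simp: H_def)

lemma card_H: "card H = q - 1"
  using K_card K_closed(1) finite_K by (simp add: H_def q_def)

lemma H_pow: "x \<in> H \<Longrightarrow> x [^] (q - 1) = \<one>"
proof -
  assume x: "x \<in> H"
  have sg: "subgroup (K - {\<zero>}) (Multiplicative_Group.mult_of R)" by (rule subgroup_mult_of[OF K_subfield])
  interpret M: group "Multiplicative_Group.mult_of R" by (rule field_mult_group)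
  interpret S: group "(Multiplicative_Group.mult_of R)\<lparr>carrier := K - {\<zero>}\<rparr>" by (rule M.subgroup_imp_group[OF sg])
  have "x [^]\<^bsub>(Multiplicative_Group.mult_of R)\<lparr>carrier := K - {\<zero>}\<rparr>\<^esub> Coset.order ((Multiplicative_Group.mult_of R)\<lparr>carrier := K - {\<zero>}\<rparr>) = \<one>\<^bsub>(Multiplicative_Group.mult_of R)\<lparr>carrier := K - {\<zero>}\<rparr>\<^esub>"
    using x by (intro S.pow_order_eq_1) (simp add: H_def)
  then show ?thesis
    using card_H by (simp add: Coset.order_def H_def M.nat_pow_consistent[symmetric] Multiplicative_Group.nat_pow_mult_of)
qed

lemma K_pow: "x \<in> K \<Longrightarrow> x [^] q = x"
proof (cases "x = \<zero>")
  case True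
  then show ?thesis using q_ge by (simp add: nat_pow_zero)
next
  case False
  assume "x \<in> K"
  then have x: "x \<in> H" using False by (simp add: H_def)
  have "x [^] Suc (q - 1) = x" using H_pow[OF x] H_Units[OF x] by simp
  then show ?thesis using q_ge(3) by simp
qed

lemma length_X_pow: "length (X [^]\<^bsub>poly_ring R\<^esub> (n::nat)) = Suc n"
  using arg_cong[OF unitary_monom_eq_var_pow[OF carrier_is_subring, of n], of length] by (simp add: monom_def)

lemma eval_X [simp]: "x \<in> carrier R \<Longrightarrow> eval X x = x"
  by (rule eval_var)

lemma length_add_lt:
  assumes "f \<in> carrier (poly_ring R)" "g \<in> carrier (poly_ring R)" "length g < length f"
  shows "length (f \<oplus>\<^bsub>poly_ring R\<^esub> g) = length f"
  using poly_add_length_eq[OF carrier_is_subring, of f g] assms univ_poly_carrier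
  by (auto simp: univ_poly_add)

text \<open>The \<open>q\<close> elements of \<open>K\<close> are roots of \<open>X^q - X\<close>,
  which has no room for further ones.\<close>

lemma pow_q_iff: 
  assumes x: "x \<in> carrier R"
  shows "x [^] q = x \<longleftrightarrow> x \<in> K"
proof -
  let ?f = "X [^]\<^bsub>poly_ring R\<^esub> q \<ominus>\<^bsub>poly_ring R\<^esub> X"
  have f: "?f \<in> carrier (poly_ring R)" by simp
  have "length (\<ominus>\<^bsub>poly_ring R\<^esub> X) = 2"
    using univ_poly_a_inv_length[OF carrier_is_subring var_poly_closed] by (simp add: var_def)
  then have len: "length ?f = Suc q"
    using length_add_lt[of "X [^]\<^bsub>poly_ring R\<^esub> q" "\<ominus>\<^bsub>poly_ring R\<^esub> X"] q_ge
    by (simp add: a_minus_def length_X_pow)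
  let ?Z = "{x \<in> carrier R. eval ?f x = \<zero>}"
  have Z: "?Z = {x \<in> carrier R. x [^] q = x}" by auto
  have "?f \<noteq> []" using len by auto
  from card_zeros_less[OF f this] have "card ?Z < Suc q" "finite ?Z" unfolding len by auto
  moreover have "K \<subseteq> ?Z" unfolding Z using K_pow K_carrier by auto
  ultimately have "K = ?Z" using K_card by (intro card_seteq) (auto simp: q_def)
  then have "K = {x \<in> carrier R. x [^] q = x}" using Z by simp
  then show ?thesis using x by auto
qed

lemma pow_q1_eq_one:
  assumes x: "x \<in> carrier R" "x [^] (q - 1) = \<one>"
  shows "x \<in> H"
proof -
  have "x [^] Suc (q - 1) = x" using x by simp
  then have "x \<in> K" using pow_q_iff[OF x(1)] q_ge(3) by simp
  moreover have "x \<noteq> \<zero>" using x(2) q_ge(3) by (auto simp: nat_pow_zero)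
  ultimately show ?thesis by (simp add: H_def)
qed

lemma g_poly_closed [simp]: "g_poly p m \<in> carrier (poly_ring R)"
  by (simp add: g_poly_def)

lemma length_g_poly: "length (g_poly p m) = Suc q"
proof -
  have "length (X [^]\<^bsub>poly_ring R\<^esub> q \<oplus>\<^bsub>poly_ring R\<^esub> X [^]\<^bsub>poly_ring R\<^esub> p) = Suc q"
    using q_ge by (subst length_add_lt) (auto simp: length_X_pow)
  moreover have "length X\<^bsub>R\<^esub> = 2" by (simp add: var_def)
  ultimately show ?thesis
    using q_ge(3) length_add_lt[of "X [^]\<^bsub>poly_ring R\<^esub> q \<oplus>\<^bsub>poly_ring R\<^esub> X [^]\<^bsub>poly_ring R\<^esub> p" X]
    by (simp add: g_poly_def q_def)
qed

lemma eval_g_poly: "x \<in> carrier R \<Longrightarrow> eval (g_poly p m) x = x [^] q \<oplus> x [^] p \<oplus> x"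
  by (simp add: g_poly_def q_def)

lemma poly_ring_char: "[p] \<cdot>\<^bsub>poly_ring R\<^esub> \<one>\<^bsub>poly_ring R\<^esub> = \<zero>\<^bsub>poly_ring R\<^esub>"
proof -
  interpret P: domain "poly_ring R" by (rule poly_ring_domain)
  interpret h: ring_hom_ring R "poly_ring R" poly_of_const
    using canonical_embedding_ring_hom[OF carrier_is_subring] by simp
  have "[k] \<cdot>\<^bsub>poly_ring R\<^esub> \<one>\<^bsub>poly_ring R\<^esub> = poly_of_const ([k] \<cdot> \<one>)" for k :: nat
    by (induction k) auto
  then show ?thesis using characteristic by simp
qed

lemma G_iff: "x \<in> G \<longleftrightarrow> x \<in> carrier R \<and> x [^] q \<oplus> x [^] p \<oplus> x = \<zero>"
  by (auto simp: G_def g_roots_def eval_g_poly)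

lemma pow_p_add: "x \<in> carrier R \<Longrightarrow> y \<in> carrier R \<Longrightarrow> (x \<oplus> y) [^] p = x [^] p \<oplus> y [^] p"
  by (rule frobenius_add[OF p_prime characteristic])

lemma pow_q_add: "x \<in> carrier R \<Longrightarrow> y \<in> carrier R \<Longrightarrow> (x \<oplus> y) [^] q = x [^] q \<oplus> y [^] q"
  unfolding q_def by (rule frobenius_pow_add[OF p_prime characteristic])

lemma g_additive:
  assumes "x \<in> carrier R" "y \<in> carrier R"
  shows "eval (g_poly p m) (x \<oplus> y) = eval (g_poly p m) x \<oplus> eval (g_poly p m) y"
  using assms by (simp add: eval_g_poly pow_p_add pow_q_add a_ac)

lemma G_zero: "\<zero> \<in> G" using q_ge p_ge_2 by (simp add: G_iff nat_pow_zero)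

lemma G_carrier: "x \<in> G \<Longrightarrow> x \<in> carrier R" by (simp add: G_iff)

lemma finite_G: "finite G"
  by (rule finite_subset[OF _ finite_carrier]) (auto dest: G_carrier)

lemma G_add: "x \<in> G \<Longrightarrow> y \<in> G \<Longrightarrow> x \<oplus> y \<in> G"
  using g_additive[of x y] by (auto simp: G_def g_roots_def)

lemma G_neg: assumes "x \<in> G" shows "\<ominus> x \<in> G"
proof -
  have x: "x \<in> carrier R" "eval (g_poly p m) x = \<zero>" using assms by (auto simp: G_def g_roots_def)
  have "eval (g_poly p m) (x \<oplus> \<ominus> x) = eval (g_poly p m) x \<oplus> eval (g_poly p m) (\<ominus> x)"
    using x by (intro g_additive) auto
  moreover have "eval (g_poly p m) (x \<oplus> \<ominus> x) = \<zero>"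
    using x G_zero by (simp add: r_neg G_def g_roots_def)
  ultimately show ?thesis using x by (simp add: G_def g_roots_def)
qed

lemma G_subgroup: "subgroup G (add_monoid R)"
  using G_carrier G_add G_neg G_zero by (intro add.subgroupI) auto

text \<open>The roots of \<open>g\<close> are simple: around a root \<open>a\<close>, additivity gives \<open>g(X) = g(X - a)\<close>, and
  \<open>g(Z)/Z\<close> does not vanish at \<open>Z = 0\<close>.\<close>

lemma alg_mult_g_le_1:
  assumes a: "a \<in> carrier R"
  shows "alg_mult (g_poly p m) a \<le> 1"
proof (rule ccontr)
  interpret P: domain "poly_ring R" by (rule poly_ring_domain)
  assume big: "\<not> ?thesis"
  let ?g = "g_poly p m" and ?Z = "[\<one>, \<ominus> a]" and ?A = "poly_of_const a"
  have Z: "?Z \<in> carrier (poly_ring R)" by (rule lin_closed[OF a])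
  have A: "?A \<in> carrier (poly_ring R)" using a by simp
  have g0: "?g \<noteq> []" using length_g_poly by auto
  have "(?Z [^]\<^bsub>poly_ring R\<^esub> (2::nat)) pdivides ?g"
    using le_alg_mult_imp_pdivides[OF a g_poly_closed, of 2] big by simp
  then obtain w where w: "w \<in> carrier (poly_ring R)"
      "?g = ?Z [^]\<^bsub>poly_ring R\<^esub> (2::nat) \<otimes>\<^bsub>poly_ring R\<^esub> w"
    unfolding pdivides_def factor_def by auto
  have Z2: "?Z [^]\<^bsub>poly_ring R\<^esub> (2::nat) = ?Z \<otimes>\<^bsub>poly_ring R\<^esub> ?Z"
    using Z by (simp add: numeral_2_eq_2)
  have Zev: "eval ?Z a = \<zero>" using a by (simp add: r_neg)
  \<comment> \<open>Both sides have length at most 2 and the field has at least two elements, so it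
    is enough to compare values.\<close>
  have XZ: "X = ?Z \<oplus>\<^bsub>poly_ring R\<^esub> ?A"
  proof (rule poly_eq_if_agree[of _ _ "carrier R"])
    have "2 \<le> card (carrier R)" 
      using card_mono[OF finite_carrier K_carrier] K_card q_ge(3) by (simp add: q_def)
    then show "length X\<^bsub>R\<^esub> \<le> card (carrier R)"
        "length (?Z \<oplus>\<^bsub>poly_ring R\<^esub> ?A) \<le> card (carrier R)"
      using length_add_le[of ?Z ?A] length_poly_of_const_le[of a] by (auto simp: var_def)
  qed (use Z A finite_carrier a in \<open>auto simp: a_assoc l_neg\<close>)
  define gA where "gA = ?A [^]\<^bsub>poly_ring R\<^esub> q \<oplus>\<^bsub>poly_ring R\<^esub> ?A [^]\<^bsub>poly_ring R\<^esub> p \<oplus>\<^bsub>poly_ring R\<^esub> ?A"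
  \<comment> \<open>The quotient \<open>g(Z)/Z\<close>. Its constant term is one, which contradicts
    divisibility of \<open>g(Z)\<close> by \<open>Z^2\<close>.\<close>
  define gZ where "gZ = ?Z [^]\<^bsub>poly_ring R\<^esub> (q - 1) \<oplus>\<^bsub>poly_ring R\<^esub> ?Z [^]\<^bsub>poly_ring R\<^esub> (p - 1) \<oplus>\<^bsub>poly_ring R\<^esub> \<one>\<^bsub>poly_ring R\<^esub>"
  have gZc: "gZ \<in> carrier (poly_ring R)" and gAc: "gA \<in> carrier (poly_ring R)"
    using Z a by (auto simp: gZ_def gA_def)
  have ZZ: "?Z \<otimes>\<^bsub>poly_ring R\<^esub> ?Z [^]\<^bsub>poly_ring R\<^esub> (k - 1) = ?Z [^]\<^bsub>poly_ring R\<^esub> k" if "0 < k" for k :: nat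
    using that Z P.nat_pow_Suc2[OF Z, of "k - 1"] by simp
  have "?g = ?Z [^]\<^bsub>poly_ring R\<^esub> q \<oplus>\<^bsub>poly_ring R\<^esub> ?A [^]\<^bsub>poly_ring R\<^esub> q \<oplus>\<^bsub>poly_ring R\<^esub>
      (?Z [^]\<^bsub>poly_ring R\<^esub> p \<oplus>\<^bsub>poly_ring R\<^esub> ?A [^]\<^bsub>poly_ring R\<^esub> p) \<oplus>\<^bsub>poly_ring R\<^esub> (?Z \<oplus>\<^bsub>poly_ring R\<^esub> ?A)"
    unfolding g_poly_def q_def
    using P.frobenius_pow_add[OF p_prime poly_ring_char Z A, of m]
      P.frobenius_add[OF p_prime poly_ring_char Z A] XZ by simp
  also have "\<dots> = (?Z [^]\<^bsub>poly_ring R\<^esub> q \<oplus>\<^bsub>poly_ring R\<^esub> ?Z [^]\<^bsub>poly_ring R\<^esub> p \<oplus>\<^bsub>poly_ring R\<^esub> ?Z) \<oplus>\<^bsub>poly_ring R\<^esub> gA"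
  proof -
    have rearrange: "b1 \<oplus>\<^bsub>poly_ring R\<^esub> b2 \<oplus>\<^bsub>poly_ring R\<^esub> (b3 \<oplus>\<^bsub>poly_ring R\<^esub> b4) \<oplus>\<^bsub>poly_ring R\<^esub> (b5 \<oplus>\<^bsub>poly_ring R\<^esub> b6)
      = (b1 \<oplus>\<^bsub>poly_ring R\<^esub> b3 \<oplus>\<^bsub>poly_ring R\<^esub> b5) \<oplus>\<^bsub>poly_ring R\<^esub> (b2 \<oplus>\<^bsub>poly_ring R\<^esub> b4 \<oplus>\<^bsub>poly_ring R\<^esub> b6)"
      if "{b1, b2, b3, b4, b5, b6} \<subseteq> carrier (poly_ring R)" for b1 b2 b3 b4 b5 b6
      using that by (simp add: P.a_ac)
    show ?thesis unfolding gA_def by (rule rearrange) (use Z A in simp)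
  qed
  also have "?Z [^]\<^bsub>poly_ring R\<^esub> q \<oplus>\<^bsub>poly_ring R\<^esub> ?Z [^]\<^bsub>poly_ring R\<^esub> p \<oplus>\<^bsub>poly_ring R\<^esub> ?Z = ?Z \<otimes>\<^bsub>poly_ring R\<^esub> gZ"
    unfolding gZ_def using Z ZZ[of q] ZZ[of p] q_ge(3) p_ge_2 by (simp add: P.r_distr)
  finally have g_eq: "?g = ?Z \<otimes>\<^bsub>poly_ring R\<^esub> gZ \<oplus>\<^bsub>poly_ring R\<^esub> gA" .
  have "?Z \<otimes>\<^bsub>poly_ring R\<^esub> (?Z \<otimes>\<^bsub>poly_ring R\<^esub> w) = ?Z \<otimes>\<^bsub>poly_ring R\<^esub> gZ \<oplus>\<^bsub>poly_ring R\<^esub> gA"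
    using w g_eq Z Z2 by (simp add: P.m_assoc)
  moreover have "gA = \<zero>\<^bsub>poly_ring R\<^esub>"
  proof -
    interpret h: ring_hom_ring R "poly_ring R" poly_of_const
      using canonical_embedding_ring_hom[OF carrier_is_subring] by simp
    have "gA = poly_of_const (a [^] q \<oplus> a [^] p \<oplus> a)"
      unfolding gA_def using a by (simp add: h.hom_nat_pow)
    also have "a [^] q \<oplus> a [^] p \<oplus> a = eval ?g a" by (rule eval_g_poly[OF a, symmetric])
    also have "\<dots> = \<zero>" using w Z Z2 Zev a by simp
    finally show ?thesis by simp
  qed
  ultimately have "?Z \<otimes>\<^bsub>poly_ring R\<^esub> (?Z \<otimes>\<^bsub>poly_ring R\<^esub> w) = ?Z \<otimes>\<^bsub>poly_ring R\<^esub> gZ"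
    using Z gZc by simp
  then have "?Z \<otimes>\<^bsub>poly_ring R\<^esub> w = gZ"
    using P.m_lcancel[of ?Z "?Z \<otimes>\<^bsub>poly_ring R\<^esub> w" gZ] Z w gZc by (simp add: poly_ring_simps(1))
  then have "eval gZ a = eval ?Z a \<otimes> eval w a" using Z w a by auto
  then have "eval gZ a = \<zero>" using Zev w a by simp
  moreover have "eval gZ a = \<one>"
    unfolding gZ_def using Z a Zev q_ge(3) p_ge_2 P.one_closed
    by (simp add: nat_pow_zero poly_ring_simps(2))
  ultimately show False by simp
qed

text \<open>\<open>g\<close> splits and its roots are simple, so the number of distinct roots is its
  degree.\<close>

lemma card_G: "card G = q"
proof -
  let ?g = "g_poly p m"
  have g0: "?g \<noteq> []" using length_g_poly by auto
  have G_eq: "G = set_mset (roots ?g)"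
    using roots_mem_iff_is_root[OF g_poly_closed] g0 by (auto simp: G_def g_roots_def is_root_def)
  have le1: "count (roots ?g) x \<le> 1" for x
    using alg_mult_g_le_1[of x] alg_mult_eq_count_roots[OF g_poly_closed]
    by (cases "x \<in> carrier R") (metis, metis alg_mult_def zero_le)
  have cnt: "count (roots ?g) x = 1" if "x \<in># roots ?g" for x
    using le1[of x] that count_greater_zero_iff[of "roots ?g" x] by linarith
  have "roots ?g = mset_set (set_mset (roots ?g))"
    by (rule multiset_eqI) (use cnt in \<open>auto simp: count_mset_set' not_in_iff\<close>)
  then have "size (roots ?g) = card G" unfolding G_eq by (metis size_mset_set)
  then show ?thesis using contains_g_roots length_g_poly by (simp add: splitted_def)
qed

end

section \<open>The prime field, independence of a basis of \<open>G\<close> over \<open>K\<close>,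
  and the span \<open>V\<close>\<close>

context coset_code_setup_ge2
begin

text \<open>The prime field, described as the fixed points of the Frobenius map. In this form
  membership is what comparing coefficients yields in \<open>Span_G_descent\<close>.\<close>

definition F0 :: "'a set" where "F0 = {x \<in> carrier R. x [^] p = x}"

lemma F0_subfield: "subfield F0 R"
proof (rule subfieldI')
  have inj: "x \<in> carrier R \<Longrightarrow> (\<ominus> x) [^] p = \<ominus> (x [^] p)" for x
    using frobenius_pow_minus[OF p_prime characteristic zero_closed, of x 1] p_ge_2
    by (simp add: nat_pow_zero a_minus_def)
  show "subring F0 R"
    by (rule subringI) (auto simp: F0_def nat_pow_distrib pow_p_add inj)
  fix k assume "k \<in> F0 - {\<zero>}"
  then have k: "k \<in> Units R" "k \<in> carrier R" "k [^] p = k" by (auto simp: F0_def field_Units)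
  have "(inv k) [^] p \<otimes> k = (inv k) [^] p \<otimes> k [^] p" using k by simp
  also have "\<dots> = \<one>" using k(1,2) by (metis Units_inv_closed Units_l_inv nat_pow_distrib nat_pow_one)
  finally have "(inv k) [^] p = inv k" using k by (metis Units_inv_closed inv_char comm_inv_char m_comm nat_pow_closed)
  then show "inv k \<in> F0" using k by (simp add: F0_def)
qed

lemma F0_subset_K: "F0 \<subseteq> K"
proof
  fix x assume "x \<in> F0"
  then have x: "x \<in> carrier R" "x [^] p = x" by (auto simp: F0_def)
  have "x [^] (p ^ k) = x" for k
    by (induction k) (use x in \<open>auto simp: nat_pow_pow[symmetric]\<close>)
  then show "x \<in> K" using pow_q_iff[OF x(1)] by (simp add: q_def)
qed

lemma card_F0_le: "card F0 \<le> p"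
proof -
  let ?f = "X [^]\<^bsub>poly_ring R\<^esub> p \<ominus>\<^bsub>poly_ring R\<^esub> X"
  have f: "?f \<in> carrier (poly_ring R)" by simp
  have "length (\<ominus>\<^bsub>poly_ring R\<^esub> X) = 2"
    using univ_poly_a_inv_length[OF carrier_is_subring var_poly_closed] by (simp add: var_def)
  then have len: "length ?f = Suc p"
    using length_add_lt[of "X [^]\<^bsub>poly_ring R\<^esub> p" "\<ominus>\<^bsub>poly_ring R\<^esub> X"] p_ge_2
    by (simp add: a_minus_def length_X_pow)
  have Z: "{x \<in> carrier R. eval ?f x = \<zero>} = F0" by (auto simp: F0_def)
  have "?f \<noteq> []" using len by auto
  from card_zeros_less[OF f this] show ?thesis unfolding len Z by simp
qed

text \<open>On \<open>G\<close> the Frobenius \<open>x \<mapsto> x\<^sup>p\<close> agrees with \<open>x \<mapsto> - (x\<^sup>q + x)\<close>, which is linear over \<open>K\<close>.\<close>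

lemma combine_pow_p:
  "set Cs \<subseteq> K \<Longrightarrow> set Us \<subseteq> G \<Longrightarrow>
    combine Cs (map (\<lambda>x. x [^] p) Us) = \<ominus> (combine Cs Us [^] q \<oplus> combine Cs Us)"
proof (induction Cs Us rule: combine.induct)
  case (1 c Cs u Us)
  have c: "c \<in> carrier R" "c [^] q = c" and u: "u \<in> carrier R"
    using 1 K_carrier K_pow G_carrier by auto
  let ?s = "combine Cs Us"
  have s: "?s \<in> carrier R" using 1 K_carrier G_carrier by (intro combine_in_carrier) auto
  have "u [^] q \<oplus> u [^] p \<oplus> u = \<zero>" using 1 by (simp add: G_iff)
  then have up: "u [^] p = \<ominus> (u [^] q \<oplus> u)"
    using u by (intro minus_equality[symmetric]) (auto simp: a_ac)
  have "(c \<otimes> u \<oplus> ?s) [^] q = c \<otimes> u [^] q \<oplus> ?s [^] q"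
    using c u s by (simp add: pow_q_add nat_pow_distrib)
  moreover have "c \<otimes> (\<ominus> (u [^] q \<oplus> u)) = \<ominus> (c \<otimes> u [^] q \<oplus> c \<otimes> u)"
    using c u by (simp add: r_minus r_distr)
  ultimately show ?case
    using 1 c u s up by (simp add: minus_add a_ac)
qed (use q_ge in \<open>auto simp: nat_pow_zero\<close>)

lemma Frobenius_hom: "ring_hom_ring R R (\<lambda>x. x [^] p)"
  using frobenius_hom[OF p_prime characteristic, of 1] by simp

lemma Frobenius_inj: "inj_on (\<lambda>x. x [^] p) (carrier R)"
  using frobenius_inj[OF p_prime characteristic, of _ _ 1] by (auto intro!: inj_onI)

lemma Frobenius_K: "(\<lambda>x. x [^] p) ` K = K"
  by (rule endo_inj_surj[OF finite_K])
     (auto intro: K_nat_pow inj_on_subset[OF Frobenius_inj K_carrier])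

text \<open>Write \<open>u\<close> as a combination of \<open>Us\<close> with coefficients
  \<open>c_i\<close> in \<open>K\<close>. The Frobenius map sends \<open>u\<close> to the
  combination of the p-th powers with coefficients \<open>c_i^p\<close>, and its linear description
  on \<open>G\<close> gives the same element with coefficients \<open>c_i\<close>. The p-th powers
  of \<open>Us\<close> are still independent over \<open>K\<close>, so
  \<open>c_i^p = c_i\<close>.\<close>

lemma Span_G_descent:
  assumes Us: "set Us \<subseteq> G" and indep: "independent K Us" and u: "u \<in> G" "u \<in> Span K Us"
  shows "u \<in> Span F0 Us"
proof -
  interpret fr: ring_hom_ring R R "\<lambda>x. x [^] p" by (rule Frobenius_hom)
  have UsR: "set Us \<subseteq> carrier R" using Us G_carrier by auto
  obtain Cs where Cs: "set Cs \<subseteq> K" "length Cs = length Us" "u = combine Cs Us"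
    using u Span_mem_iff_length_version[OF K_subfield UsR] by auto
  have CsR: "set Cs \<subseteq> carrier R" using Cs K_carrier by auto
  let ?Vs = "map (\<lambda>x. x [^] p) Us" and ?Ds = "map (\<lambda>x. x [^] p) Cs"
  have VsR: "set ?Vs \<subseteq> carrier R" using UsR by auto
  have "u [^] q \<oplus> u [^] p \<oplus> u = \<zero>" "u \<in> carrier R" using u by (auto simp: G_iff)
  then have up: "u [^] p = \<ominus> (u [^] q \<oplus> u)"
    by (intro minus_equality[symmetric]) (auto simp: a_ac)
  have "combine ?Ds ?Vs = u [^] p" using fr.combine_hom[OF CsR UsR] Cs by simp
  also have "\<dots> = combine Cs ?Vs" using combine_pow_p[OF Cs(1) Us] Cs(3) up by simp
  finally have eq: "combine ?Ds ?Vs = combine Cs ?Vs" .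
  \<comment> \<open>A semilinear injective map preserves independence, but over the image of
    \<open>K\<close>; this image is \<open>K\<close> itself.\<close>
  have "independent ((\<lambda>x. x [^] p) ` K) ?Vs"
    using fr.inj_hom_preserves_independent[OF K_subfield one_not_zero
        inj_on_subset[OF Frobenius_inj Span_in_carrier[OF K_carrier UsR]] indep] .
  then have indepV: "independent K ?Vs" by (simp add: Frobenius_K)
  have DsK: "set ?Ds \<subseteq> K" using Cs(1) K_nat_pow by auto
  have "combine Cs ?Vs \<in> Span K ?Vs"
    using Span_eq_combine_set_length_version[OF K_subfield VsR] Cs by auto
  then have "?Ds = Cs"
    using unique_decomposition[OF K_subfield indepV] eq Cs DsK by (metis length_map)
  then have "set Cs \<subseteq> F0" using CsR by (auto simp: F0_def list_eq_iff_nth_eq in_set_conv_nth)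
  then show ?thesis
    using Cs Span_eq_combine_set_length_version[OF F0_subfield UsR] by auto
qed

lemma independent_F0_imp_K:
  "independent F0 Us \<Longrightarrow> set Us \<subseteq> G \<Longrightarrow> independent K Us"
proof (induction Us)
  case (Cons u Us)
  have *: "independent F0 Us" "u \<notin> Span F0 Us" using independent_backwards[OF Cons.prems(1)] by auto
  then have "independent K Us" "u \<notin> Span K Us"
    using Cons Span_G_descent[of Us u] by auto
  then show ?case using Cons.prems G_carrier by (intro li_Cons) auto
qed simp

text \<open>\<open>Span\<close> expects a list, so an enumeration of \<open>G\<close> is chosen;
  \<open>V_Span\<close> shows that the choice does not matter.\<close>

definition V :: "'a set" where "V = Span K (SOME Us. set Us = G)"

lemma V_Span: "set Us = G \<Longrightarrow> V = Span K Us"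
proof -
  assume Us: "set Us = G"
  then have "set (SOME Us. set Us = G) = G" by (rule someI[of "\<lambda>Us. set Us = G"])
  then show ?thesis unfolding V_def
    using Us G_carrier by (intro Span_same_set[OF K_subfield]) auto
qed

text \<open>A basis of \<open>G\<close> over \<open>F0\<close> has m elements, stays independent
  over \<open>K\<close> and spans \<open>V\<close>.\<close>

lemma card_V: "card V = q ^ m"
proof -
  obtain Gs where Gs: "set Gs = G" using finite_list[OF finite_G] by auto
  have GsR: "set Gs \<subseteq> carrier R" using Gs G_carrier by auto
  obtain Us where Us: "set Us \<subseteq> carrier R" "independent F0 Us" "Span F0 Us = Span F0 Gs"
    using filter_base[OF F0_subfield GsR] by auto
  have smult: "k \<otimes> v \<in> G" if "k \<in> F0" "v \<in> G" for k v
  proof -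
    have k: "k \<in> carrier R" "k [^] p = k" "k [^] q = k"
      using that F0_subset_K K_pow by (auto simp: F0_def)
    have "(k \<otimes> v) [^] q \<oplus> (k \<otimes> v) [^] p \<oplus> k \<otimes> v = k \<otimes> (v [^] q \<oplus> v [^] p \<oplus> v)"
      using k G_carrier[OF that(2)] by (simp add: nat_pow_distrib r_distr)
    then show ?thesis using that k by (simp add: G_iff)
  qed
  have "subalgebra F0 G R"
    using G_subgroup smult by (auto simp: subalgebra_def subalgebra_axioms_def)
  then have "Span F0 Gs \<subseteq> G" using Gs by (intro subalgebra_Span_incl[OF F0_subfield]) auto
  moreover have "G \<subseteq> Span F0 Gs" using Span_base_incl[OF F0_subfield GsR] Gs by simp
  ultimately have SG: "Span F0 Us = G" using Us by simp
  have UsG: "set Us \<subseteq> G" using Span_base_incl[OF F0_subfield Us(1)] SG by simp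
  have finF0: "finite F0" using finite_subset[OF F0_subset_K finite_K] .
  have "card F0 ^ length Us = p ^ m"
    using card_Span[OF F0_subfield Us(2,1) finF0] SG card_G by (simp add: q_def)
  moreover have "2 \<le> card F0"
  proof -
    have "{\<zero>, \<one>} \<subseteq> F0" using p_ge_2 by (auto simp: F0_def nat_pow_zero)
    then have "card {\<zero>, \<one>} \<le> card F0" by (rule card_mono[OF finF0])
    then show ?thesis by simp
  qed
  ultimately have len: "length Us = m"
  proof -
    \<comment> \<open>Only \<open>2 \<le> card F0 \<le> p\<close> is known so far. Since
      \<open>card F0\<close> divides the prime power \<open>p^m\<close>, it must be p, and then the
      basis has m elements.\<close>
    assume eq: "card F0 ^ length Us = p ^ m" and ge: "2 \<le> card F0"
    have "length Us \<noteq> 0" using eq q_ge(3) by (auto simp: q_def)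
    then have "card F0 dvd p ^ m" using eq by (metis dvd_power gr0I)
    then obtain j where j: "card F0 = p ^ j" using divides_primepow_nat[OF p_prime] by auto
    have "j \<noteq> 0" using j ge by (cases "j = 0") auto
    moreover have "j \<le> 1"
    proof (rule ccontr)
      assume "\<not> j \<le> 1"
      then have "p ^ 1 < p ^ j" using p_ge_2 by (intro power_strict_increasing) auto
      then show False using j card_F0_le by simp
    qed
    ultimately have "card F0 = p" using j by (simp add: le_Suc_eq)
    then show ?thesis using eq p_ge_2 by (simp add: power_inject_exp)
  qed
  have indK: "independent K Us" by (rule independent_F0_imp_K[OF Us(2) UsG])
  have "V = Span K Us"
  proof
    have "G \<subseteq> Span K Us"
      using SG Span_eq_combine_set[OF F0_subfield Us(1)] Span_eq_combine_set[OF K_subfield Us(1)]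
        F0_subset_K by blast
    then show "V \<subseteq> Span K Us"
      unfolding V_Span[OF Gs] using Gs Us by (intro mono_Span_subset[OF K_subfield]) auto
    show "Span K Us \<subseteq> V"
      unfolding V_Span[OF Gs] using Gs GsR UsG by (intro mono_Span_sublist[OF K_subfield]) auto
  qed
  then show ?thesis using card_Span[OF K_subfield indK Us(1) finite_K] K_card len by (simp add: q_def)
qed

lemma V_props:
  shows V_carrier: "v \<in> V \<Longrightarrow> v \<in> carrier R" and V_zero: "\<zero> \<in> V"
    and V_add: "v \<in> V \<Longrightarrow> w \<in> V \<Longrightarrow> v \<oplus> w \<in> V" and V_neg: "v \<in> V \<Longrightarrow> \<ominus> v \<in> V"
    and V_smult: "k \<in> K \<Longrightarrow> v \<in> V \<Longrightarrow> k \<otimes> v \<in> V" and G_subset_V: "G \<subseteq> V"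
proof -
  obtain Gs where Gs: "set Gs = G" using finite_list[OF finite_G] by auto
  have GsR: "set Gs \<subseteq> carrier R" using Gs G_carrier by auto
  note Span_subgroup_props[OF K_subfield GsR] Span_smult_closed[OF K_subfield GsR]
    Span_base_incl[OF K_subfield GsR]
  then show "v \<in> V \<Longrightarrow> v \<in> carrier R" "\<zero> \<in> V" "v \<in> V \<Longrightarrow> w \<in> V \<Longrightarrow> v \<oplus> w \<in> V" "v \<in> V \<Longrightarrow> \<ominus> v \<in> V"
    "k \<in> K \<Longrightarrow> v \<in> V \<Longrightarrow> k \<otimes> v \<in> V" "G \<subseteq> V"
    unfolding V_Span[OF Gs] using Gs by blast+
qed

text \<open>Induction along \<open>K\<close>-combinations of \<open>G\<close>. It serves twice: to
  generate all translations by \<open>V\<close>, and to show that a function invariant under all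
  \<open>k G\<close> is constant on \<open>V\<close>.\<close>

lemma V_induct [consumes 1, case_names zero step]:
  assumes v: "v \<in> V" and zero: "P \<zero>"
    and step: "\<And>k g w. k \<in> K \<Longrightarrow> g \<in> G \<Longrightarrow> w \<in> V \<Longrightarrow> P w \<Longrightarrow> P (k \<otimes> g \<oplus> w)"
  shows "P v"
proof -
  obtain Gs where Gs: "set Gs = G" using finite_list[OF finite_G] by auto
  have GsR: "set Gs \<subseteq> carrier R" using Gs G_carrier by auto
  have "set Ks \<subseteq> K \<Longrightarrow> set Us \<subseteq> G \<Longrightarrow> combine Ks Us \<in> V \<and> P (combine Ks Us)" for Ks Us
  proof (induction Ks Us rule: combine.induct)
    case (1 k Ks u Us)
    then show ?case using step G_subset_V by (auto intro!: V_add V_smult)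
  qed (auto simp: zero V_zero)
  then show ?thesis
    using v Span_eq_combine_set[OF K_subfield GsR] V_Span[OF Gs] Gs by auto
qed

lemma finite_V: "finite V"
  by (rule finite_subset[OF _ finite_carrier]) (auto dest: V_carrier)

end

section \<open>The affine group and its orbits\<close>

context coset_code_setup_ge2
begin

definition aff :: "'a \<Rightarrow> 'a \<Rightarrow> 'a \<Rightarrow> 'a" where
  "aff a b = (\<lambda>x\<in>carrier R. a \<otimes> x \<oplus> b)"

definition A :: "('a \<Rightarrow> 'a) monoid" where "A = aff_group G H"

lemma aff_apply [simp]: "x \<in> carrier R \<Longrightarrow> aff a b x = a \<otimes> x \<oplus> b"
  by (simp add: aff_def)

lemma aff_inj:
  assumes "a \<in> carrier R" "b \<in> carrier R" "c \<in> carrier R" "d \<in> carrier R" "aff a b = aff c d"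
  shows "a = c \<and> b = d"
proof -
  have "aff a b \<zero> = aff c d \<zero>" "aff a b \<one> = aff c d \<one>" using assms(5) by auto
  then have bd: "b = d" and "a \<oplus> b = c \<oplus> d" using assms(1-4) by simp_all
  then show ?thesis using assms(1-4) by simp
qed

lemma nonzero_mult: "a \<in> carrier R - {\<zero>} \<Longrightarrow> c \<in> carrier R - {\<zero>} \<Longrightarrow> a \<otimes> c \<in> carrier R - {\<zero>}"
  using integral_iff[of a c] by simp

lemma aff_Bij:
  assumes "a \<in> carrier R - {\<zero>}" "b \<in> carrier R"
  shows "aff a b \<in> Bij (carrier R)"
proof -
  have a: "a \<in> carrier R" "a \<in> Units R" using assms by (auto simp: field_Units)
  have "inj_on (aff a b) (carrier R)"
    using a assms(2) by (intro inj_onI) (simp add: Units_l_cancel)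
  moreover from this have "aff a b ` carrier R = carrier R"
    using a assms(2) by (intro endo_inj_surj finite_carrier) auto
  ultimately show ?thesis by (simp add: Bij_def bij_betw_def aff_def)
qed

lemma AGL1_carrier: "carrier AGL1 = {aff a b |a b. a \<in> carrier R - {\<zero>} \<and> b \<in> carrier R}"
  by (simp add: AGL1_def aff_def)

lemma AGL1_mult:
  assumes "a \<in> carrier R - {\<zero>}" "b \<in> carrier R" "c \<in> carrier R - {\<zero>}" "d \<in> carrier R"
  shows "aff a b \<otimes>\<^bsub>AGL1\<^esub> aff c d = aff (a \<otimes> c) (a \<otimes> d \<oplus> b)"
proof -
  have "aff a b \<otimes>\<^bsub>AGL1\<^esub> aff c d = compose (carrier R) (aff a b) (aff c d)"
    using aff_Bij assms by (simp add: AGL1_def BijGroup_def)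
  also have "\<dots> = aff (a \<otimes> c) (a \<otimes> d \<oplus> b)"
    using assms by (auto simp: compose_def aff_def restrict_def fun_eq_iff r_distr m_assoc a_assoc)
  finally show ?thesis .
qed

lemma AGL1_one: "\<one>\<^bsub>AGL1\<^esub> = aff \<one> \<zero>"
  by (auto simp: AGL1_def BijGroup_def aff_def restrict_def fun_eq_iff)

lemma AGL1_inverse:
  assumes "a \<in> carrier R - {\<zero>}" "b \<in> carrier R"
  shows "aff (inv a) (\<ominus> (inv a \<otimes> b)) \<otimes>\<^bsub>AGL1\<^esub> aff a b = \<one>\<^bsub>AGL1\<^esub>"
    and "inv a \<in> carrier R - {\<zero>}"
proof -
  have a: "a \<in> Units R" using assms by (simp add: field_Units)
  then show ia: "inv a \<in> carrier R - {\<zero>}" using Units_inv_Units field_Units by auto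
  show "aff (inv a) (\<ominus> (inv a \<otimes> b)) \<otimes>\<^bsub>AGL1\<^esub> aff a b = \<one>\<^bsub>AGL1\<^esub>"
    using assms ia a by (subst AGL1_mult) (auto simp: AGL1_one r_neg)
qed

lemma AGL1_group: "group AGL1"
proof (rule groupI)
  fix x y z assume "x \<in> carrier AGL1" "y \<in> carrier AGL1" "z \<in> carrier AGL1"
  then obtain a b c d e f where *: "x = aff a b" "y = aff c d" "z = aff e f"
    "a \<in> carrier R - {\<zero>}" "c \<in> carrier R - {\<zero>}" "e \<in> carrier R - {\<zero>}"
    "b \<in> carrier R" "d \<in> carrier R" "f \<in> carrier R"
    unfolding AGL1_carrier by blast
  have nz: "a \<otimes> c \<in> carrier R - {\<zero>}" "c \<otimes> e \<in> carrier R - {\<zero>}"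
    using nonzero_mult[OF *(4,5)] nonzero_mult[OF *(5,6)] .
  show "x \<otimes>\<^bsub>AGL1\<^esub> y \<otimes>\<^bsub>AGL1\<^esub> z = x \<otimes>\<^bsub>AGL1\<^esub> (y \<otimes>\<^bsub>AGL1\<^esub> z)"
    using * nz by (simp add: AGL1_mult r_distr m_assoc a_assoc)
next
  fix x y assume "x \<in> carrier AGL1" "y \<in> carrier AGL1"
  then obtain a b c d where *: "x = aff a b" "y = aff c d"
    "a \<in> carrier R - {\<zero>}" "c \<in> carrier R - {\<zero>}" "b \<in> carrier R" "d \<in> carrier R"
    unfolding AGL1_carrier by blast
  have nz: "a \<otimes> c \<in> carrier R - {\<zero>}" using nonzero_mult[OF *(3,4)] .
  have "x \<otimes>\<^bsub>AGL1\<^esub> y = aff (a \<otimes> c) (a \<otimes> d \<oplus> b)" unfolding *(1,2) using * by (intro AGL1_mult) auto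
  then show "x \<otimes>\<^bsub>AGL1\<^esub> y \<in> carrier AGL1" unfolding AGL1_carrier using nz * by blast
next
  have "\<one> \<in> carrier R - {\<zero>}" by simp
  then show "\<one>\<^bsub>AGL1\<^esub> \<in> carrier AGL1" unfolding AGL1_carrier AGL1_one using zero_closed by blast
next
  fix x assume "x \<in> carrier AGL1"
  then obtain a b where *: "x = aff a b" "a \<in> carrier R - {\<zero>}" "b \<in> carrier R"
    unfolding AGL1_carrier by blast
  show "\<one>\<^bsub>AGL1\<^esub> \<otimes>\<^bsub>AGL1\<^esub> x = x" using * by (simp add: AGL1_one AGL1_mult)
  show "\<exists>y\<in>carrier AGL1. y \<otimes>\<^bsub>AGL1\<^esub> x = \<one>\<^bsub>AGL1\<^esub>"
  proof (rule bexI)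
    show "aff (inv a) (\<ominus> (inv a \<otimes> b)) \<otimes>\<^bsub>AGL1\<^esub> x = \<one>\<^bsub>AGL1\<^esub>"
      unfolding *(1) by (rule AGL1_inverse[OF *(2,3)])
    have "inv a \<in> carrier R - {\<zero>}" "\<ominus> (inv a \<otimes> b) \<in> carrier R"
      using AGL1_inverse(2)[OF *(2,3)] *(3) by auto
    then show "aff (inv a) (\<ominus> (inv a \<otimes> b)) \<in> carrier AGL1" unfolding AGL1_carrier by blast
  qed
qed

definition affs :: "('a \<Rightarrow> 'a) set" where "affs = {aff a b |a b. a \<in> H \<and> b \<in> V}"

lemma H_nonzero: "a \<in> H \<Longrightarrow> a \<in> carrier R - {\<zero>}" using H_Units by auto

lemma affs_subgroup: "subgroup affs AGL1"
proof -
  interpret AGL: group AGL1 by (rule AGL1_group)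
  show ?thesis
  proof (rule AGL.subgroupI)
    show "affs \<subseteq> carrier AGL1" unfolding affs_def AGL1_carrier using H_nonzero V_carrier by blast
    show "affs \<noteq> {}" unfolding affs_def using one_H V_zero by blast
  next
    fix x assume "x \<in> affs"
    then obtain a b where x: "x = aff a b" "a \<in> H" "b \<in> V" unfolding affs_def by blast
    then have ab: "a \<in> carrier R - {\<zero>}" "b \<in> carrier R" using H_nonzero V_carrier by auto
    have "aff (inv a) (\<ominus> (inv a \<otimes> b)) \<in> carrier AGL1" "x \<in> carrier AGL1"
      unfolding AGL1_carrier using AGL1_inverse(2)[OF ab] ab x(1) by (blast intro: m_closed a_inv_closed)+
    then have "inv\<^bsub>AGL1\<^esub> x = aff (inv a) (\<ominus> (inv a \<otimes> b))"
      using AGL1_inverse(1)[OF ab] unfolding x(1) by (intro AGL.inv_equality)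
    moreover have "inv a \<in> H" "\<ominus> (inv a \<otimes> b) \<in> V"
      using x H_inv(1) H_Units by (auto intro!: V_neg V_smult)
    ultimately show "inv\<^bsub>AGL1\<^esub> x \<in> affs" unfolding affs_def by blast
  next
    fix x y assume "x \<in> affs" "y \<in> affs"
    then obtain a b c d where x: "x = aff a b" "a \<in> H" "b \<in> V" "y = aff c d" "c \<in> H" "d \<in> V"
      unfolding affs_def by blast
    have "x \<otimes>\<^bsub>AGL1\<^esub> y = aff (a \<otimes> c) (a \<otimes> d \<oplus> b)"
      unfolding x(1,4) using x H_nonzero V_carrier by (intro AGL1_mult) auto
    moreover have "a \<otimes> c \<in> H" "a \<otimes> d \<oplus> b \<in> V"
      using x H_mult H_Units by (auto intro!: V_add V_smult)
    ultimately show "x \<otimes>\<^bsub>AGL1\<^esub> y \<in> affs" unfolding affs_def by blast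
  qed
qed

lemma translation_maps_eq: "translation_maps G = (\<lambda>g. aff \<one> g) ` G"
  unfolding translation_maps_def aff_def by (auto simp: image_def restrict_def fun_eq_iff)

lemma scaling_maps_eq: "scaling_maps H = (\<lambda>c. aff c \<zero>) ` H"
proof -
  have "(\<lambda>x\<in>carrier R. c \<otimes> x) = aff c \<zero>" if "c \<in> H" for c
    using H_Units[OF that] by (auto simp: aff_def restrict_def fun_eq_iff)
  then show ?thesis unfolding scaling_maps_def by (auto simp: image_def)
qed

text \<open>Conjugating translations by scalings produces translations by all
  \<open>K\<close>-multiples of elements of \<open>G\<close>, hence by all of
  \<open>V\<close>.\<close>

lemma A_carrier: "carrier A = affs"
proof -
  interpret AGL: group AGL1 by (rule AGL1_group)
  let ?S = "translation_maps G \<union> scaling_maps H"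
  have S: "?S \<subseteq> affs"
    unfolding translation_maps_eq scaling_maps_eq affs_def using G_subset_V V_zero one_H by blast
  then have S': "carrier AGL1 \<inter> ?S = ?S" using AGL.subgroup_self subgroup.subset[OF affs_subgroup] by auto
  have "carrier A = generate AGL1 ?S" by (simp add: A_def aff_group_def subgroup_generated_def S')
  also have "\<dots> = affs"
  proof
    show "generate AGL1 ?S \<subseteq> affs" using AGL.generate_subgroup_incl[OF S affs_subgroup] .
    have mult: "x \<otimes>\<^bsub>AGL1\<^esub> y \<in> generate AGL1 ?S" if "x \<in> generate AGL1 ?S" "y \<in> generate AGL1 ?S" for x y
      using that by (rule generate.eng)
    have sc: "aff c \<zero> \<in> generate AGL1 ?S" if "c \<in> H" for c
      using that by (intro generate.incl) (auto simp: scaling_maps_eq)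
    have tr: "aff \<one> g \<in> generate AGL1 ?S" if "g \<in> G" for g
      using that by (intro generate.incl) (auto simp: translation_maps_eq)
    have one: "\<one> \<in> carrier R - {\<zero>}" by simp
    have tV: "aff \<one> v \<in> generate AGL1 ?S" if "v \<in> V" for v
      using that
    proof (induction rule: V_induct)
      case zero
      then show ?case using sc[OF one_H] .
    next
      case (step k g w)
      have w: "w \<in> carrier R" and g: "g \<in> carrier R" using step V_carrier G_carrier by auto
      show ?case
      proof (cases "k = \<zero>")
        case True
        then show ?thesis using step w g by simp
      next
        case False
        then have k: "k \<in> H" "k \<in> carrier R - {\<zero>}" "inv k \<in> H" "inv k \<in> carrier R - {\<zero>}" "k \<otimes> inv k = \<one>"
          using step H_inv H_nonzero by (auto simp: H_def)
        \<comment> \<open>Scale by \<open>inv k\<close>, translate by \<open>g\<close>, scale by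
          \<open>k\<close>: the result is the translation by \<open>k \<otimes> g\<close>.\<close>
        have "aff k \<zero> \<otimes>\<^bsub>AGL1\<^esub> aff \<one> g = aff k (k \<otimes> g)"
          using k g by (subst AGL1_mult) auto
        moreover have "aff k (k \<otimes> g) \<otimes>\<^bsub>AGL1\<^esub> aff (inv k) \<zero> = aff \<one> (k \<otimes> g)"
          using k g by (subst AGL1_mult) auto
        moreover have "aff \<one> (k \<otimes> g) \<otimes>\<^bsub>AGL1\<^esub> aff \<one> w = aff \<one> (k \<otimes> g \<oplus> w)"
          using k g w by (subst AGL1_mult) (auto simp: a_comm)
        ultimately show ?thesis
          using mult[OF mult[OF mult[OF sc[OF k(1)] tr[OF step(2)]] sc[OF k(3)]] step(4)] by simp
      qed
    qed
    show "affs \<subseteq> generate AGL1 ?S"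
    proof
      fix x assume "x \<in> affs"
      then obtain a b where x: "x = aff a b" "a \<in> H" "b \<in> V" unfolding affs_def by blast
      then have "aff \<one> b \<otimes>\<^bsub>AGL1\<^esub> aff a \<zero> = aff a b"
        using H_nonzero[of a] V_carrier[of b] by (subst AGL1_mult) auto
      then show "x \<in> generate AGL1 ?S" using mult[OF tV[OF x(3)] sc[OF x(2)]] x by simp
    qed
  qed
  finally show ?thesis .
qed

lemma A_mult: "\<lbrakk>a \<in> H; b \<in> V; c \<in> H; d \<in> V\<rbrakk> \<Longrightarrow> aff a b \<otimes>\<^bsub>A\<^esub> aff c d = aff (a \<otimes> c) (a \<otimes> d \<oplus> b)"
  using AGL1_mult[of a b c d] H_nonzero V_carrier by (simp add: A_def aff_group_def subgroup_generated_def)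

lemma order_A: "Coset.order A = (q - 1) * q ^ m"
proof -
  have "inj_on (\<lambda>(a, b). aff a b) (H \<times> V)"
    using aff_inj H_Units V_carrier by (auto simp: inj_on_def) metis+
  moreover have "affs = (\<lambda>(a, b). aff a b) ` (H \<times> V)" unfolding affs_def by auto
  ultimately show ?thesis
    by (simp add: Coset.order_def A_carrier card_image card_cartesian_product card_H card_V)
qed

text \<open>Otherwise the map with multiplier \<open>a\<close> and fixed point
  \<open>\<alpha>\<close> would belong to the group for every \<open>a\<close> in \<open>H\<close>;
  as \<open>q \<ge> 4\<close> there is such an \<open>a\<close> other than one, against the trivial
  stabilizer.\<close>

lemma \<alpha>_notin_V: "\<alpha> \<notin> V"
proof
  assume \<alpha>V: "\<alpha> \<in> V"
  have "2 < card K" using K_card q_ge(3) by (simp add: q_def)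
  moreover have "card K \<le> 2" if "K \<subseteq> {\<zero>, \<one>}"
    using card_mono[OF _ that] by simp
  ultimately obtain a where a: "a \<in> K" "a \<noteq> \<zero>" "a \<noteq> \<one>" by fastforce
  have aH: "a \<in> H" "a \<in> carrier R" using a K_carrier by (auto simp: H_def)
  define b where "b = \<alpha> \<ominus> a \<otimes> \<alpha>"
  have b: "b \<in> V" unfolding b_def a_minus_def using \<alpha>V a by (auto intro!: V_add V_neg V_smult)
  have bR: "b \<in> carrier R" using b V_carrier by simp
  have "aff a b \<alpha> = \<alpha>"
    using aH \<alpha>_carrier by (simp add: b_def a_minus_def a_lcomm r_neg)
  then have "aff a b \<in> stabilizer A (\<lambda>\<phi>. \<phi>) \<alpha>"
    unfolding stabilizer_def A_carrier affs_def using aH b by blast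
  then have "aff a b = \<one>\<^bsub>A\<^esub>"
    using \<alpha>_stabilizer by (simp add: A_def G_def H_def)
  also have "\<dots> = aff \<one> \<zero>" by (simp add: A_def aff_group_def subgroup_generated_def AGL1_one)
  finally have "a = \<one>" using aff_inj[of a b \<one> \<zero>] aH bR by simp
  then show False using a by simp
qed

text \<open>Coordinates on the evaluation set. With the scalar outside, \<open>H\<close> acts on
  \<open>a\<close> alone, so right orbits are indexed by \<open>v\<close>; adding \<open>g\<close>
  keeps \<open>a\<close> and moves \<open>v\<close> by \<open>inv a \<otimes> g\<close>, so a left
  orbit is a coset of \<open>inv a G\<close> in \<open>V\<close>.\<close>

definition \<omega> :: "'a \<Rightarrow> 'a \<Rightarrow> 'a" where "\<omega> a v = a \<otimes> (\<alpha> \<oplus> v)"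

definition \<Omega> :: "'a set" where "\<Omega> = eval_set G H \<alpha>"

lemma \<omega>_carrier: "a \<in> H \<Longrightarrow> v \<in> V \<Longrightarrow> \<omega> a v \<in> carrier R"
  using H_Units V_carrier \<alpha>_carrier by (simp add: \<omega>_def)

text \<open>Two representations with different scalars would put a nonzero \<open>K\<close>-multiple
  of \<open>\<alpha>\<close> into \<open>V\<close>.\<close>

lemma \<omega>_inj:
  assumes "a \<in> H" "v \<in> V" "c \<in> H" "w \<in> V" "\<omega> a v = \<omega> c w"
  shows "a = c \<and> v = w"
proof -
  have R: "a \<in> carrier R" "c \<in> carrier R" "v \<in> carrier R" "w \<in> carrier R"
    using assms H_Units V_carrier by auto
  have "a = c"
  proof (rule ccontr)
    assume ne: "a \<noteq> c"
    have "a \<ominus> c \<in> K" using assms H_Units K_closed by (simp add: a_minus_def)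
    moreover have "a \<ominus> c \<noteq> \<zero>" using ne R by simp
    ultimately have ac: "a \<ominus> c \<in> H" by (simp add: H_def)
    have "(a \<ominus> c) \<otimes> \<alpha> = c \<otimes> w \<ominus> a \<otimes> v"
    proof -
      have e: "a \<otimes> \<alpha> \<oplus> a \<otimes> v = c \<otimes> \<alpha> \<oplus> c \<otimes> w"
        using assms(5) R \<alpha>_carrier by (simp add: \<omega>_def r_distr)
      have "(a \<ominus> c) \<otimes> \<alpha> = (a \<otimes> \<alpha> \<oplus> a \<otimes> v) \<ominus> a \<otimes> v \<ominus> c \<otimes> \<alpha>"
        using R \<alpha>_carrier by algebra
      also have "\<dots> = c \<otimes> w \<ominus> a \<otimes> v"
        unfolding e using R \<alpha>_carrier by algebra
      finally show ?thesis .
    qed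
    also have "\<dots> \<in> V" using assms H_Units by (auto simp: a_minus_def intro!: V_add V_neg V_smult)
    finally have V': "(a \<ominus> c) \<otimes> \<alpha> \<in> V" .
    have "inv (a \<ominus> c) \<otimes> ((a \<ominus> c) \<otimes> \<alpha>) \<in> V"
      using H_Units[OF H_inv(1)[OF ac]] by (intro V_smult[OF _ V']) auto
    also have "inv (a \<ominus> c) \<otimes> ((a \<ominus> c) \<otimes> \<alpha>) = \<alpha>"
      using H_inv[OF ac] H_Units \<alpha>_carrier ac by (simp add: m_assoc[symmetric])
    finally show False using \<alpha>_notin_V by simp
  qed
  then have "\<alpha> \<oplus> v = \<alpha> \<oplus> w"
    using assms R \<alpha>_carrier H_Units[of a] by (auto simp: \<omega>_def Units_l_cancel)
  then show ?thesis using \<open>a = c\<close> R \<alpha>_carrier by simp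
qed

lemma \<omega>_inj_on: "inj_on (\<lambda>(a, v). \<omega> a v) (H \<times> V)"
  using \<omega>_inj by (auto intro!: inj_onI)

lemma \<omega>_nonzero: 
  assumes "a \<in> H" "v \<in> V" shows "\<omega> a v \<noteq> \<zero>"
proof
  assume "\<omega> a v = \<zero>"
  then have "\<alpha> \<oplus> v = \<zero>" using assms H_Units V_carrier \<alpha>_carrier integral_iff by (auto simp: \<omega>_def)
  then have "\<alpha> = \<ominus> v" using assms V_carrier \<alpha>_carrier by (intro minus_equality[symmetric]) auto
  then show False using V_neg[OF assms(2)] \<alpha>_notin_V by simp
qed

lemma \<omega>_add: "a \<in> H \<Longrightarrow> v \<in> V \<Longrightarrow> g \<in> carrier R \<Longrightarrow> \<omega> a v \<oplus> g = \<omega> a (v \<oplus> inv a \<otimes> g)"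
proof -
  assume *: "a \<in> H" "v \<in> V" "g \<in> carrier R"
  have "a \<otimes> (inv a \<otimes> g) = g" using * H_inv[of a] H_Units by (simp add: m_assoc[symmetric])
  then show ?thesis using * H_inv(1)[of a] H_Units V_carrier \<alpha>_carrier by (simp add: \<omega>_def r_distr a_assoc)
qed

lemma \<omega>_mult: "a \<in> H \<Longrightarrow> v \<in> V \<Longrightarrow> c \<in> H \<Longrightarrow> c \<otimes> \<omega> a v = \<omega> (c \<otimes> a) v"
  using H_Units V_carrier \<alpha>_carrier by (simp add: \<omega>_def m_assoc)

lemma shift_V: "a \<in> H \<Longrightarrow> v \<in> V \<Longrightarrow> g \<in> G \<Longrightarrow> v \<oplus> inv a \<otimes> g \<in> V"
  using H_inv(1) H_Units G_subset_V by (intro V_add V_smult) auto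

lemma \<Omega>_eq: "\<Omega> = (\<lambda>(a, v). \<omega> a v) ` (H \<times> V)"
proof -
  have "\<Omega> = {a \<otimes> \<alpha> \<oplus> b |a b. a \<in> H \<and> b \<in> V}"
    unfolding \<Omega>_def eval_set_def orbit_def A_def[symmetric] A_carrier affs_def
    using \<alpha>_carrier by (force simp del: aff_apply simp: aff_apply[symmetric])
  also have "\<dots> = (\<lambda>(a, v). \<omega> a v) ` (H \<times> V)"
  proof (intro equalityI subsetI)
    fix x assume "x \<in> {a \<otimes> \<alpha> \<oplus> b |a b. a \<in> H \<and> b \<in> V}"
    then obtain a b where x: "a \<in> H" "b \<in> V" "x = a \<otimes> \<alpha> \<oplus> b" by auto
    have "a \<otimes> (inv a \<otimes> b) = b" using x H_inv[of a] H_Units V_carrier by (simp add: m_assoc[symmetric])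
    then have "x = \<omega> a (inv a \<otimes> b)"
      using x H_Units H_inv(1)[of a] V_carrier \<alpha>_carrier by (simp add: \<omega>_def r_distr)
    moreover have "inv a \<otimes> b \<in> V" using x H_inv(1)[of a] H_Units by (intro V_smult) auto
    ultimately show "x \<in> (\<lambda>(a, v). \<omega> a v) ` (H \<times> V)" using x by auto
  next
    fix x assume "x \<in> (\<lambda>(a, v). \<omega> a v) ` (H \<times> V)"
    then obtain a v where x: "a \<in> H" "v \<in> V" "x = \<omega> a v" by auto
    then have "x = a \<otimes> \<alpha> \<oplus> a \<otimes> v" "a \<otimes> v \<in> V"
      using H_Units V_carrier \<alpha>_carrier by (auto simp: \<omega>_def r_distr intro: V_smult)
    then show "x \<in> {a \<otimes> \<alpha> \<oplus> b |a b. a \<in> H \<and> b \<in> V}" using x by blast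
  qed
  finally show ?thesis .
qed

lemma card_\<Omega>: "card \<Omega> = (q - 1) * q ^ m"
  unfolding \<Omega>_eq card_image[OF \<omega>_inj_on] by (simp add: card_cartesian_product card_H card_V)

lemma \<Omega>_carrier: "\<Omega> \<subseteq> carrier R"
  unfolding \<Omega>_eq using \<omega>_carrier by auto

lemma finite_\<Omega>: "finite \<Omega>"
  by (rule finite_subset[OF \<Omega>_carrier finite_carrier])

definition left_orb :: "'a \<Rightarrow> 'a \<Rightarrow> 'a set" where
  "left_orb a v = (\<lambda>g. \<omega> a (v \<oplus> inv a \<otimes> g)) ` G"

definition right_orb :: "'a \<Rightarrow> 'a set" where
  "right_orb v = (\<lambda>a. \<omega> a v) ` H"

lemma left_orbits_eq: "left_orbits G H \<alpha> = (\<lambda>(a, v). left_orb a v) ` (H \<times> V)"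
proof -
  have "orbit (A\<lparr>carrier := translation_maps G\<rparr>) (\<lambda>\<phi>. \<phi>) (\<omega> a v) = left_orb a v"
    if "a \<in> H" "v \<in> V" for a v
  proof -
    have "orbit (A\<lparr>carrier := translation_maps G\<rparr>) (\<lambda>\<phi>. \<phi>) (\<omega> a v) = (\<lambda>g. aff \<one> g (\<omega> a v)) ` G"
      by (auto simp: orbit_def translation_maps_eq)
    also have "\<dots> = left_orb a v"
      unfolding left_orb_def using \<omega>_carrier[OF that] \<omega>_add[OF that] G_carrier by (intro image_cong) auto
    finally show ?thesis .
  qed
  then show ?thesis
    unfolding left_orbits_def orbits_def A_def[symmetric] \<Omega>_def[symmetric] \<Omega>_eq by (auto simp: image_def) blast
qed

lemma right_orbits_eq: "right_orbits G H \<alpha> = right_orb ` V"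
proof -
  have "orbit (A\<lparr>carrier := scaling_maps H\<rparr>) (\<lambda>\<phi>. \<phi>) (\<omega> a v) = right_orb v"
    if "a \<in> H" "v \<in> V" for a v
  proof (intro equalityI subsetI)
    fix x assume "x \<in> orbit (A\<lparr>carrier := scaling_maps H\<rparr>) (\<lambda>\<phi>. \<phi>) (\<omega> a v)"
    then obtain c where c: "c \<in> H" "x = aff c \<zero> (\<omega> a v)" by (auto simp: orbit_def scaling_maps_eq)
    then have "x = \<omega> (c \<otimes> a) v"
      using that \<omega>_carrier[OF that] \<omega>_carrier[OF H_mult[OF c(1) that(1)] that(2)] \<omega>_mult H_Units by simp
    then show "x \<in> right_orb v" using c that H_mult by (auto simp: right_orb_def)
  next
    fix x assume "x \<in> right_orb v"
    then obtain b where b: "b \<in> H" "x = \<omega> b v" by (auto simp: right_orb_def)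
    let ?c = "b \<otimes> inv a"
    have c: "?c \<in> H" using b that H_inv(1) H_mult by simp
    have "?c \<otimes> a = b" using b that H_inv[of a] H_Units by (simp add: m_assoc)
    then have "x = aff ?c \<zero> (\<omega> a v)"
      using \<omega>_carrier[OF that] \<omega>_carrier[OF b(1) that(2)] \<omega>_mult[OF that c] b by simp
    then show "x \<in> orbit (A\<lparr>carrier := scaling_maps H\<rparr>) (\<lambda>\<phi>. \<phi>) (\<omega> a v)"
      using c unfolding orbit_def scaling_maps_eq by auto
  qed
  then show ?thesis
    unfolding right_orbits_def orbits_def A_def[symmetric] \<Omega>_def[symmetric] \<Omega>_eq
    using one_H by (auto simp: image_def)
qed

lemma left_orb_inj: "a \<in> H \<Longrightarrow> v \<in> V \<Longrightarrow> inj_on (\<lambda>g. \<omega> a (v \<oplus> inv a \<otimes> g)) G"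
proof (rule inj_onI)
  fix g h assume *: "a \<in> H" "v \<in> V" "g \<in> G" "h \<in> G" "\<omega> a (v \<oplus> inv a \<otimes> g) = \<omega> a (v \<oplus> inv a \<otimes> h)"
  then have "\<omega> a v \<oplus> g = \<omega> a v \<oplus> h" using \<omega>_add G_carrier by simp
  then show "g = h" using * \<omega>_carrier G_carrier by simp
qed

lemma card_left_orb: "a \<in> H \<Longrightarrow> v \<in> V \<Longrightarrow> card (left_orb a v) = q"
  using card_image[OF left_orb_inj] card_G by (simp add: left_orb_def)

lemma card_right_orb: "v \<in> V \<Longrightarrow> card (right_orb v) = q - 1"
  unfolding right_orb_def using \<omega>_inj by (subst card_image) (auto intro!: inj_onI simp: card_H)

lemma left_orb_subset: "a \<in> H \<Longrightarrow> v \<in> V \<Longrightarrow> left_orb a v \<subseteq> \<Omega>"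
  unfolding left_orb_def \<Omega>_eq using shift_V by auto

lemma right_orb_subset: "v \<in> V \<Longrightarrow> right_orb v \<subseteq> \<Omega>"
  unfolding right_orb_def \<Omega>_eq by auto

end

section \<open>Evaluation codes\<close>

context field
begin

lemma RS_code_eq:
  assumes "0 < k"
  shows "RS_code S k = (\<lambda>f. \<lambda>x\<in>S. eval f x) ` {f \<in> carrier (poly_ring R). real (length f) < k + 1}"
  by (simp add: RS_code_def evaluations_def pdeg_less_iff[OF assms])

lemma restrict_eval_RS_iff:
  assumes "0 < k" "S \<subseteq> T"
  shows "restrict (\<lambda>x\<in>T. eval f x) S \<in> RS_code S k \<longleftrightarrow>
    (\<exists>g\<in>carrier (poly_ring R). real (length g) < k + 1 \<and> (\<forall>x\<in>S. eval g x = eval f x))"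
proof -
  have 1: "restrict (\<lambda>x\<in>T. eval f x) S = (\<lambda>x\<in>S. eval f x)"
    using assms(2) by (auto simp: restrict_def fun_eq_iff)
  have 2: "(\<lambda>x\<in>S. eval f x) = (\<lambda>x\<in>S. eval g x) \<longleftrightarrow> (\<forall>x\<in>S. eval g x = eval f x)" for g
    by (auto simp: restrict_def fun_eq_iff)
  show ?thesis unfolding RS_code_eq[OF assms(1)] 1 using 2 by (auto simp: image_iff)
qed

text \<open>When all fibres of \<open>u\<close> on \<open>\<Omega>\<close> have the full size
  \<open>degree u\<close>, the number of fibres times this degree is \<open>card \<Omega>\<close>.
  The fibre criterion therefore reaches every polynomial of degree below
  \<open>card \<Omega>\<close>.\<close>

lemma base_deg_less_iff_orbits:
  assumes u: "u \<in> carrier (poly_ring R)" and d: "0 < Polynomials.degree u"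
    and \<Omega>: "finite \<Omega>" "\<Omega> \<subseteq> carrier R"
    and orb: "\<And>x. x \<in> \<Omega> \<Longrightarrow> card {y \<in> \<Omega>. eval u y = eval u x} = Polynomials.degree u"
    and f: "f \<in> carrier (poly_ring R)" "length f \<le> card \<Omega>"
    and k: "0 < k" "k \<le> real (Polynomials.degree u)"
  shows "base_deg u f < ereal k \<longleftrightarrow>
    (\<forall>x\<in>\<Omega>. restrict (\<lambda>x\<in>\<Omega>. eval f x) {y \<in> \<Omega>. eval u y = eval u x} \<in> RS_code {y \<in> \<Omega>. eval u y = eval u x} k)"
proof -
  let ?Y = "eval u ` \<Omega>" and ?S = "\<lambda>y. {x \<in> \<Omega>. eval u x = y}"
  have "card \<Omega> = (\<Sum>x\<in>\<Omega>. 1)" by simp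
  also have "\<dots> = (\<Sum>y\<in>?Y. \<Sum>x\<in>?S y. 1)" by (rule sum.image_gen[OF \<Omega>(1)])
  also have "\<dots> = (\<Sum>y\<in>?Y. Polynomials.degree u)"
    by (rule sum.cong[OF refl]) (use orb in \<open>auto simp del: One_nat_def\<close>)
  also have "\<dots> = card ?Y * Polynomials.degree u" by simp
  finally have "length f \<le> card ?Y * Polynomials.degree u" using f by simp
  then have "base_deg u f < ereal k \<longleftrightarrow>
      (\<forall>y\<in>?Y. \<exists>g\<in>carrier (poly_ring R). real (length g) < k + 1 \<and> (\<forall>x\<in>?S y. eval g x = eval f x))"
    using u d \<Omega> orb f(1) k by (intro base_deg_less_iff_fibres) auto
  also have "\<dots> \<longleftrightarrow> (\<forall>x\<in>\<Omega>. restrict (\<lambda>x\<in>\<Omega>. eval f x) (?S (eval u x)) \<in> RS_code (?S (eval u x)) k)"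
  proof -
    have "restrict (\<lambda>x\<in>\<Omega>. eval f x) (?S y) \<in> RS_code (?S y) k \<longleftrightarrow>
      (\<exists>g\<in>carrier (poly_ring R). real (length g) < k + 1 \<and> (\<forall>x\<in>?S y. eval g x = eval f x))" for y
      by (rule restrict_eval_RS_iff[OF k(1)]) auto
    then show ?thesis by simp
  qed
  finally show ?thesis .
qed

text \<open>\<open>min_dist\<close> is a \<open>Min\<close> and says something only for a nonempty
  set of distances, so two distinct words have to be exhibited; the constant words zero and one play
  this part later.\<close>

lemma rel_min_dist_ge:
  assumes S: "finite S" and two: "c0 \<in> C" "d0 \<in> C" "c0 \<noteq> d0"
    and dist: "\<And>c d. c \<in> C \<Longrightarrow> d \<in> C \<Longrightarrow> c \<noteq> d \<Longrightarrow> \<delta> * real (card S) \<le> real (card {x \<in> S. c x \<noteq> d x})"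
    and ne: "S \<noteq> {}"
  shows "\<delta> \<le> rel_min_dist S C"
proof -
  let ?D = "{card {x \<in> S. c x \<noteq> d x} | c d. c \<in> C \<and> d \<in> C \<and> c \<noteq> d}"
  have "?D \<subseteq> {..card S}" using S by (auto intro!: card_mono)
  then have fin: "finite ?D" by (rule finite_subset) simp
  have "?D \<noteq> {}" using two by blast
  then have "Min ?D \<in> ?D" using fin by (intro Min_in)
  then have "\<delta> * real (card S) \<le> real (min_dist S C)" unfolding min_dist_def using dist by auto
  moreover have "0 < card S" using S ne by (simp add: card_gt_0_iff)
  ultimately show ?thesis unfolding rel_min_dist_def by (simp add: le_divide_eq)
qed

lemma constant_words_RS:
  assumes "0 < k"
  shows "(\<lambda>x\<in>S. \<zero>) \<in> RS_code S k" "(\<lambda>x\<in>S. \<one>) \<in> RS_code S k"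
proof -
  show "(\<lambda>x\<in>S. \<zero>) \<in> RS_code S k"
    unfolding RS_code_eq[OF assms] using assms by (intro image_eqI[of _ _ "[]"]) auto
  show "(\<lambda>x\<in>S. \<one>) \<in> RS_code S k"
    unfolding RS_code_eq[OF assms] using assms by (intro image_eqI[of _ _ "[\<one>]"]) auto
qed

lemma constant_words_distinct: "S \<noteq> {} \<Longrightarrow> (\<lambda>x\<in>S. \<zero>) \<noteq> (\<lambda>x\<in>S. \<one>)"
proof
  assume "S \<noteq> {}" and eq: "(\<lambda>x\<in>S. \<zero>) = (\<lambda>x\<in>S. \<one>)"
  then obtain x where "x \<in> S" by auto
  then show False using fun_cong[OF eq, of x] by simp
qed

lemma RS_dist:
  assumes k: "0 < k" and S: "finite S" "S \<subseteq> carrier R"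
    and c: "c \<in> RS_code S k" "d \<in> RS_code S k" "c \<noteq> d"
  shows "real (card S) - k \<le> real (card {x \<in> S. c x \<noteq> d x})"
proof -
  interpret P: domain "poly_ring R" by (rule poly_ring_domain)
  obtain f g where fg: "f \<in> carrier (poly_ring R)" "g \<in> carrier (poly_ring R)"
    "real (length f) < k + 1" "real (length g) < k + 1" "c = (\<lambda>x\<in>S. eval f x)" "d = (\<lambda>x\<in>S. eval g x)"
    using c unfolding RS_code_eq[OF k] by auto
  let ?h = "f \<ominus>\<^bsub>poly_ring R\<^esub> g"
  have h: "?h \<in> carrier (poly_ring R)" using fg by simp
  have "f \<noteq> g" using c(3) fg by auto
  then have h0: "?h \<noteq> []" using P.r_right_minus_eq[OF fg(1,2)] by (simp add: poly_ring_simps(1))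
  have "real (length ?h) < k + 1" using length_minus_le[OF fg(2), of f] fg(3,4) by linarith
  moreover have "card {x \<in> carrier R. eval ?h x = \<zero>} < length ?h"
    "finite {x \<in> carrier R. eval ?h x = \<zero>}" using card_zeros_less[OF h h0] by auto
  moreover have "{x \<in> S. c x = d x} \<subseteq> {x \<in> carrier R. eval ?h x = \<zero>}"
    using fg S by auto
  ultimately have "real (card {x \<in> S. c x = d x}) < k"
    using card_mono[of "{x \<in> carrier R. eval ?h x = \<zero>}" "{x \<in> S. c x = d x}"] by linarith
  moreover have "card S = card {x \<in> S. c x = d x} + card {x \<in> S. c x \<noteq> d x}"
    using S(1) by (subst card_Un_disjoint[symmetric]) (auto intro: arg_cong[of _ _ card])
  ultimately show ?thesis by simp
qed

lemma RS_rel_min_dist: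
  assumes "0 < r" and S: "finite S" "S \<subseteq> carrier R" "S \<noteq> {}"
  shows "1 - r \<le> rel_min_dist S (RS_code S (r * real (card S)))"
proof (rule rel_min_dist_ge[OF S(1)])
  have k: "0 < r * real (card S)" using assms by (simp add: card_gt_0_iff)
  show "(\<lambda>x\<in>S. \<zero>) \<in> RS_code S (r * real (card S))" "(\<lambda>x\<in>S. \<one>) \<in> RS_code S (r * real (card S))"
    by (rule constant_words_RS[OF k])+
  show "(\<lambda>x\<in>S. \<zero>) \<noteq> (\<lambda>x\<in>S. \<one>)" using constant_words_distinct[OF S(3)] .
  show "(1 - r) * real (card S) \<le> real (card {x \<in> S. c x \<noteq> d x})"
    if "c \<in> RS_code S (r * real (card S))" "d \<in> RS_code S (r * real (card S))" "c \<noteq> d" for c d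
    using RS_dist[OF k S(1,2) that] by (simp add: left_diff_distrib)
qed (use S in auto)

text \<open>Turns every dimension estimate below into a comparison of cardinalities, both for the
  upper bound on local rates and for the lower bound on the global rate.\<close>

lemma card_code_dim:
  assumes fin: "finite (carrier R)" "finite S" and sub: "C \<subseteq> S \<rightarrow>\<^sub>E carrier R"
    and zero: "(\<lambda>x\<in>S. \<zero>) \<in> C"
    and add: "\<And>c d. c \<in> C \<Longrightarrow> d \<in> C \<Longrightarrow> (\<lambda>x\<in>S. c x \<oplus> d x) \<in> C"
    and smult: "\<And>a c. a \<in> carrier R \<Longrightarrow> c \<in> C \<Longrightarrow> (\<lambda>x\<in>S. a \<otimes> c x) \<in> C"
  shows "card C = card (carrier R) ^ vectorspace.dim R ((func_space S)\<lparr>carrier := C\<rparr>)"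
proof -
  have mod: "module R (func_space S)" by (rule func_space_is_module)
  then have vs: "vectorspace R (func_space S)"
    by (simp add: vectorspace_def field_axioms)
  interpret FS: vectorspace R "func_space S" by (rule vs)
  have "submodule R C (func_space S)"
    by (rule submodule.intro[OF mod]) (use sub zero add smult in \<open>auto simp: func_space_def\<close>)
  then have "vectorspace R (FS.vs C)"
    using vs by (intro FS.subspace_is_vs) (simp add: subspace_def)
  then interpret W: vectorspace R "(func_space S)\<lparr>carrier := C\<rparr>" by simp
  have finC: "finite C" using finite_subset[OF sub finite_PiE[OF fin(2)]] fin by auto
  have "W.fin_dim" unfolding W.fin_dim_def
    using finC W.span_is_subset2[of C] W.in_own_span[of C] by (intro exI[of _ C]) auto
  then obtain \<beta> where \<beta>: "finite \<beta>" "W.basis \<beta>" using W.finite_basis_exists by auto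
  have \<beta>C: "\<beta> \<subseteq> carrier ((func_space S)\<lparr>carrier := C\<rparr>)" using \<beta>(2) by (simp add: W.basis_def)
  have ex1: "\<exists>!a. a \<in> \<beta> \<rightarrow>\<^sub>E carrier R \<and> W.lincomb a \<beta> = v" if "v \<in> C" for v
    using W.basis_criterion[OF \<beta>(1) \<beta>C] \<beta>(2) that by auto
  have "bij_betw (\<lambda>a. W.lincomb a \<beta>) (\<beta> \<rightarrow>\<^sub>E carrier R) C"
  proof (rule bij_betw_imageI)
    have cl: "W.lincomb a \<beta> \<in> C" if "a \<in> \<beta> \<rightarrow>\<^sub>E carrier R" for a
      using W.lincomb_closed[OF \<beta>C, of a] that by (auto simp: PiE_def)
    show "inj_on (\<lambda>a. W.lincomb a \<beta>) (\<beta> \<rightarrow>\<^sub>E carrier R)"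
      using ex1 cl by (intro inj_onI) blast
    show "(\<lambda>a. W.lincomb a \<beta>) ` (\<beta> \<rightarrow>\<^sub>E carrier R) = C"
      using cl ex1 by blast
  qed
  then have "card C = card (\<beta> \<rightarrow>\<^sub>E carrier R)" by (simp add: bij_betw_same_card)
  also have "\<dots> = card (carrier R) ^ card \<beta>" using \<beta>(1) by (simp add: card_PiE)
  also have "card \<beta> = W.dim" using W.dim_basis[OF \<beta>] by simp
  finally show ?thesis .
qed

lemma RS_closed:
  assumes k: "0 < k" and S: "S \<subseteq> carrier R"
  shows "RS_code S k \<subseteq> S \<rightarrow>\<^sub>E carrier R"
    and "c \<in> RS_code S k \<Longrightarrow> d \<in> RS_code S k \<Longrightarrow> (\<lambda>x\<in>S. c x \<oplus> d x) \<in> RS_code S k"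
    and "a \<in> carrier R \<Longrightarrow> c \<in> RS_code S k \<Longrightarrow> (\<lambda>x\<in>S. a \<otimes> c x) \<in> RS_code S k"
proof -
  show "RS_code S k \<subseteq> S \<rightarrow>\<^sub>E carrier R" using S by (auto simp: RS_code_eq[OF k])
next
  assume "c \<in> RS_code S k" "d \<in> RS_code S k"
  then obtain f g where fg: "f \<in> carrier (poly_ring R)" "g \<in> carrier (poly_ring R)"
    "real (length f) < k + 1" "real (length g) < k + 1" "c = (\<lambda>x\<in>S. eval f x)" "d = (\<lambda>x\<in>S. eval g x)"
    unfolding RS_code_eq[OF k] by auto
  have "real (length (f \<oplus>\<^bsub>poly_ring R\<^esub> g)) < k + 1" using length_add_le[of f g] fg(3,4) by linarith
  then show "(\<lambda>x\<in>S. c x \<oplus> d x) \<in> RS_code S k"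
    unfolding RS_code_eq[OF k] using fg S
    by (intro image_eqI[of _ _ "f \<oplus>\<^bsub>poly_ring R\<^esub> g"]) (auto simp: restrict_def fun_eq_iff)
next
  assume a: "a \<in> carrier R" and "c \<in> RS_code S k"
  then obtain f where f: "f \<in> carrier (poly_ring R)" "real (length f) < k + 1" "c = (\<lambda>x\<in>S. eval f x)"
    unfolding RS_code_eq[OF k] by auto
  have "real (length (poly_of_const a \<otimes>\<^bsub>poly_ring R\<^esub> f)) < k + 1"
    using length_mult_le[of "poly_of_const a" f] length_poly_of_const_le[of a] f a by (cases "length f") auto
  then show "(\<lambda>x\<in>S. a \<otimes> c x) \<in> RS_code S k"
    unfolding RS_code_eq[OF k] using f S a
    by (intro image_eqI[of _ _ "poly_of_const a \<otimes>\<^bsub>poly_ring R\<^esub> f"]) (auto simp: restrict_def fun_eq_iff)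
qed

lemma card_low_polys_le:
  assumes fin: "finite (carrier R)"
  shows "finite {f \<in> carrier (poly_ring R). length f \<le> N}"
    and "card {f \<in> carrier (poly_ring R). length f \<le> N} \<le> card (carrier R) ^ N"
proof -
  let ?P = "{f \<in> carrier (poly_ring R). length f \<le> N}" and ?L = "{l. set l \<subseteq> carrier R \<and> length l = N}"
  \<comment> \<open>Coefficient lists carry no leading zeros, so filling up to length
    \<open>N\<close> can be undone by normalizing.\<close>
  let ?pad = "\<lambda>f. replicate (N - length f) \<zero> @ f"
  have inj: "inj_on ?pad ?P"
  proof (rule inj_onI)
    fix f g assume fg: "f \<in> ?P" "g \<in> ?P" "?pad f = ?pad g"
    have "normalize f = normalize g"
      using normalize_replicate_zero[of "N - length f" f] normalize_replicate_zero[of "N - length g" g] fg(3) by simp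
    moreover have "normalize f = f" "normalize g = g"
      using fg(1,2) univ_poly_carrier normalize_polynomial by blast+
    ultimately show "f = g" by simp
  qed
  have sub: "?pad ` ?P \<subseteq> ?L" by (auto dest: subsetD[OF poly_carrier_set])
  have finL: "finite ?L" by (rule finite_lists_length_eq[OF fin])
  show "finite ?P" using inj sub finL by (meson finite_imageD finite_subset)
  show "card ?P \<le> card (carrier R) ^ N"
    using card_inj_on_le[OF inj sub finL] card_lists_length_eq[OF fin] by simp
qed

lemma card_carrier_gt_1:
  assumes "finite (carrier R)" shows "1 < card (carrier R)"
proof -
  have "card {\<zero>, \<one>} \<le> card (carrier R)" by (rule card_mono[OF assms]) auto
  then show ?thesis by simp
qed

lemma RS_rate:
  assumes fin: "finite (carrier R)" and r: "0 < r" and S: "S \<subseteq> carrier R" "S \<noteq> {}"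
  shows "code_rate S (RS_code S (r * real (card S))) \<le> r + 1 / real (card S)"
proof -
  have finS: "finite S" using S(1) fin finite_subset by blast
  then have c0: "0 < card S" using S by (simp add: card_gt_0_iff)
  let ?k = "r * real (card S)"
  have k: "0 < ?k" using r c0 by simp
  \<comment> \<open>The number of admissible coefficients when \<open>r * card S\<close> is not an
    integer; the rounding is the source of the term \<open>1 / card S\<close>.\<close>
  define N where "N = nat \<lceil>?k\<rceil>"
  have N: "real N \<le> ?k + 1" using k unfolding N_def by linarith
  have sub: "{f \<in> carrier (poly_ring R). real (length f) < ?k + 1} \<subseteq> {f \<in> carrier (poly_ring R). length f \<le> N}"
  proof
    fix f assume f: "f \<in> {f \<in> carrier (poly_ring R). real (length f) < ?k + 1}"
    then have "real (length f) < ?k + 1" by simp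
    then have "int (length f) \<le> \<lceil>?k\<rceil>" by linarith
    then show "f \<in> {f \<in> carrier (poly_ring R). length f \<le> N}" using f by (simp add: N_def)
  qed
  have "card (RS_code S ?k) \<le> card {f \<in> carrier (poly_ring R). length f \<le> N}"
    unfolding RS_code_eq[OF k]
    using card_image_le[OF finite_subset[OF sub card_low_polys_le(1)[OF fin]]]
      card_mono[OF card_low_polys_le(1)[OF fin] sub] le_trans by blast
  also have "\<dots> \<le> card (carrier R) ^ N" by (rule card_low_polys_le(2)[OF fin])
  also have "card (RS_code S ?k) = card (carrier R) ^ vectorspace.dim R ((func_space S)\<lparr>carrier := RS_code S ?k\<rparr>)"
    by (rule card_code_dim[OF fin finS RS_closed(1)[OF k S(1)] constant_words_RS(1)[OF k] RS_closed(2)[OF k S(1)] RS_closed(3)[OF k S(1)]])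
  finally have "card (carrier R) ^ vectorspace.dim R ((func_space S)\<lparr>carrier := RS_code S ?k\<rparr>) \<le> card (carrier R) ^ N" .
  then have "vectorspace.dim R ((func_space S)\<lparr>carrier := RS_code S ?k\<rparr>) \<le> N"
    using card_carrier_gt_1[OF fin] power_le_imp_le_exp by blast
  then have "code_rate S (RS_code S ?k) \<le> real N / real (card S)"
    unfolding code_rate_def by (intro divide_right_mono) auto
  also have "\<dots> \<le> (?k + 1) / real (card S)" using N by (intro divide_right_mono) auto
  also have "\<dots> = r + 1 / real (card S)" using c0 by (simp add: field_simps)
  finally show ?thesis .
qed

end

section \<open>Orbits as fibres of \<open>g\<close> and \<open>h\<close>, and equality with the
  Tanner code\<close>

context coset_code_setup_ge2
begin

lemma degree_g: "Polynomials.degree (g_poly p m) = q"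
  using length_g_poly by simp

lemma h_poly_closed [simp]: "h_poly H \<in> carrier (poly_ring R)"
  by (simp add: h_poly_def)

lemma degree_h: "Polynomials.degree (h_poly H) = q - 1"
  using length_X_pow[of "card H"] by (simp add: h_poly_def card_H)

lemma eval_h: "x \<in> carrier R \<Longrightarrow> eval (h_poly H) x = x [^] (q - 1)"
  by (simp add: h_poly_def card_H)

text \<open>\<open>g\<close> is additive with kernel \<open>G\<close>.\<close>

lemma g_fibre:
  assumes "a \<in> H" "v \<in> V"
  shows "{y \<in> \<Omega>. eval (g_poly p m) y = eval (g_poly p m) (\<omega> a v)} = left_orb a v"
proof (intro equalityI subsetI)
  fix y assume y: "y \<in> {y \<in> \<Omega>. eval (g_poly p m) y = eval (g_poly p m) (\<omega> a v)}"
  have yR: "y \<in> carrier R" and wR: "\<omega> a v \<in> carrier R" using y \<Omega>_carrier \<omega>_carrier[OF assms] by auto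
  define g where "g = y \<ominus> \<omega> a v"
  have gR: "g \<in> carrier R" and yg: "y = \<omega> a v \<oplus> g"
    using yR wR by (auto simp: g_def a_minus_def a_lcomm r_neg)
  have "eval (g_poly p m) (\<omega> a v \<oplus> g) = eval (g_poly p m) (\<omega> a v) \<oplus> eval (g_poly p m) g"
    by (rule g_additive[OF wR gR])
  then have "eval (g_poly p m) (\<omega> a v) \<oplus> eval (g_poly p m) g = eval (g_poly p m) (\<omega> a v)"
    using y yg by simp
  then have "eval (g_poly p m) g = \<zero>" using wR gR by (simp add: add.l_cancel_one)
  then have "g \<in> G" using gR by (simp add: G_def g_roots_def)
  then show "y \<in> left_orb a v" using yg \<omega>_add[OF assms gR] by (auto simp: left_orb_def)
next
  fix y assume y: "y \<in> left_orb a v"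
  then obtain g where g: "g \<in> G" "y = \<omega> a v \<oplus> g" using \<omega>_add[OF assms] G_carrier by (auto simp: left_orb_def)
  then have "eval (g_poly p m) y = eval (g_poly p m) (\<omega> a v)"
    using g_additive[OF \<omega>_carrier[OF assms] G_carrier[OF g(1)]] \<omega>_carrier[OF assms]
    by (simp add: G_def g_roots_def)
  then show "y \<in> {y \<in> \<Omega>. eval (g_poly p m) y = eval (g_poly p m) (\<omega> a v)}"
    using y left_orb_subset[OF assms] by auto
qed

text \<open>Points of \<open>\<Omega>\<close> are nonzero, and two of them have equal (q-1)-st
  powers exactly when their quotient is a (q-1)-st root of unity, that is an element of
  \<open>H\<close>.\<close>

lemma h_fibre:
  assumes "a \<in> H" "v \<in> V"
  shows "{y \<in> \<Omega>. eval (h_poly H) y = eval (h_poly H) (\<omega> a v)} = right_orb v"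
proof (intro equalityI subsetI)
  fix y assume y: "y \<in> {y \<in> \<Omega>. eval (h_poly H) y = eval (h_poly H) (\<omega> a v)}"
  then obtain b w where bw: "b \<in> H" "w \<in> V" "y = \<omega> b w" by (auto simp: \<Omega>_eq)
  have yR: "y \<in> carrier R" and wR: "\<omega> a v \<in> carrier R" and wU: "\<omega> a v \<in> Units R"
    using bw \<omega>_carrier \<omega>_nonzero assms by (auto simp: field_Units)
  define c where "c = y \<otimes> inv (\<omega> a v)"
  have cR: "c \<in> carrier R" and yc: "y = c \<otimes> \<omega> a v" using yR wR wU by (auto simp: c_def m_assoc)
  have "c [^] (q - 1) \<otimes> \<omega> a v [^] (q - 1) = \<omega> a v [^] (q - 1)"
    using y yR wR cR yc eval_h nat_pow_distrib[OF cR wR] by auto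
  moreover have "\<omega> a v [^] (q - 1) \<noteq> \<zero>" using \<omega>_nonzero[OF assms] nat_pow_eq_zero wR by blast
  ultimately have "c [^] (q - 1) = \<one>"
    using wR cR m_rcancel[of "\<omega> a v [^] (q - 1)" "c [^] (q - 1)" \<one>] by simp
  then have c: "c \<in> H" by (rule pow_q1_eq_one[OF cR])
  then have "y = \<omega> (c \<otimes> a) v" using yc \<omega>_mult[OF assms c] by simp
  then show "y \<in> right_orb v" using H_mult[OF c assms(1)] by (auto simp: right_orb_def)
next
  fix y assume y: "y \<in> right_orb v"
  then obtain b where b: "b \<in> H" "y = \<omega> b v" by (auto simp: right_orb_def)
  have *: "\<omega> c v [^] (q - 1) = (\<alpha> \<oplus> v) [^] (q - 1)" if "c \<in> H" for c
    using that H_pow[OF that] H_Units[OF that] V_carrier[OF assms(2)] \<alpha>_carrier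
    by (simp add: \<omega>_def nat_pow_distrib)
  have "eval (h_poly H) y = eval (h_poly H) (\<omega> a v)"
    using b assms \<omega>_carrier *[OF b(1)] *[OF assms(1)] by (simp add: eval_h)
  then show "y \<in> {y \<in> \<Omega>. eval (h_poly H) y = eval (h_poly H) (\<omega> a v)}"
    using y right_orb_subset[OF assms(2)] by auto
qed

lemma left_orbits_fibres: "left_orbits G H \<alpha> = (\<lambda>x. {y \<in> \<Omega>. eval (g_poly p m) y = eval (g_poly p m) x}) ` \<Omega>"
proof -
  define F where "F x = {y \<in> \<Omega>. eval (g_poly p m) y = eval (g_poly p m) x}" for x
  have fib: "F (\<omega> a v) = left_orb a v" if "a \<in> H" "v \<in> V" for a v
    unfolding F_def by (rule g_fibre[OF that])
  have "F ` \<Omega> = (\<lambda>z. F (\<omega> (fst z) (snd z))) ` (H \<times> V)"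
    by (simp add: \<Omega>_eq image_image split_def)
  also have "\<dots> = (\<lambda>(a, v). left_orb a v) ` (H \<times> V)"
    by (intro image_cong) (auto simp: fib)
  finally show ?thesis by (simp add: left_orbits_eq F_def)
qed

lemma right_orbits_fibres: "right_orbits G H \<alpha> = (\<lambda>x. {y \<in> \<Omega>. eval (h_poly H) y = eval (h_poly H) x}) ` \<Omega>"
proof -
  define F where "F x = {y \<in> \<Omega>. eval (h_poly H) y = eval (h_poly H) x}" for x
  have fib: "F (\<omega> a v) = right_orb v" if "a \<in> H" "v \<in> V" for a v
    unfolding F_def by (rule h_fibre[OF that])
  have "F ` \<Omega> = (\<lambda>z. F (\<omega> (fst z) (snd z))) ` (H \<times> V)"
    by (simp add: \<Omega>_eq image_image split_def)
  also have "\<dots> = (\<lambda>z. right_orb (snd z)) ` (H \<times> V)"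
    by (intro image_cong) (auto simp: fib)
  also have "\<dots> = right_orb ` V" using one_H by force
  finally show ?thesis by (simp add: right_orbits_eq F_def)
qed

text \<open>Both base-degree conditions become conditions on orbits, which are full fibres of
  \<open>g\<close> and \<open>h\<close>. The degree bound n loses nothing: every word on
  \<open>\<Omega>\<close> is interpolated by a polynomial of degree below n.\<close>

lemma coset_code_eq_tanner:
  assumes r: "0 < r" "r < 1"
  shows "coset_code p m H \<alpha> r (Coset.order A) = tanner_code G H \<alpha> r"
proof -
  have n: "Coset.order A = card \<Omega>" by (simp add: order_A card_\<Omega>)
  have n0: "0 < card \<Omega>" using q_ge(3) by (simp add: card_\<Omega>)
  have kG: "0 < r * real (card G)" "r * real (card G) \<le> real (Polynomials.degree (g_poly p m))"
    unfolding degree_g card_G using r q_ge(3) by (auto simp: mult_left_le_one_le)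
  have kH: "0 < r * real (card H)" "r * real (card H) \<le> real (Polynomials.degree (h_poly H))"
    unfolding degree_h card_H using r q_ge(3) by (auto simp: mult_left_le_one_le)
  have g_card: "card {y \<in> \<Omega>. eval (g_poly p m) y = eval (g_poly p m) x} = Polynomials.degree (g_poly p m)"
    if x: "x \<in> \<Omega>" for x
  proof -
    obtain a v where "a \<in> H" "v \<in> V" "x = \<omega> a v" using x by (auto simp: \<Omega>_eq)
    then show ?thesis unfolding degree_g by (simp add: g_fibre card_left_orb)
  qed
  have h_card: "card {y \<in> \<Omega>. eval (h_poly H) y = eval (h_poly H) x} = Polynomials.degree (h_poly H)"
    if x: "x \<in> \<Omega>" for x
  proof -
    obtain a v where "a \<in> H" "v \<in> V" "x = \<omega> a v" using x by (auto simp: \<Omega>_eq)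
    then show ?thesis unfolding degree_h by (simp add: h_fibre card_right_orb)
  qed
  have W_iff: "f \<in> W_space p m H r (Coset.order A) \<longleftrightarrow> f \<in> carrier (poly_ring R) \<and> length f \<le> card \<Omega> \<and>
      (\<forall>S\<in>left_orbits G H \<alpha>. restrict (\<lambda>x\<in>\<Omega>. eval f x) S \<in> RS_code S (r * real (card G))) \<and>
      (\<forall>S\<in>right_orbits G H \<alpha>. restrict (\<lambda>x\<in>\<Omega>. eval f x) S \<in> RS_code S (r * real (card H)))" for f
  proof (cases "f \<in> carrier (poly_ring R) \<and> length f \<le> card \<Omega>")
    case True
    then have f: "f \<in> carrier (poly_ring R)" "length f \<le> card \<Omega>" by auto
    have "pdeg f < ereal (real (card \<Omega>))" using n0 f by (subst pdeg_less_iff) auto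
    moreover have "base_deg (g_poly p m) f < ereal (r * real (card G)) \<longleftrightarrow>
        (\<forall>S\<in>left_orbits G H \<alpha>. restrict (\<lambda>x\<in>\<Omega>. eval f x) S \<in> RS_code S (r * real (card G)))"
      unfolding left_orbits_fibres ball_simps
      using q_ge(3) by (intro base_deg_less_iff_orbits[OF g_poly_closed _ finite_\<Omega> \<Omega>_carrier g_card f kG])
        (auto simp: degree_g simp del: One_nat_def)
    moreover have "base_deg (h_poly H) f < ereal (r * real (card H)) \<longleftrightarrow>
        (\<forall>S\<in>right_orbits G H \<alpha>. restrict (\<lambda>x\<in>\<Omega>. eval f x) S \<in> RS_code S (r * real (card H)))"
      unfolding right_orbits_fibres ball_simps
      using q_ge(3) by (intro base_deg_less_iff_orbits[OF h_poly_closed _ finite_\<Omega> \<Omega>_carrier h_card f kH])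
        (auto simp: degree_h simp del: One_nat_def)
    ultimately show ?thesis using f by (simp add: W_space_def n G_def)
  next
    case False
    moreover have "pdeg f < ereal (real (card \<Omega>)) \<Longrightarrow> length f \<le> card \<Omega>"
      using n0 by (subst (asm) pdeg_less_iff) auto
    ultimately show ?thesis by (auto simp: W_space_def n)
  qed
  show ?thesis
  proof (intro equalityI subsetI)
    fix c assume "c \<in> coset_code p m H \<alpha> r (Coset.order A)"
    then obtain f where f: "f \<in> W_space p m H r (Coset.order A)" "c = (\<lambda>x\<in>\<Omega>. eval f x)"
      by (auto simp: coset_code_def evaluations_def \<Omega>_def G_def)
    then show "c \<in> tanner_code G H \<alpha> r"
      using W_iff[of f] \<Omega>_carrier by (auto simp: tanner_code_def \<Omega>_def[symmetric])
  next
    fix c assume c: "c \<in> tanner_code G H \<alpha> r"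
    then have cR: "c \<in> \<Omega> \<rightarrow>\<^sub>E carrier R" by (simp add: tanner_code_def \<Omega>_def)
    then obtain f where f: "f \<in> carrier (poly_ring R)" "length f \<le> card \<Omega>" "\<forall>x\<in>\<Omega>. eval f x = c x"
      using interpolation_exists[OF finite_\<Omega> \<Omega>_carrier, of c] by (auto simp: PiE_def Pi_def)
    have cf: "c = (\<lambda>x\<in>\<Omega>. eval f x)"
      using cR f(3) by (auto simp: PiE_def extensional_def restrict_def fun_eq_iff)
    then have "f \<in> W_space p m H r (Coset.order A)"
      using W_iff[of f] f c by (auto simp: tanner_code_def)
    then show "c \<in> coset_code p m H \<alpha> r (Coset.order A)"
      using cf by (auto simp: coset_code_def evaluations_def \<Omega>_def G_def)
  qed
qed

lemma tanner_closed:
  assumes "0 < r"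
  shows "tanner_code G H \<alpha> r \<subseteq> \<Omega> \<rightarrow>\<^sub>E carrier R"
    and "(\<lambda>x\<in>\<Omega>. \<zero>) \<in> tanner_code G H \<alpha> r" "(\<lambda>x\<in>\<Omega>. \<one>) \<in> tanner_code G H \<alpha> r"
    and "c \<in> tanner_code G H \<alpha> r \<Longrightarrow> d \<in> tanner_code G H \<alpha> r \<Longrightarrow> (\<lambda>x\<in>\<Omega>. c x \<oplus> d x) \<in> tanner_code G H \<alpha> r"
    and "a \<in> carrier R \<Longrightarrow> c \<in> tanner_code G H \<alpha> r \<Longrightarrow> (\<lambda>x\<in>\<Omega>. a \<otimes> c x) \<in> tanner_code G H \<alpha> r"
proof -
  have kG: "0 < r * real (card G)" and kH: "0 < r * real (card H)"
    using assms q_ge(3) by (auto simp: card_G card_H)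
  have orb: "S \<subseteq> \<Omega>" if "S \<in> left_orbits G H \<alpha> \<union> right_orbits G H \<alpha>" for S
    using that left_orb_subset right_orb_subset unfolding left_orbits_eq right_orbits_eq by blast
  have res: "restrict (\<lambda>x\<in>\<Omega>. F x) S = (\<lambda>x\<in>S. F x)" if "S \<in> left_orbits G H \<alpha> \<union> right_orbits G H \<alpha>" for F :: "'a \<Rightarrow> 'a" and S
    using orb[OF that] by (auto simp: restrict_def fun_eq_iff)
  have resI: "S \<in> left_orbits G H \<alpha> \<Longrightarrow> \<Omega> \<inter> S = S" "S \<in> right_orbits G H \<alpha> \<Longrightarrow> \<Omega> \<inter> S = S" for S
    using orb[of S] by auto
  have res2: "(\<lambda>x\<in>S. c x \<oplus> d x) = (\<lambda>x\<in>S. restrict c S x \<oplus> restrict d S x)"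
     "(\<lambda>x\<in>S. a \<otimes> c x) = (\<lambda>x\<in>S. a \<otimes> restrict c S x)" for S a and c d :: "'a \<Rightarrow> 'a"
    by (auto simp: restrict_def fun_eq_iff)
  have SR: "S \<subseteq> carrier R" if "S \<in> left_orbits G H \<alpha> \<union> right_orbits G H \<alpha>" for S
    using orb[OF that] \<Omega>_carrier by auto
  show sub: "tanner_code G H \<alpha> r \<subseteq> \<Omega> \<rightarrow>\<^sub>E carrier R" by (auto simp: tanner_code_def \<Omega>_def)
  show "(\<lambda>x\<in>\<Omega>. \<zero>) \<in> tanner_code G H \<alpha> r" "(\<lambda>x\<in>\<Omega>. \<one>) \<in> tanner_code G H \<alpha> r"
    using constant_words_RS[OF kG] constant_words_RS[OF kH]
    by (auto simp: tanner_code_def \<Omega>_def[symmetric] resI)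
  show "(\<lambda>x\<in>\<Omega>. c x \<oplus> d x) \<in> tanner_code G H \<alpha> r" if "c \<in> tanner_code G H \<alpha> r" "d \<in> tanner_code G H \<alpha> r"
  proof -
    have "(\<lambda>x\<in>\<Omega>. c x \<oplus> d x) \<in> \<Omega> \<rightarrow>\<^sub>E carrier R" using that sub by (auto simp: PiE_def Pi_def)
    moreover have "restrict (\<lambda>x\<in>\<Omega>. c x \<oplus> d x) S \<in> RS_code S k"
      if "S \<in> left_orbits G H \<alpha> \<union> right_orbits G H \<alpha>" "0 < k" "restrict c S \<in> RS_code S k" "restrict d S \<in> RS_code S k" for S k
      unfolding res[OF that(1)] by (subst res2(1)) (rule RS_closed(2)[OF that(2) SR[OF that(1)] that(3,4)])
    ultimately show ?thesis using that kG kH by (auto simp: tanner_code_def \<Omega>_def[symmetric])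
  qed
  show "(\<lambda>x\<in>\<Omega>. a \<otimes> c x) \<in> tanner_code G H \<alpha> r" if "a \<in> carrier R" "c \<in> tanner_code G H \<alpha> r"
  proof -
    have "(\<lambda>x\<in>\<Omega>. a \<otimes> c x) \<in> \<Omega> \<rightarrow>\<^sub>E carrier R" using that sub by (auto simp: PiE_def Pi_def)
    moreover have "restrict (\<lambda>x\<in>\<Omega>. a \<otimes> c x) S \<in> RS_code S k"
      if "S \<in> left_orbits G H \<alpha> \<union> right_orbits G H \<alpha>" "0 < k" "restrict c S \<in> RS_code S k" for S k
      unfolding res[OF that(1)] by (subst res2(2)) (rule RS_closed(3)[OF that(2) SR[OF that(1)] \<open>a \<in> carrier R\<close> that(3)])
    ultimately show ?thesis using that kG kH by (auto simp: tanner_code_def \<Omega>_def[symmetric])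
  qed
qed

end

section \<open>Expansion of the coset graph\<close>

lemma cauchy_schwarz_sum:
  fixes f g :: "'b \<Rightarrow> real"
  shows "(\<Sum>i\<in>I. f i * g i)\<^sup>2 \<le> (\<Sum>i\<in>I. (f i)\<^sup>2) * (\<Sum>i\<in>I. (g i)\<^sup>2)"
proof -
  let ?A = "\<Sum>i\<in>I. (f i)\<^sup>2" and ?B = "\<Sum>i\<in>I. (g i)\<^sup>2" and ?C = "\<Sum>i\<in>I. f i * g i"
  \<comment> \<open>The Lagrange identity.\<close>
  have "0 \<le> (\<Sum>i\<in>I. \<Sum>j\<in>I. (f i * g j - f j * g i)\<^sup>2)" by (intro sum_nonneg) auto
  also have "\<dots> = (\<Sum>i\<in>I. \<Sum>j\<in>I. (f i)\<^sup>2 * (g j)\<^sup>2 + (g i)\<^sup>2 * (f j)\<^sup>2 - 2 * ((f i * g i) * (f j * g j)))"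
    by (intro sum.cong refl) (simp add: power2_eq_square algebra_simps)
  also have "\<dots> = ?A * ?B + ?B * ?A - 2 * (?C * ?C)"
    by (simp add: sum.distrib sum_subtractf sum_distrib_left[symmetric] sum_distrib_right[symmetric])
  finally show ?thesis by (simp add: power2_eq_square mult.commute)
qed

context coset_code_setup_ge2
begin

definition avg :: "'a \<Rightarrow> ('a \<Rightarrow> real) \<Rightarrow> 'a \<Rightarrow> real" where
  "avg a x v = (\<Sum>g\<in>G. x (v \<oplus> a \<otimes> g)) / real q"

definition nrm :: "('a \<Rightarrow> real) \<Rightarrow> real" where
  "nrm x = (\<Sum>v\<in>V. (x v)\<^sup>2)"

lemma nrm_nonneg: "0 \<le> nrm x" unfolding nrm_def by (intro sum_nonneg) auto

lemma KG_V: "a \<in> K \<Longrightarrow> g \<in> G \<Longrightarrow> a \<otimes> g \<in> V"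
  using G_subset_V by (intro V_smult) auto

lemma shift_closed: "v \<in> V \<Longrightarrow> a \<in> K \<Longrightarrow> g \<in> G \<Longrightarrow> v \<oplus> a \<otimes> g \<in> V"
  by (intro V_add KG_V)

lemma sum_shift: "t \<in> V \<Longrightarrow> (\<Sum>v\<in>V. F (v \<oplus> t)) = (\<Sum>v\<in>V. F v)"
proof -
  assume t: "t \<in> V"
  have "(\<Sum>v\<in>V. F (v \<oplus> t)) = sum F ((\<lambda>v. v \<oplus> t) ` V)"
    using t V_carrier by (subst sum.reindex) (auto intro!: inj_onI)
  also have "(\<lambda>v. v \<oplus> t) ` V = V"
    using t V_carrier V_add by (intro endo_inj_surj finite_V) (auto intro!: inj_onI)
  finally show ?thesis .
qed

lemma sum_shift_G: "h \<in> G \<Longrightarrow> (\<Sum>g\<in>G. F (g \<oplus> h)) = (\<Sum>g\<in>G. F g)"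
proof -
  assume h: "h \<in> G"
  have "(\<Sum>g\<in>G. F (g \<oplus> h)) = sum F ((\<lambda>g. g \<oplus> h) ` G)"
    using h G_carrier by (subst sum.reindex) (auto intro!: inj_onI)
  also have "(\<lambda>g. g \<oplus> h) ` G = G"
    using h G_carrier G_add by (intro endo_inj_surj finite_G) (auto intro!: inj_onI)
  finally show ?thesis .
qed

lemma sum_neg_G: "(\<Sum>g\<in>G. F (\<ominus> g)) = (\<Sum>g\<in>G. F g)"
proof -
  have inj: "inj_on (\<lambda>g. \<ominus> g) G" using G_carrier by (intro inj_onI) (metis minus_minus)
  have "(\<Sum>g\<in>G. F (\<ominus> g)) = sum F ((\<lambda>g. \<ominus> g) ` G)" by (simp add: sum.reindex[OF inj])
  also have "(\<lambda>g. \<ominus> g) ` G = G" using inj G_neg by (intro endo_inj_surj finite_G) auto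
  finally show ?thesis .
qed

lemma avg_cong: "v \<in> V \<Longrightarrow> a \<in> K \<Longrightarrow> (\<And>w. w \<in> V \<Longrightarrow> x w = y w) \<Longrightarrow> avg a x v = avg a y v"
  unfolding avg_def by (intro arg_cong2[of _ _ _ _ "(/)"] sum.cong refl) (auto intro: shift_closed)

lemma avg_const: "avg a (\<lambda>_. c) v = c"
  using q_ge(3) by (simp add: avg_def card_G)

lemma avg_diff: "avg a (\<lambda>v. x v - y v) v = avg a x v - avg a y v"
  by (simp add: avg_def sum_subtractf diff_divide_distrib)

lemma avg_invariant:
  assumes "v \<in> V" "a \<in> K" "h \<in> G"
  shows "avg a x (v \<oplus> a \<otimes> h) = avg a x v"
proof -
  have "(\<Sum>g\<in>G. x (v \<oplus> a \<otimes> h \<oplus> a \<otimes> g)) = (\<Sum>g\<in>G. x (v \<oplus> a \<otimes> (g \<oplus> h)))"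
    using assms V_carrier G_carrier K_carrier by (intro sum.cong refl) (auto simp: r_distr a_ac subset_iff)
  also have "\<dots> = (\<Sum>g\<in>G. x (v \<oplus> a \<otimes> g))" by (rule sum_shift_G[OF assms(3)])
  finally show ?thesis by (simp add: avg_def)
qed

lemma avg_idem: "v \<in> V \<Longrightarrow> a \<in> K \<Longrightarrow> avg a (avg a x) v = avg a x v"
  using q_ge(3) by (subst avg_def) (simp add: avg_invariant card_G)

lemma avg_commute:
  assumes "v \<in> V" "a \<in> K" "b \<in> K"
  shows "avg a (avg b x) v = avg b (avg a x) v"
proof -
  have "(\<Sum>g\<in>G. \<Sum>h\<in>G. x (v \<oplus> a \<otimes> g \<oplus> b \<otimes> h)) = (\<Sum>h\<in>G. \<Sum>g\<in>G. x (v \<oplus> b \<otimes> h \<oplus> a \<otimes> g))"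
    using assms V_carrier G_carrier K_carrier
    by (subst sum.swap) (intro sum.cong refl arg_cong[of _ _ x], auto simp: a_ac subset_iff)
  then show ?thesis by (simp add: avg_def sum_divide_distrib[symmetric])
qed

lemma sum_avg: "a \<in> K \<Longrightarrow> (\<Sum>v\<in>V. avg a x v) = (\<Sum>v\<in>V. x v)"
proof -
  assume a: "a \<in> K"
  have "(\<Sum>v\<in>V. \<Sum>g\<in>G. x (v \<oplus> a \<otimes> g)) = (\<Sum>g\<in>G. \<Sum>v\<in>V. x (v \<oplus> a \<otimes> g))" by (rule sum.swap)
  also have "\<dots> = (\<Sum>g\<in>G. \<Sum>v\<in>V. x v)"
    using KG_V[OF a] by (intro sum.cong refl sum_shift) auto
  finally show ?thesis using q_ge(3) by (simp add: avg_def sum_divide_distrib[symmetric] card_G)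
qed

text \<open>Translation by \<open>a g\<close> is adjoint to translation by \<open>- a g\<close>, and
  \<open>G\<close> is closed under negation.\<close>

lemma avg_symmetric:
  assumes a: "a \<in> K"
  shows "(\<Sum>v\<in>V. avg a x v * y v) = (\<Sum>v\<in>V. x v * avg a y v)"
proof -
  have "(\<Sum>v\<in>V. (\<Sum>g\<in>G. x (v \<oplus> a \<otimes> g)) * y v) = (\<Sum>g\<in>G. \<Sum>v\<in>V. x (v \<oplus> a \<otimes> g) * y v)"
    unfolding sum_distrib_right by (rule sum.swap)
  also have "\<dots> = (\<Sum>g\<in>G. \<Sum>v\<in>V. x v * y (v \<oplus> a \<otimes> (\<ominus> g)))"
  proof (rule sum.cong[OF refl])
    fix g assume g: "g \<in> G"
    have R: "a \<in> carrier R" "g \<in> carrier R" using a g K_carrier G_carrier by auto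
    have "v \<oplus> a \<otimes> g \<oplus> a \<otimes> (\<ominus> g) = v" if "v \<in> V" for v
      using R V_carrier[OF that] by (simp add: a_assoc r_minus r_neg)
    then have "(\<Sum>v\<in>V. x (v \<oplus> a \<otimes> g) * y v)
        = (\<Sum>v\<in>V. (\<lambda>w. x w * y (w \<oplus> a \<otimes> (\<ominus> g))) (v \<oplus> a \<otimes> g))" by (intro sum.cong refl) simp
    also have "\<dots> = (\<Sum>v\<in>V. x v * y (v \<oplus> a \<otimes> (\<ominus> g)))" by (rule sum_shift[OF KG_V[OF a g]])
    finally show "(\<Sum>v\<in>V. x (v \<oplus> a \<otimes> g) * y v) = (\<Sum>v\<in>V. x v * y (v \<oplus> a \<otimes> (\<ominus> g)))" .
  qed
  also have "\<dots> = (\<Sum>g\<in>G. \<Sum>v\<in>V. x v * y (v \<oplus> a \<otimes> g))"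
    by (rule sum_neg_G[of "\<lambda>g. \<Sum>v\<in>V. x v * y (v \<oplus> a \<otimes> g)"])
  also have "\<dots> = (\<Sum>v\<in>V. x v * (\<Sum>g\<in>G. y (v \<oplus> a \<otimes> g)))"
    unfolding sum_distrib_left by (rule sum.swap)
  finally show ?thesis by (simp add: avg_def sum_divide_distrib[symmetric])
qed

lemma nrm_add_orthogonal:
  assumes "\<And>v. v \<in> V \<Longrightarrow> x v = y v + z v" "(\<Sum>v\<in>V. y v * z v) = 0"
  shows "nrm x = nrm y + nrm z"
proof -
  have "nrm x = (\<Sum>v\<in>V. (y v)\<^sup>2 + (z v)\<^sup>2 + 2 * (y v * z v))"
    unfolding nrm_def using assms(1) by (intro sum.cong refl) (simp add: power2_eq_square algebra_simps)
  also have "\<dots> = nrm y + nrm z + 2 * (\<Sum>v\<in>V. y v * z v)"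
    by (simp add: nrm_def sum.distrib sum_distrib_left)
  finally show ?thesis using assms(2) by simp
qed

text \<open>By Lagrange the order is a power of p properly below \<open>p^m\<close>.\<close>

lemma card_proper_subgroup_K:
  assumes D: "subgroup D (add_monoid R)" "D \<subseteq> K" "D \<noteq> K"
  shows "card D \<le> p ^ (m - 1)"
proof -
  have sgK: "subgroup K (add_monoid R)"
    using K_carrier K_closed by (intro add.subgroupI) auto
  interpret KG: group "(add_monoid R)\<lparr>carrier := K\<rparr>" by (rule add.subgroup_imp_group[OF sgK])
  have "subgroup D ((add_monoid R)\<lparr>carrier := K\<rparr>)"
    by (rule add.subgroup_incl[OF D(1) sgK D(2)])
  then have "card D dvd Coset.order ((add_monoid R)\<lparr>carrier := K\<rparr>)"
    using KG.lagrange by (metis dvd_triv_right)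
  then have "card D dvd p ^ m" by (simp add: Coset.order_def K_card)
  then obtain j where j: "j \<le> m" "card D = p ^ j" using divides_primepow_nat[OF p_prime] by auto
  have "card D < card K" using D finite_K by (intro psubset_card_mono) auto
  then have "p ^ j < p ^ m" using j K_card by simp
  then have "j < m" using p_ge_2 by (simp add: power_less_imp_less_exp)
  then show ?thesis unfolding j(2) using p_ge_2 by (intro power_increasing) auto
qed

text \<open>The set \<open>D\<close> of scalars \<open>a\<close> for which \<open>x\<close> is
  invariant under translation by \<open>a G\<close> is an additive subgroup: a shift by
  \<open>(a + b) g\<close> is a shift by \<open>a g\<close> followed by one by \<open>b g\<close>.
  If \<open>D\<close> were all of \<open>K\<close>, then \<open>x\<close> would be constant on
  \<open>V\<close>, hence zero by the mean condition. So at most \<open>p^(m-1) - 1\<close> nonzero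
  scalars contribute \<open>nrm x\<close>, and the others contribute nothing.\<close>

lemma all_projections_trivial:
  assumes triv: "\<And>a. a \<in> H \<Longrightarrow> (\<forall>v\<in>V. avg a x v = x v) \<or> (\<forall>v\<in>V. avg a x v = 0)"
    and mean: "(\<Sum>v\<in>V. x v) = 0"
  shows "(\<Sum>a\<in>H. nrm (avg a x)) \<le> real (q - 1) / real p * nrm x"
proof (cases "nrm x = 0")
  case True
  have x0: "x v = 0" if "v \<in> V" for v
    using True that finite_V by (simp add: nrm_def sum_nonneg_eq_0_iff)
  have "nrm (avg a x) = 0" if "a \<in> H" for a
  proof -
    have "avg a x v = 0" if "v \<in> V" for v
      using avg_cong[of v a x "\<lambda>_. 0"] that \<open>a \<in> H\<close> x0 H_Units avg_const by simp
    then show ?thesis by (simp add: nrm_def)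
  qed
  then show ?thesis using True by simp
next
  case False
  define D where "D = {a \<in> K. \<forall>v\<in>V. \<forall>g\<in>G. x (v \<oplus> a \<otimes> g) = x v}"
  have D_iff: "a \<in> D \<longleftrightarrow> (\<forall>v\<in>V. avg a x v = x v)" if a: "a \<in> K" for a
  proof
    assume "a \<in> D"
    then show "\<forall>v\<in>V. avg a x v = x v" using q_ge(3) by (simp add: D_def avg_def card_G)
  next
    assume inv: "\<forall>v\<in>V. avg a x v = x v"
    then have "x (v \<oplus> a \<otimes> g) = x v" if "v \<in> V" "g \<in> G" for v g
      using avg_invariant[OF that(1) a that(2), of x] shift_closed[OF that(1) a that(2)] that by simp
    then show "a \<in> D" using a by (simp add: D_def)
  qed
  have R: "a \<in> carrier R" "g \<in> carrier R" "v \<in> carrier R" if "a \<in> K" "g \<in> G" "v \<in> V" for a g v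
    using that K_carrier G_carrier V_carrier by auto
  have zeroD: "\<zero> \<in> D" using R K_closed by (auto simp: D_def)
  have "subgroup D (add_monoid R)"
  proof (rule add.subgroupI)
    show "D \<subseteq> carrier R" using K_carrier by (auto simp: D_def)
    show "D \<noteq> {}" using zeroD by auto
  next
    fix a assume a: "a \<in> D"
    have "x (v \<oplus> (\<ominus> a) \<otimes> g) = x v" if "v \<in> V" "g \<in> G" for v g
    proof -
      have "(\<ominus> a) \<otimes> g = a \<otimes> (\<ominus> g)" using a R[of a g v] that by (simp add: D_def l_minus r_minus)
      then show ?thesis using a that G_neg by (simp add: D_def)
    qed
    then show "\<ominus> a \<in> D" using a K_closed by (simp add: D_def)
  next
    fix a b assume ab: "a \<in> D" "b \<in> D"
    have "x (v \<oplus> (a \<oplus> b) \<otimes> g) = x v" if "v \<in> V" "g \<in> G" for v g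
    proof -
      have K: "a \<in> K" "b \<in> K" using ab by (auto simp: D_def)
      have "v \<oplus> (a \<oplus> b) \<otimes> g = v \<oplus> a \<otimes> g \<oplus> b \<otimes> g"
        using R[OF K(1) that(2,1)] R[OF K(2) that(2,1)] by (simp add: l_distr a_assoc)
      then show ?thesis using ab that shift_closed[OF that(1) K(1) that(2)] by (simp add: D_def)
    qed
    then show "a \<oplus> b \<in> D" using ab K_closed by (simp add: D_def)
  qed
  moreover have "D \<noteq> K"
  proof
    assume DK: "D = K"
    have const: "x w = x \<zero>" if "w \<in> V" for w
      using that
    proof (induction rule: V_induct)
      case (step k g w)
      then have "k \<otimes> g \<oplus> w = w \<oplus> k \<otimes> g" using R[of k g w] by (simp add: a_comm)
      moreover have "k \<in> D" using step DK by simp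
      then have "x (w \<oplus> k \<otimes> g) = x w" using step by (simp add: D_def)
      ultimately show ?case using step by simp
    qed simp
    then have "(\<Sum>v\<in>V. x v) = real (card V) * x \<zero>" by simp
    then have "x \<zero> = 0" using mean card_V q_ge(3) by simp
    then have "nrm x = 0" using const by (simp add: nrm_def)
    then show False using False by simp
  qed
  ultimately have cardD: "card D \<le> p ^ (m - 1)"
    by (intro card_proper_subgroup_K) (auto simp: D_def)
  have DH: "nrm (avg a x) = (if a \<in> D then nrm x else 0)" if "a \<in> H" for a
  proof (cases "a \<in> D")
    case True
    then show ?thesis using D_iff[of a] that H_Units by (simp add: nrm_def)
  next
    case False
    then have "\<forall>v\<in>V. avg a x v = 0" using triv[OF that] D_iff[of a] that H_Units by auto
    then show ?thesis using False by (simp add: nrm_def)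
  qed
  have "(\<Sum>a\<in>H. nrm (avg a x)) = (\<Sum>a\<in>H. if a \<in> D then nrm x else 0)"
    by (intro sum.cong refl DH)
  also have "\<dots> = real (card (H \<inter> D)) * nrm x"
    using finite_H by (simp add: sum.If_cases)
  also have "H \<inter> D = D - {\<zero>}" by (auto simp: H_def D_def)
  also have "real (card (D - {\<zero>})) * nrm x \<le> real (q - 1) / real p * nrm x"
  proof (intro mult_right_mono nrm_nonneg)
    have finD: "finite D" using finite_K by (simp add: D_def)
    have "Suc (m - 1) = m" using m_ge_2 by simp
    then have "p * p ^ (m - 1) = q" unfolding q_def by (metis power_Suc)
    moreover have "card (D - {\<zero>}) = card D - 1" using zeroD finD by simp
    moreover have "0 < card D" using zeroD finD card_gt_0_iff by blast
    \<comment> \<open>The removal of zero matters: \<open>(p^(m-1) - 1) p = q - p\<close>, which is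
      below \<open>q - 1\<close>.\<close>
    ultimately have "card (D - {\<zero>}) * p \<le> q - p"
      using cardD mult_le_mono2[OF cardD, of p] by (simp add: diff_mult_distrib2 mult.commute diff_le_mono)
    also have "\<dots> \<le> q - 1" using p_ge_2 by simp
    finally have "real (card (D - {\<zero>})) * real p \<le> real (q - 1)" by (metis of_nat_le_iff of_nat_mult)
    then show "real (card (D - {\<zero>})) \<le> real (q - 1) / real p"
      using p_ge_2 by (simp add: pos_le_divide_eq)
  qed
  finally show ?thesis .
qed

text \<open>The averages \<open>avg a\<close> are commuting orthogonal projections, so \<open>x\<close> splits orthogonally into
  joint eigenvectors; the induction is over the projections that do not yet act as \<open>0\<close> or \<open>1\<close>.\<close>

lemma sum_nrm_avg_le_aux:
  assumes "finite U"
  shows "U \<subseteq> H \<Longrightarrow> (\<And>a. a \<in> H - U \<Longrightarrow> (\<forall>v\<in>V. avg a x v = x v) \<or> (\<forall>v\<in>V. avg a x v = 0)) \<Longrightarrow>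
    (\<Sum>v\<in>V. x v) = 0 \<Longrightarrow> (\<Sum>a\<in>H. nrm (avg a x)) \<le> real (q - 1) / real p * nrm x"
  using assms
proof (induction U arbitrary: x rule: finite_induct)
  case empty
  then show ?case by (intro all_projections_trivial) auto
next
  case (insert a U)
  have a: "a \<in> K" "a \<in> H" using insert.prems H_Units by auto
  \<comment> \<open>The components of \<open>x\<close> in the range and in the kernel of
    \<open>avg a\<close>. On both of them \<open>avg a\<close> is trivial, so \<open>a\<close> can
    leave the exceptional set.\<close>
  define y where "y = avg a x"
  define z where "z v = x v - y v" for v
  have az: "avg a z v = 0" if "v \<in> V" for v
    using avg_idem[OF that a(1), of x] by (simp add: z_def[abs_def] avg_diff y_def)
  have lin: "avg b x v = avg b y v + avg b z v" for b v
    by (simp add: z_def[abs_def] avg_diff)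
  have by_eq: "avg b y v = avg a (avg b x) v" if "b \<in> K" "v \<in> V" for b v
    unfolding y_def by (rule avg_commute[OF that(2,1) a(1)])
  \<comment> \<open>The projections commute, so \<open>avg b y\<close> stays in the range of
    \<open>avg a\<close>, while \<open>z\<close> lies in the kernel; self-adjointness makes these
    orthogonal.\<close>
  have orth: "(\<Sum>v\<in>V. avg b y v * avg b z v) = 0" if b: "b \<in> K" for b
  proof -
    have "(\<Sum>v\<in>V. avg b y v * avg b z v) = (\<Sum>v\<in>V. avg b (avg b y) v * z v)"
      by (rule avg_symmetric[OF b, symmetric])
    also have "\<dots> = (\<Sum>v\<in>V. avg a (avg b x) v * z v)"
      using b by (intro sum.cong refl) (simp add: avg_idem by_eq)
    also have "\<dots> = (\<Sum>v\<in>V. avg b x v * avg a z v)" by (rule avg_symmetric[OF a(1)])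
    also have "\<dots> = 0" using az by simp
    finally show ?thesis .
  qed
  have orth0: "(\<Sum>v\<in>V. y v * z v) = 0"
    unfolding y_def using avg_symmetric[OF a(1), of x z] az by simp
  \<comment> \<open>Projections that already act on \<open>x\<close> as zero or one act in the same
    way on both components; the induction hypothesis thus applies with the smaller set.\<close>
  have eq: "(\<forall>v\<in>V. avg b y v = y v \<and> avg b z v = z v) \<or> (\<forall>v\<in>V. avg b y v = 0 \<and> avg b z v = 0)"
    if b: "b \<in> H - insert a U" for b
  proof -
    have bK: "b \<in> K" using b H_Units by auto
    consider "\<forall>v\<in>V. avg b x v = x v" | "\<forall>v\<in>V. avg b x v = 0" using insert.prems(2)[OF b] by auto
    then show ?thesis
    proof cases
      case 1
      have "avg b y v = y v" if "v \<in> V" for v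
        using by_eq[OF bK that] avg_cong[OF that a(1), of "avg b x" x] 1 by (simp add: y_def)
      moreover have "avg b z v = z v" if "v \<in> V" for v
        using 1 lin[of b v] calculation[OF that] that by (simp add: z_def)
      ultimately show ?thesis by blast
    next
      case 2
      have "avg b y v = 0" if "v \<in> V" for v
        using by_eq[OF bK that] avg_cong[OF that a(1), of "avg b x" "\<lambda>_. 0"] 2 by (simp add: avg_const)
      then show ?thesis using 2 lin[of b] by simp
    qed
  qed
  have UH: "U \<subseteq> H" using insert.prems by simp
  have y: "(\<Sum>b\<in>H. nrm (avg b y)) \<le> real (q - 1) / real p * nrm y"
  proof (rule insert.IH[OF UH])
    fix b assume b: "b \<in> H - U"
    show "(\<forall>v\<in>V. avg b y v = y v) \<or> (\<forall>v\<in>V. avg b y v = 0)"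
      using eq[of b] b avg_idem[OF _ a(1), of _ x] by (cases "b = a") (auto simp: y_def)
  next
    show "(\<Sum>v\<in>V. y v) = 0" unfolding y_def using sum_avg[OF a(1)] insert.prems by simp
  qed
  have z: "(\<Sum>b\<in>H. nrm (avg b z)) \<le> real (q - 1) / real p * nrm z"
  proof (rule insert.IH[OF UH])
    fix b assume b: "b \<in> H - U"
    show "(\<forall>v\<in>V. avg b z v = z v) \<or> (\<forall>v\<in>V. avg b z v = 0)"
      using eq[of b] b az by (cases "b = a") auto
  next
    show "(\<Sum>v\<in>V. z v) = 0" using sum_avg[OF a(1), of x] insert.prems by (simp add: z_def y_def sum_subtractf)
  qed
  have "nrm (avg b x) = nrm (avg b y) + nrm (avg b z)" if "b \<in> H" for b
    using orth[of b] H_Units[OF that] lin by (intro nrm_add_orthogonal) auto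
  then have "(\<Sum>b\<in>H. nrm (avg b x)) = (\<Sum>b\<in>H. nrm (avg b y)) + (\<Sum>b\<in>H. nrm (avg b z))"
    by (simp add: sum.distrib)
  moreover have "nrm x = nrm y + nrm z" using orth0 by (intro nrm_add_orthogonal) (auto simp: z_def)
  ultimately show ?case using y z by (simp add: distrib_left)
qed

lemma sum_nrm_avg_le:
  assumes "(\<Sum>v\<in>V. x v) = 0"
  shows "(\<Sum>a\<in>H. nrm (avg a x)) \<le> real (q - 1) / real p * nrm x"
  using assms by (intro sum_nrm_avg_le_aux[OF finite_H]) auto

text \<open>The graph involves \<open>avg (inv a)\<close>, because a left orbit moves
  \<open>v\<close> along \<open>inv a G\<close>; after summation over \<open>H\<close> the inversion
  disappears.\<close>

lemma sum_inv_H: "(\<Sum>a\<in>H. F (inv a)) = (\<Sum>a\<in>H. F a)"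
proof -
  have inj: "inj_on (\<lambda>a. inv a) H"
    using H_Units by (intro inj_onI) (metis Units_inv_inv)
  have "(\<Sum>a\<in>H. F (inv a)) = sum F ((\<lambda>a. inv a) ` H)" by (simp add: sum.reindex[OF inj])
  also have "(\<lambda>a. inv a) ` H = H" using inj H_inv(1) by (intro endo_inj_surj finite_H) auto
  finally show ?thesis .
qed

text \<open>Let s be the fraction of points that lie on left orbits meeting \<open>Z\<close>, and t
  the fraction of right orbits meeting \<open>Z\<close>. A point of \<open>Z\<close> lies on two
  touched orbits; counting such points, with the indicator of the touched right orbits split into
  its mean and a mean-zero part, gives at most n(st + sqrt(st/p)). The local hypotheses give at
  least \<open>\<kappa>\<close> s n and at least \<open>\<kappa>\<close> t n points, hence at least
  \<open>\<kappa>\<close> sqrt(st) n. Comparison yields sqrt(st) >= \<open>\<kappa>\<close> -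
  1/sqrt(p), and the lower bound finishes the argument.\<close>

lemma distance_bound:
  assumes Z: "Z \<subseteq> \<Omega>" "Z \<noteq> {}" and \<kappa>: "0 < \<kappa>"
    and left: "\<And>a v. a \<in> H \<Longrightarrow> v \<in> V \<Longrightarrow> left_orb a v \<inter> Z \<noteq> {} \<Longrightarrow> \<kappa> * real q \<le> real (card (left_orb a v \<inter> Z))"
    and right: "\<And>v. v \<in> V \<Longrightarrow> right_orb v \<inter> Z \<noteq> {} \<Longrightarrow> \<kappa> * real (q - 1) \<le> real (card (right_orb v \<inter> Z))"
  shows "\<kappa> * (\<kappa> - 1 / sqrt (real p)) * real (card \<Omega>) \<le> real (card Z)"
proof -
  let ?I = "H \<times> V"
  define ind where "ind a v = (if \<omega> a v \<in> Z then 1 else 0 :: real)" for a v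
  define y where "y a v = (if left_orb a v \<inter> Z \<noteq> {} then 1 else 0 :: real)" for a v
  define T where "T = {v \<in> V. right_orb v \<inter> Z \<noteq> {}}"
  define F where "F v = (if v \<in> T then 1 else 0 :: real)" for v
  define w where "w = real (card Z)"
  define N where "N = real (card V)"
  define Y where "Y = (\<Sum>a\<in>H. \<Sum>v\<in>V. y a v)"
  have N0: "0 < N" using card_V q_ge(3) by (simp add: N_def)
  have q1: "0 < real (q - 1)" and q0: "0 < real q" and p0: "0 < real p" using q_ge(3) p_ge_2 by auto
  have finZ: "finite Z" using Z(1) finite_\<Omega> finite_subset by blast
  have w_sum: "w = (\<Sum>a\<in>H. \<Sum>v\<in>V. ind a v)"
  proof -
    have "Z = (\<lambda>(a, v). \<omega> a v) ` {z \<in> ?I. \<omega> (fst z) (snd z) \<in> Z}"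
    proof (intro equalityI subsetI)
      fix x assume x: "x \<in> Z"
      then obtain a v where "a \<in> H" "v \<in> V" "x = \<omega> a v" using Z(1) by (auto simp: \<Omega>_eq)
      then show "x \<in> (\<lambda>(a, v). \<omega> a v) ` {z \<in> ?I. \<omega> (fst z) (snd z) \<in> Z}"
        using x by (intro image_eqI[of _ _ "(a, v)"]) auto
    qed auto
    moreover have "inj_on (\<lambda>(a, v). \<omega> a v) {z \<in> ?I. \<omega> (fst z) (snd z) \<in> Z}"
      by (rule inj_on_subset[OF \<omega>_inj_on]) auto
    ultimately have "card Z = card {z \<in> ?I. \<omega> (fst z) (snd z) \<in> Z}"
      by (metis (no_types, lifting) card_image)
    also have "real \<dots> = (\<Sum>z\<in>{z \<in> ?I. \<omega> (fst z) (snd z) \<in> Z}. 1)" by simp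
    also have "\<dots> = (\<Sum>z\<in>?I. ind (fst z) (snd z))"
      unfolding ind_def using finite_H finite_V by (intro sum.inter_filter) auto
    finally show ?thesis by (simp add: w_def sum.cartesian_product split_def)
  qed
  have T_V: "T \<subseteq> V" "finite T" using finite_V by (auto simp: T_def)
  have w_right: "\<kappa> * real (q - 1) * real (card T) \<le> w"
  proof -
    have "\<kappa> * real (q - 1) * real (card T) = (\<Sum>v\<in>T. \<kappa> * real (q - 1))" by simp
    also have "\<dots> \<le> (\<Sum>v\<in>T. \<Sum>a\<in>H. ind a v)"
    proof (rule sum_mono)
      fix v assume v: "v \<in> T"
      then have vV: "v \<in> V" by (simp add: T_def)
      have "right_orb v \<inter> Z = (\<lambda>a. \<omega> a v) ` {a \<in> H. \<omega> a v \<in> Z}" by (auto simp: right_orb_def)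
      moreover have "inj_on (\<lambda>a. \<omega> a v) {a \<in> H. \<omega> a v \<in> Z}" using \<omega>_inj vV by (auto intro!: inj_onI)
      ultimately have "card (right_orb v \<inter> Z) = card {a \<in> H. \<omega> a v \<in> Z}" by (simp add: card_image)
      also have "real \<dots> = (\<Sum>a\<in>H. ind a v)"
        using finite_H by (simp add: ind_def sum.If_cases Int_def conj_commute)
      finally show "\<kappa> * real (q - 1) \<le> (\<Sum>a\<in>H. ind a v)" using right[OF vV] v by (simp add: T_def)
    qed
    also have "\<dots> \<le> (\<Sum>v\<in>V. \<Sum>a\<in>H. ind a v)"
      using T_V finite_V by (intro sum_mono2) (auto simp: ind_def intro!: sum_nonneg)
    also have "\<dots> = w" unfolding w_sum by (rule sum.swap)
    finally show ?thesis .
  qed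
  have left_card: "real (card (left_orb a v \<inter> Z)) = (\<Sum>g\<in>G. ind a (v \<oplus> inv a \<otimes> g))"
    if "a \<in> H" "v \<in> V" for a v
  proof -
    have "left_orb a v \<inter> Z = (\<lambda>g. \<omega> a (v \<oplus> inv a \<otimes> g)) ` {g \<in> G. \<omega> a (v \<oplus> inv a \<otimes> g) \<in> Z}"
      by (auto simp: left_orb_def)
    moreover have "inj_on (\<lambda>g. \<omega> a (v \<oplus> inv a \<otimes> g)) {g \<in> G. \<omega> a (v \<oplus> inv a \<otimes> g) \<in> Z}"
      by (rule inj_on_subset[OF left_orb_inj[OF that]]) auto
    ultimately have "card (left_orb a v \<inter> Z) = card {g \<in> G. \<omega> a (v \<oplus> inv a \<otimes> g) \<in> Z}"
      by (simp add: card_image)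
    then show ?thesis using finite_G by (simp add: ind_def sum.If_cases Int_def conj_commute)
  qed
  have w_left: "\<kappa> * Y \<le> w"
  proof -
    have "real q * w = (\<Sum>a\<in>H. \<Sum>v\<in>V. \<Sum>g\<in>G. ind a (v \<oplus> inv a \<otimes> g))"
    proof -
      have "(\<Sum>v\<in>V. \<Sum>g\<in>G. ind a (v \<oplus> inv a \<otimes> g)) = real q * (\<Sum>v\<in>V. ind a v)" if "a \<in> H" for a
      proof -
        have "(\<Sum>v\<in>V. avg (inv a) (ind a) v) = (\<Sum>v\<in>V. ind a v)"
          using H_inv(1)[OF that] H_Units by (intro sum_avg) auto
        then show ?thesis using q0 by (simp add: avg_def sum_divide_distrib[symmetric] field_simps)
      qed
      then show ?thesis unfolding w_sum by (simp add: sum_distrib_left)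
    qed
    also have "\<dots> \<ge> (\<Sum>a\<in>H. \<Sum>v\<in>V. \<kappa> * real q * y a v)"
    proof (intro sum_mono)
      fix a v assume av: "a \<in> H" "v \<in> V"
      show "\<kappa> * real q * y a v \<le> (\<Sum>g\<in>G. ind a (v \<oplus> inv a \<otimes> g))"
        using left[OF av] left_card[OF av] by (auto simp: y_def ind_def intro!: sum_nonneg)
    qed
    finally have "\<kappa> * real q * Y \<le> real q * w" by (simp add: Y_def sum_distrib_left)
    then have "real q * (\<kappa> * Y) \<le> real q * w" by (simp add: mult_ac)
    then show ?thesis using q0 by simp
  qed
  have y_inv: "y a (v \<oplus> inv a \<otimes> g) = y a v" if "a \<in> H" "v \<in> V" "g \<in> G" for a v g
  proof -
    have "left_orb a (v \<oplus> inv a \<otimes> g) = left_orb a v"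
    proof -
      have "\<omega> a (v \<oplus> inv a \<otimes> g) \<in> left_orb a v" using that by (auto simp: left_orb_def)
      then have "eval (g_poly p m) (\<omega> a (v \<oplus> inv a \<otimes> g)) = eval (g_poly p m) (\<omega> a v)"
        unfolding g_fibre[OF that(1,2), symmetric] by simp
      then show ?thesis
        using g_fibre[OF that(1,2)] g_fibre[OF that(1) shift_V[OF that]] by simp
    qed
    then show ?thesis by (simp add: y_def)
  qed
  \<comment> \<open>\<open>y a\<close> is constant on left orbits, so any function paired with it
    may be replaced by its orbit average; this is how the projections enter.\<close>
  have y_avg: "(\<Sum>v\<in>V. y a v * B v) = (\<Sum>v\<in>V. y a v * avg (inv a) B v)" if a: "a \<in> H" for a B
  proof -
    have ia: "inv a \<in> K" using H_inv(1)[OF a] H_Units by auto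
    have "avg (inv a) (y a) v = y a v" if "v \<in> V" for v
      using y_inv[OF a that] q0 by (simp add: avg_def card_G)
    then have "(\<Sum>v\<in>V. y a v * B v) = (\<Sum>v\<in>V. avg (inv a) (y a) v * B v)" by simp
    also have "\<dots> = (\<Sum>v\<in>V. y a v * avg (inv a) B v)" by (rule avg_symmetric[OF ia])
    finally show ?thesis .
  qed
  define t where "t = real (card T) / N"
  define F' where "F' v = F v - t" for v
  have sumF: "(\<Sum>v\<in>V. F v) = real (card T)"
    using T_V finite_V by (simp add: F_def sum.If_cases Int_absorb1)
  have F'0: "(\<Sum>v\<in>V. F' v) = 0"
    using N0 by (simp add: F'_def sum_subtractf sumF t_def N_def)
  \<comment> \<open>The exact value is the variance \<open>card T * (1 - t)\<close>.\<close>
  have nrmF': "nrm F' \<le> real (card T)"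
  proof -
    have "nrm F' = (\<Sum>v\<in>V. F v + t * t - 2 * t * F v)"
      unfolding nrm_def F'_def by (intro sum.cong refl) (auto simp: F_def power2_eq_square algebra_simps)
    also have "\<dots> = real (card T) + N * t * t - 2 * t * real (card T)"
      by (simp add: sum_subtractf sum.distrib sumF N_def sum_distrib_left[symmetric])
    also have "N * t * t = t * real (card T)" using N0 by (simp add: t_def)
    finally have "nrm F' = real (card T) - t * real (card T)" by simp
    then show ?thesis using N0 by (simp add: t_def)
  qed
  have w_le: "w \<le> t * Y + sqrt (Y * (real (q - 1) / real p * real (card T)))"
  proof -
    have "w \<le> (\<Sum>a\<in>H. \<Sum>v\<in>V. y a v * F v)"
      unfolding w_sum
    proof (intro sum_mono)
      fix a v assume av: "a \<in> H" "v \<in> V"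
      have "\<omega> a v \<in> right_orb v" using av by (auto simp: right_orb_def)
      moreover have "\<omega> a v \<in> left_orb a v"
        using av G_zero V_carrier H_inv(1)[of a] H_Units by (auto simp: left_orb_def intro!: image_eqI[of _ _ \<zero>])
      ultimately show "ind a v \<le> y a v * F v" using av by (auto simp: ind_def y_def F_def T_def)
    qed
    also have "\<dots> = (\<Sum>a\<in>H. \<Sum>v\<in>V. t * y a v + y a v * avg (inv a) F' v)"
    proof (rule sum.cong[OF refl])
      fix a assume a: "a \<in> H"
      have "(\<Sum>v\<in>V. y a v * F v) = (\<Sum>v\<in>V. t * y a v + y a v * F' v)"
        by (intro sum.cong refl) (simp add: F'_def algebra_simps)
      then show "(\<Sum>v\<in>V. y a v * F v) = (\<Sum>v\<in>V. t * y a v + y a v * avg (inv a) F' v)"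
        using y_avg[OF a, of F'] by (simp add: sum.distrib)
    qed
    also have "\<dots> = t * Y + (\<Sum>z\<in>?I. y (fst z) (snd z) * avg (inv (fst z)) F' (snd z))"
      by (simp add: sum.distrib Y_def sum_distrib_left sum.cartesian_product split_def)
    also have "(\<Sum>z\<in>?I. y (fst z) (snd z) * avg (inv (fst z)) F' (snd z)) \<le> sqrt (Y * (real (q - 1) / real p * real (card T)))"
    proof (rule real_le_rsqrt)
      have "(\<Sum>z\<in>?I. y (fst z) (snd z) * avg (inv (fst z)) F' (snd z))\<^sup>2
          \<le> (\<Sum>z\<in>?I. (y (fst z) (snd z))\<^sup>2) * (\<Sum>z\<in>?I. (avg (inv (fst z)) F' (snd z))\<^sup>2)"
        by (rule cauchy_schwarz_sum)
      also have "(\<Sum>z\<in>?I. (y (fst z) (snd z))\<^sup>2) = Y"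
        unfolding Y_def sum.cartesian_product split_def by (intro sum.cong refl) (auto simp: y_def)
      also have "(\<Sum>z\<in>?I. (avg (inv (fst z)) F' (snd z))\<^sup>2) = (\<Sum>a\<in>H. nrm (avg (inv a) F'))"
        by (simp add: nrm_def sum.cartesian_product split_def)
      also have "\<dots> = (\<Sum>a\<in>H. nrm (avg a F'))" by (rule sum_inv_H[of "\<lambda>a. nrm (avg a F')"])
      also have "Y * \<dots> \<le> Y * (real (q - 1) / real p * real (card T))"
      proof (rule mult_left_mono)
        have "(\<Sum>a\<in>H. nrm (avg a F')) \<le> real (q - 1) / real p * nrm F'" by (rule sum_nrm_avg_le[OF F'0])
        also have "\<dots> \<le> real (q - 1) / real p * real (card T)" using nrmF' by (intro mult_left_mono) auto
        finally show "(\<Sum>a\<in>H. nrm (avg a F')) \<le> real (q - 1) / real p * real (card T)" .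
        show "0 \<le> Y" unfolding Y_def by (intro sum_nonneg) (auto simp: y_def)
      qed
      finally show "(\<Sum>z\<in>?I. y (fst z) (snd z) * avg (inv (fst z)) F' (snd z))\<^sup>2
          \<le> Y * (real (q - 1) / real p * real (card T))" .
    qed
    finally show ?thesis by simp
  qed
  define n where "n = real (q - 1) * N"
  have n0: "0 < n" using N0 q1 by (simp add: n_def)
  have n_eq: "real (card \<Omega>) = n" by (simp add: n_def N_def card_\<Omega> card_V)
  define s where "s = Y / n"
  have sn: "Y = s * n" using n0 by (simp add: s_def)
  have tn: "real (card T) = t * N" using N0 by (simp add: t_def)
  have t0: "0 \<le> t" using N0 by (simp add: t_def)
  have s0: "0 \<le> s" unfolding s_def Y_def using n0 by (intro divide_nonneg_pos sum_nonneg) (auto simp: y_def)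
  \<comment> \<open>The geometric mean of the two densities is the only quantity in which the upper
    and the lower bound are both expressed.\<close>
  define \<mu> where "\<mu> = sqrt (s * t)"
  have mu0: "0 \<le> \<mu>" using s0 t0 by (simp add: \<mu>_def)
  have mu2: "\<mu> * \<mu> = s * t" using s0 t0 by (simp add: \<mu>_def)
  have up: "w \<le> n * (\<mu> * \<mu> + \<mu> / sqrt (real p))"
  proof -
    have "Y * (real (q - 1) / real p * real (card T)) = (n * n) * (s * t) / real p"
      by (simp add: sn tn n_def)
    also have "\<dots> = (n * (\<mu> / sqrt (real p)))\<^sup>2"
      by (simp add: power_mult_distrib power_divide) (simp add: power2_eq_square mu2)
    finally have "sqrt (Y * (real (q - 1) / real p * real (card T))) = n * (\<mu> / sqrt (real p))"
      using n0 mu0 by (intro real_sqrt_unique) auto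
    then show ?thesis using w_le by (simp add: sn mu2 algebra_simps)
  qed
  \<comment> \<open>The geometric mean of the bounds from the left and from the right
    orbits.\<close>
  have lo: "\<kappa> * \<mu> * n \<le> w"
  proof -
    have a: "\<kappa> * s * n \<le> w" using w_left by (simp add: sn mult_ac)
    have b: "\<kappa> * t * n \<le> w" using w_right by (simp add: tn n_def mult_ac)
    have "(\<kappa> * \<mu> * n)\<^sup>2 = (\<kappa> * s * n) * (\<kappa> * t * n)" using mu2 by (simp add: power2_eq_square mult_ac)
    also have "\<dots> \<le> w * w" using a b \<kappa> s0 t0 n0 by (intro mult_mono) (auto simp: w_def)
    finally have "(\<kappa> * \<mu> * n)\<^sup>2 \<le> w\<^sup>2" by (simp add: power2_eq_square)
    then show ?thesis by (rule power2_le_imp_le) (simp add: w_def)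
  qed
  \<comment> \<open>Nonemptiness of \<open>Z\<close> permits the division by
    \<open>\<mu>\<close>.\<close>
  have "0 < w" using Z(2) finZ by (simp add: w_def card_gt_0_iff)
  then have "\<mu> \<noteq> 0" using up by auto
  then have mu: "0 < \<mu>" using mu0 by simp
  have "\<kappa> * \<mu> * n \<le> n * (\<mu> * \<mu> + \<mu> / sqrt (real p))" using up lo by linarith
  then have "(n * \<mu>) * \<kappa> \<le> (n * \<mu>) * (\<mu> + 1 / sqrt (real p))" by (simp add: algebra_simps)
  then have "\<kappa> \<le> \<mu> + 1 / sqrt (real p)" using n0 mu by (simp add: mult_le_cancel_left)
  then have "\<kappa> - 1 / sqrt (real p) \<le> \<mu>" by simp
  then have "\<kappa> * (\<kappa> - 1 / sqrt (real p)) * n \<le> \<kappa> * \<mu> * n" using \<kappa> n0 by (intro mult_right_mono mult_left_mono) auto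
  then show ?thesis using lo by (simp add: n_eq w_def)
qed

end

section \<open>The second singular value\<close>

text \<open>Row sums one make the all-ones vector an eigenvector with eigenvalue one. The remaining
  factor belongs to the action on the quotient by this vector, written in the classes of the last n
  unit vectors.\<close>

lemma char_poly_row_stochastic:
  fixes B :: "'a :: field mat"
  assumes B: "B \<in> carrier_mat (Suc n) (Suc n)" and rows: "\<And>i. i < Suc n \<Longrightarrow> (\<Sum>j<Suc n. B $$ (i, j)) = 1"
  shows "char_poly B = [:-1, 1:] * char_poly (mat n n (\<lambda>(i, j). B $$ (Suc i, Suc j) - B $$ (0, Suc j)))"
proof -
  \<comment> \<open>Change of basis: the first column is the all-ones vector, the others are unit
    vectors. \<open>Q\<close> is its inverse.\<close>
  define P where "P = mat (Suc n) (Suc n) (\<lambda>(i, j). if j = 0 \<or> i = j then 1 else 0 :: 'a)"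
  define Q where "Q = mat (Suc n) (Suc n) (\<lambda>(i, j). if i = j then 1 else if j = 0 then - 1 else 0 :: 'a)"
  define B' where "B' = mat n n (\<lambda>(i, j). B $$ (Suc i, Suc j) - B $$ (0, Suc j))"
  define A where "A = four_block_mat (mat 1 1 (\<lambda>_. 1)) (mat 1 n (\<lambda>(i, j). B $$ (0, Suc j))) (0\<^sub>m n 1) B'"
  have PQ[simp]: "P \<in> carrier_mat (Suc n) (Suc n)" "Q \<in> carrier_mat (Suc n) (Suc n)" by (auto simp: P_def Q_def)
  have B'[simp]: "B' \<in> carrier_mat n n" by (simp add: B'_def)
  have A: "A \<in> carrier_mat (Suc n) (Suc n)" unfolding A_def by (auto simp: four_block_mat_def Let_def B'_def)
  have delta: "(\<Sum>k = 0..<Suc n. (if i = k then 1 else if k = 0 then - 1 else 0) * f k) = (if i = 0 then f 0 else f i - f 0)"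
    if "i < Suc n" for i and f :: "nat \<Rightarrow> 'a"
  proof (cases "i = 0")
    case True
    have "(\<Sum>k = 0..<Suc n. (if i = k then 1 else if k = 0 then - 1 else 0) * f k) = (\<Sum>k = 0..<Suc n. if k = 0 then f 0 else 0)"
      using True by (intro sum.cong) auto
    then show ?thesis using True by simp
  next
    case False
    have "(\<Sum>k = 0..<Suc n. (if i = k then 1 else if k = 0 then - 1 else 0) * f k)
      = (\<Sum>k = 0..<Suc n. (if k = i then f i else 0) + (if k = 0 then - f 0 else 0))"
      using False by (intro sum.cong) auto
    then show ?thesis using False that by (simp only: sum.distrib) simp
  qed
  have delta2: "(\<Sum>k = 0..<Suc n. f k * (if k = j then 1 else 0)) = f j" if "j < Suc n" for j and f :: "nat \<Rightarrow> 'a"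
  proof -
    have "(\<Sum>k = 0..<Suc n. f k * (if k = j then 1 else 0)) = (\<Sum>k = 0..<Suc n. if k = j then f j else 0)"
      by (intro sum.cong) auto
    then show ?thesis using that by simp
  qed
  have QP: "Q * P = 1\<^sub>m (Suc n)"
  proof (rule eq_matI)
    fix i j assume ij: "i < dim_row (1\<^sub>m (Suc n) :: 'a mat)" "j < dim_col (1\<^sub>m (Suc n) :: 'a mat)"
    have "(Q * P) $$ (i, j) = (\<Sum>k = 0..<Suc n. (if i = k then 1 else if k = 0 then - 1 else 0) * P $$ (k, j))"
      using ij by (simp add: scalar_prod_def Q_def P_def)
    also have "\<dots> = (if i = 0 then P $$ (0, j) else P $$ (i, j) - P $$ (0, j))"
      using ij by (intro delta) simp
    finally show "(Q * P) $$ (i, j) = 1\<^sub>m (Suc n) $$ (i, j)" using ij by (auto simp: P_def)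
  qed (auto simp: P_def Q_def)
  have PQ1: "P * Q = 1\<^sub>m (Suc n)" using mat_mult_left_right_inverse[OF PQ(2,1) QP] .
  have BP: "(B * P) $$ (i, j) = (if j = 0 then 1 else B $$ (i, j))" if "i < Suc n" "j < Suc n" for i j
  proof -
    have "(B * P) $$ (i, j) = (\<Sum>k = 0..<Suc n. B $$ (i, k) * P $$ (k, j))"
      using that carrier_matD[OF B] by (simp add: scalar_prod_def P_def del: sum.op_ivl_Suc)
    also have "\<dots> = (\<Sum>k = 0..<Suc n. B $$ (i, k) * (if j = 0 \<or> k = j then 1 else 0))"
      using that by (intro sum.cong) (auto simp: P_def)
    also have "\<dots> = (if j = 0 then 1 else B $$ (i, j))"
      using rows[OF that(1)] delta2[OF that(2), of "\<lambda>k. B $$ (i, k)"] by (auto simp: atLeast0LessThan)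
    finally show ?thesis .
  qed
  have QBP: "Q * (B * P) = A"
  proof (rule eq_matI)
    fix i j assume ij: "i < dim_row A" "j < dim_col A"
    then have ij': "i < Suc n" "j < Suc n" using A by auto
    have "(Q * (B * P)) $$ (i, j) = (\<Sum>k = 0..<Suc n. Q $$ (i, k) * (B * P) $$ (k, j))"
      using ij' carrier_matD[OF B] carrier_matD[OF PQ(2)] carrier_matD[OF PQ(1)]
      by (simp add: scalar_prod_def del: sum.op_ivl_Suc)
    also have "\<dots> = (\<Sum>k = 0..<Suc n. (if i = k then 1 else if k = 0 then - 1 else 0) * (B * P) $$ (k, j))"
      using ij' by (intro sum.cong) (auto simp: Q_def)
    also have "\<dots> = (if i = 0 then (B * P) $$ (0, j) else (B * P) $$ (i, j) - (B * P) $$ (0, j))"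
      by (rule delta[OF ij'(1)])
    also have "\<dots> = A $$ (i, j)"
      using ij' by (cases i; cases j) (auto simp: BP A_def B'_def)
    finally show "(Q * (B * P)) $$ (i, j) = A $$ (i, j)" .
  qed (use A B carrier_matD[OF PQ(1)] carrier_matD[OF PQ(2)] in auto)
  have "similar_mat B A"
  proof (rule similar_matI)
    show "{B, A, P, Q} \<subseteq> carrier_mat (Suc n) (Suc n)" using A B by auto
    have BPc: "B * P \<in> carrier_mat (Suc n) (Suc n)" using B PQ(1) by (rule mult_carrier_mat)
    have "P * A = B * P"
      using assoc_mult_mat[OF PQ(1,2) BPc] left_mult_one_mat[OF BPc] by (simp add: QBP PQ1)
    then show "B = P * A * Q"
      using assoc_mult_mat[OF B PQ(1,2)] PQ1 B by simp
  qed (use PQ1 QP in auto)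
  then have "char_poly B = char_poly A" by (rule char_poly_similar)
  also have "\<dots> = char_poly (mat 1 1 (\<lambda>_. 1 :: 'a)) * char_poly B'"
    unfolding A_def by (rule char_poly_four_block_zeros_col) auto
  also have "char_poly (mat 1 1 (\<lambda>_. 1 :: 'a)) = [:-1, 1:]"
    by (subst char_poly_upper_triangular[of _ 1]) (auto simp: diag_mat_def)
  finally show ?thesis by (simp add: B'_def)
qed

text \<open>Singular values are defined through roots of a characteristic polynomial with
  multiplicity, so a bound on some eigenvectors is not enough. The root one is split off once, and
  every root of the remaining factor is shown to have an eigenvector of mean zero, where
  \<open>quad\<close> bounds the Rayleigh quotient.\<close>

lemma second_singular_value_bound:
  fixes M :: "real mat"
  assumes M: "M \<in> carrier_mat l (Suc n)" and n: "0 < n" and c: "0 \<le> c" "c \<le> 1"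
    and rows: "\<And>i. i < Suc n \<Longrightarrow> (\<Sum>j<Suc n. \<Sum>k<l. M $$ (k, i) * M $$ (k, j)) = 1"
    and quad: "\<And>x :: nat \<Rightarrow> real. (\<Sum>j<Suc n. x j) = 0 \<Longrightarrow>
      (\<Sum>k<l. (\<Sum>j<Suc n. M $$ (k, j) * x j)\<^sup>2) \<le> c * (\<Sum>j<Suc n. (x j)\<^sup>2)"
  shows "0 \<le> singular_values M ! 1" "singular_values M ! 1 \<le> sqrt c"
proof -
  define B where "B = transpose_mat M * M"
  have Bc: "B \<in> carrier_mat (Suc n) (Suc n)" using M by (simp add: B_def)
  have Bij: "B $$ (i, j) = (\<Sum>k<l. M $$ (k, i) * M $$ (k, j))" if "i < Suc n" "j < Suc n" for i j
    using M that by (simp add: B_def scalar_prod_def atLeast0LessThan)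
  have Bsym: "B $$ (i, j) = B $$ (j, i)" if "i < Suc n" "j < Suc n" for i j
    using that by (simp add: Bij mult.commute)
  have Brow: "(\<Sum>j<Suc n. B $$ (i, j)) = 1" if "i < Suc n" for i
    using rows[OF that] that by (simp add: Bij del: sum.lessThan_Suc)
  have Bcol: "(\<Sum>i<Suc n. B $$ (i, j)) = 1" if "j < Suc n" for j
    using Brow[OF that] Bsym[OF that] by (simp del: sum.lessThan_Suc)
  define B' where "B' = mat n n (\<lambda>(i, j). B $$ (Suc i, Suc j) - B $$ (0, Suc j))"
  have B': "B' \<in> carrier_mat n n" by (simp add: B'_def)
  have cpB: "char_poly B = [:-1, 1:] * char_poly B'"
    unfolding B'_def by (rule char_poly_row_stochastic[OF Bc Brow])
  \<comment> \<open>The deflated matrix \<open>B'\<close> need not be symmetric. Over the complex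
    numbers its characteristic polynomial splits, and each root is shown to be real
    afterwards.\<close>
  define C where "C = map_mat complex_of_real B'"
  have C: "C \<in> carrier_mat n n" using B' by (simp add: C_def)
  obtain as where as: "char_poly C = (\<Prod>a\<leftarrow>as. [:- a, 1:])" "length as = n"
    using char_poly_factorized[OF C] by auto
  have real_root: "\<exists>\<nu>. a = complex_of_real \<nu> \<and> 0 \<le> \<nu> \<and> \<nu> \<le> c" if a: "a \<in> set as" for a
  proof -
    have "poly (char_poly C) a = 0" using a unfolding as(1) poly_prod_list by (auto simp: prod_list_zero_iff)
    then have "eigenvalue C a" using eigenvalue_root_char_poly[OF C] by simp
    then obtain y where y: "y \<in> carrier_vec n" "y \<noteq> 0\<^sub>v n" "C *\<^sub>v y = a \<cdot>\<^sub>v y"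
      using C unfolding eigenvalue_def eigenvector_def by auto
    \<comment> \<open>Lift from the quotient: a zero is put in position 0, so that \<open>z\<close>
      is an eigenvector of \<open>B\<close> up to the constant \<open>d\<close>.\<close>
    define z where "z i = (case i of 0 \<Rightarrow> 0 | Suc i \<Rightarrow> y $ i)" for i
    define Bz where "Bz i = (\<Sum>j<Suc n. complex_of_real (B $$ (i, j)) * z j)" for i
    define d where "d = Bz 0"
    have Bz_eq: "Bz i = a * z i + d" if i: "i < Suc n" for i
    proof (cases i)
      case 0
      then show ?thesis by (simp add: d_def z_def)
    next
      case (Suc i')
      then have i': "i' < n" using i by simp
      have "(C *\<^sub>v y) $ i' = (\<Sum>j<n. complex_of_real (B $$ (Suc i', Suc j) - B $$ (0, Suc j)) * y $ j)"
        using i' C y(1) by (simp add: scalar_prod_def C_def B'_def atLeast0LessThan)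
      also have "\<dots> = Bz i - Bz 0"
        unfolding Bz_def sum.lessThan_Suc_shift Suc
        by (simp add: z_def sum_subtractf left_diff_distrib)
      finally have "Bz i - Bz 0 = a * z i" using y i' Suc by (simp add: z_def)
      then show ?thesis by (simp add: d_def algebra_simps)
    qed
    define N where "N = complex_of_real (real (Suc n))"
    define \<mu> where "\<mu> = (\<Sum>i<Suc n. z i) / N"
    have N0: "N \<noteq> 0" unfolding N_def of_real_eq_0_iff by simp
    have Nmu: "(\<Sum>i<Suc n. z i) = N * \<mu>" using N0 by (simp add: \<mu>_def)
    have "(\<Sum>i<Suc n. Bz i) = (\<Sum>j<Suc n. \<Sum>i<Suc n. complex_of_real (B $$ (i, j)) * z j)"
      unfolding Bz_def by (rule sum.swap)
    also have "\<dots> = (\<Sum>j<Suc n. complex_of_real (\<Sum>i<Suc n. B $$ (i, j)) * z j)"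
      by (simp only: of_real_sum sum_distrib_right)
    also have "\<dots> = (\<Sum>j<Suc n. z j)" using Bcol by (intro sum.cong) auto
    finally have sumBz: "(\<Sum>i<Suc n. Bz i) = N * \<mu>" using Nmu by simp
    have "(\<Sum>i<Suc n. Bz i) = (\<Sum>i<Suc n. a * z i + d)" using Bz_eq by (intro sum.cong) auto
    also have "\<dots> = a * (N * \<mu>) + N * d"
      unfolding Nmu[symmetric] by (simp add: sum.distrib sum_distrib_left N_def del: sum.lessThan_Suc)
    finally have "N * \<mu> = N * (a * \<mu> + d)" using sumBz by (simp add: algebra_simps)
    \<comment> \<open>Since the columns of \<open>B\<close> also sum to one, the mean obeys the same
      affine relation as the entries of \<open>Bz\<close>. Subtracting it turns \<open>z\<close>
      into a true eigenvector of mean zero.\<close>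
    then have mud: "\<mu> = a * \<mu> + d" using N0 by simp
    define w where "w i = z i - \<mu>" for i
    have Bw: "(\<Sum>j<Suc n. complex_of_real (B $$ (i, j)) * w j) = a * w i" if i: "i < Suc n" for i
    proof -
      have "(\<Sum>j<Suc n. complex_of_real (B $$ (i, j)) * w j) = Bz i - (\<Sum>j<Suc n. complex_of_real (B $$ (i, j))) * \<mu>"
        by (simp add: Bz_def w_def right_diff_distrib sum_subtractf sum_distrib_right del: sum.lessThan_Suc)
      also have "(\<Sum>j<Suc n. complex_of_real (B $$ (i, j))) = 1"
        using Brow[OF i] by (metis of_real_1 of_real_sum)
      also have "Bz i - 1 * \<mu> = a * z i + d - \<mu>" using Bz_eq[OF i] by simp
      also have "d = \<mu> - a * \<mu>" using mud by (metis add_diff_cancel_left')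
      also have "a * z i + (\<mu> - a * \<mu>) - \<mu> = a * w i" by (simp add: w_def algebra_simps)
      finally show ?thesis .
    qed
    define S where "S = (\<Sum>i<Suc n. (cmod (w i))\<^sup>2)"
    have S0: "0 < S"
    proof -
      obtain i where i: "i < n" "y $ i \<noteq> 0" using y(1,2) by (metis carrier_vecD eq_vecI index_zero_vec)
      have "w (Suc i) \<noteq> 0 \<or> w 0 \<noteq> 0" using i by (auto simp: w_def z_def)
      then obtain k where k: "k < Suc n" "w k \<noteq> 0" using i by auto
      have "0 < (cmod (w k))\<^sup>2" using k by simp
      also have "\<dots> \<le> S" unfolding S_def using k by (intro member_le_sum) auto
      finally show ?thesis .
    qed
    define u where "u k = (\<Sum>j<Suc n. complex_of_real (M $$ (k, j)) * w j)" for k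
    have "complex_of_real (\<Sum>k<l. (cmod (u k))\<^sup>2) = (\<Sum>k<l. cnj (u k) * u k)"
      by (simp only: of_real_sum complex_norm_square mult.commute)
    also have "\<dots> = (\<Sum>k<l. \<Sum>i<Suc n. \<Sum>j<Suc n. complex_of_real (M $$ (k, i)) * cnj (w i) * (complex_of_real (M $$ (k, j)) * w j))"
      unfolding u_def cnj_sum sum_product by simp
    also have "\<dots> = (\<Sum>i<Suc n. \<Sum>j<Suc n. \<Sum>k<l. complex_of_real (M $$ (k, i)) * cnj (w i) * (complex_of_real (M $$ (k, j)) * w j))"
      by (subst sum.swap, rule sum.cong[OF refl], rule sum.swap)
    also have "\<dots> = (\<Sum>i<Suc n. \<Sum>j<Suc n. cnj (w i) * (complex_of_real (B $$ (i, j)) * w j))"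
      by (intro sum.cong refl) (simp add: Bij sum_distrib_left sum_distrib_right mult_ac)
    also have "\<dots> = (\<Sum>i<Suc n. cnj (w i) * (a * w i))"
      using Bw by (simp only: sum_distrib_left[symmetric]) (intro sum.cong, auto)
    also have "\<dots> = a * complex_of_real S"
      unfolding S_def of_real_sum sum_distrib_left by (intro sum.cong refl) (simp only: complex_norm_square mult_ac)
    \<comment> \<open>The root is the quotient of the two nonnegative reals \<open>L\<close> and
      \<open>S\<close>, hence itself real and nonnegative.\<close>
    finally have aS: "complex_of_real (\<Sum>k<l. (cmod (u k))\<^sup>2) = a * complex_of_real S" .
    define L where "L = (\<Sum>k<l. (cmod (u k))\<^sup>2)"
    have aL: "a = complex_of_real (L / S)" using aS S0 by (simp add: L_def field_simps)
    have w_sum: "(\<Sum>i<Suc n. w i) = 0"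
      unfolding w_def sum_subtractf Nmu by (simp add: N_def)
    have "(\<Sum>i<Suc n. Re (w i)) = 0" "(\<Sum>i<Suc n. Im (w i)) = 0"
      using arg_cong[OF w_sum, of Re] arg_cong[OF w_sum, of Im] by (simp_all only: Re_sum Im_sum zero_complex.simps)
    \<comment> \<open>\<open>quad\<close> speaks of real vectors and is applied to the real and the
      imaginary part.\<close>
    note q = quad[OF this(1)] quad[OF this(2)]
    have "L = (\<Sum>k<l. (\<Sum>j<Suc n. M $$ (k, j) * Re (w j))\<^sup>2) + (\<Sum>k<l. (\<Sum>j<Suc n. M $$ (k, j) * Im (w j))\<^sup>2)"
      unfolding L_def cmod_power2 u_def Re_sum Im_sum by (simp add: sum.distrib)
    also have "\<dots> \<le> c * (\<Sum>j<Suc n. (Re (w j))\<^sup>2) + c * (\<Sum>j<Suc n. (Im (w j))\<^sup>2)"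
      using q by (rule add_mono)
    also have "\<dots> = c * S" unfolding S_def cmod_power2 sum.distrib by (simp only: distrib_left)
    finally have "L / S \<le> c" using S0 by (simp add: pos_divide_le_eq)
    moreover have "0 \<le> L / S" using S0 by (simp add: L_def sum_nonneg)
    ultimately show ?thesis using aL by blast
  qed
  define \<nu>s where "\<nu>s = map Re as"
  have nu: "0 \<le> \<nu> \<and> \<nu> \<le> c" if "\<nu> \<in> set \<nu>s" for \<nu>
    using that real_root by (fastforce simp: \<nu>s_def)
  have as_nu: "as = map complex_of_real \<nu>s"
    unfolding \<nu>s_def map_map by (rule map_idI[symmetric]) (use real_root in fastforce)
  interpret mp: map_poly_inj_comm_ring_hom complex_of_real ..
  have "map_poly complex_of_real (char_poly B') = char_poly C"
    unfolding C_def by (rule of_real_hom.char_poly_hom[OF B', symmetric])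
  also have "\<dots> = map_poly complex_of_real (\<Prod>a\<leftarrow>\<nu>s. [:- a, 1:])"
    unfolding as(1) as_nu by (induction \<nu>s) (simp_all only: list.map prod_list.Cons prod_list.Nil mp.hom_mult mp.hom_one, simp)
  finally have cpB': "char_poly B' = (\<Prod>a\<leftarrow>\<nu>s. [:- a, 1:])"
    by (rule mp.injectivity)
  have roots: "proots (\<Prod>a\<leftarrow>xs. [:- a, 1:]) = mset xs \<and> (\<Prod>a\<leftarrow>xs. [:- a, 1:]) \<noteq> 0" for xs :: "real list"
  proof (induction xs)
    case (Cons a xs)
    let ?p = "\<Prod>a\<leftarrow>xs. [:- a, 1:]"
    have "proots ([:- a, 1:] * ?p) = proots [:- a, 1:] + proots ?p"
      by (rule proots_mult) (use Cons in auto)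
    then have "proots ([:- a, 1:] * ?p) = add_mset a (proots ?p)"
      by (simp del: mult_pCons_left mult_pCons_right)
    moreover have "[:- a, 1:] * ?p \<noteq> 0" using Cons by (metis no_zero_divisors pCons_eq_0_iff zero_neq_one)
    ultimately show ?case using Cons by (simp only: list.map prod_list.Cons mset.simps) simp
  qed simp
  have "char_poly B = (\<Prod>a\<leftarrow>1 # \<nu>s. [:- a, 1:])" by (simp add: cpB cpB')
  then have "proots (char_poly B) = mset (1 # \<nu>s)" using roots[of "1 # \<nu>s"] by metis
  then have sv: "singular_values M = rev (sorted_list_of_multiset (mset (map sqrt (1 # \<nu>s))))"
    by (simp add: singular_values_def B_def[symmetric])
  \<comment> \<open>As \<open>c \<le> 1\<close>, the value one is the largest, so the entry at index
    1 comes from the deflated factor; it exists because \<open>0 < n\<close>.\<close>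
  have "sort (map sqrt (1 # \<nu>s)) = sort (map sqrt \<nu>s) @ [1]"
    by (rule properties_for_sort) (use nu c in \<open>auto simp: sorted_append intro: order_trans\<close>)
  then have sv': "singular_values M = 1 # rev (sort (map sqrt \<nu>s))"
    unfolding sv sorted_list_of_multiset_mset by simp
  have "length \<nu>s = n" using as(2) by (simp add: \<nu>s_def)
  then have "singular_values M ! 1 \<in> set (map sqrt \<nu>s)"
    unfolding sv' using n nth_mem[of 0 "rev (sort (map sqrt \<nu>s))"] by simp
  then show "0 \<le> singular_values M ! 1" "singular_values M ! 1 \<le> sqrt c"
    using nu by auto
qed

text \<open>Transfers the bound from list positions to sets of cosets. The condition
  \<open>rows\<close> says that the Gram matrix fixes the constant vector.\<close>

lemma second_singular_value_bound_sets:
  fixes w :: "'l \<Rightarrow> 'r \<Rightarrow> real"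
  assumes ls: "distinct ls" and rs: "distinct rs" "2 \<le> length rs" and c: "0 \<le> c" "c \<le> 1"
    and rows: "\<And>R. R \<in> set rs \<Longrightarrow> (\<Sum>L\<in>set ls. w L R * (\<Sum>R'\<in>set rs. w L R')) = 1"
    and quad: "\<And>x. (\<Sum>R\<in>set rs. x R) = 0 \<Longrightarrow>
      (\<Sum>L\<in>set ls. (\<Sum>R\<in>set rs. w L R * x R)\<^sup>2) \<le> c * (\<Sum>R\<in>set rs. (x R)\<^sup>2)"
  defines "M \<equiv> mat (length ls) (length rs) (\<lambda>(i, j). w (ls ! i) (rs ! j))"
  shows "0 \<le> singular_values M ! 1" "singular_values M ! 1 \<le> sqrt c"
proof -
  obtain n where n: "length rs = Suc n" "0 < n" using rs(2) by (cases "length rs") auto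
  have sum_rs: "(\<Sum>j<Suc n. f (rs ! j)) = (\<Sum>R\<in>set rs. f R)" for f :: "'r \<Rightarrow> real"
    using sum.reindex_bij_betw[OF bij_betw_nth[OF rs(1) refl refl], of f] n(1) by simp
  have sum_ls: "(\<Sum>i<length ls. f (ls ! i)) = (\<Sum>L\<in>set ls. f L)" for f :: "'l \<Rightarrow> real"
    using sum.reindex_bij_betw[OF bij_betw_nth[OF ls refl refl], of f] by simp
  have M: "M \<in> carrier_mat (length ls) (Suc n)" by (simp add: M_def n(1))
  have Mij: "M $$ (k, j) = w (ls ! k) (rs ! j)" if "k < length ls" "j < Suc n" for k j
    using that n(1) by (simp add: M_def)
  have 1: "(\<Sum>j<Suc n. \<Sum>k<length ls. M $$ (k, i) * M $$ (k, j)) = 1" if i: "i < Suc n" for i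
  proof -
    have "(\<Sum>j<Suc n. \<Sum>k<length ls. M $$ (k, i) * M $$ (k, j))
        = (\<Sum>j<Suc n. \<Sum>k<length ls. w (ls ! k) (rs ! i) * w (ls ! k) (rs ! j))"
      using i by (intro sum.cong refl) (simp add: Mij)
    also have "\<dots> = (\<Sum>k<length ls. w (ls ! k) (rs ! i) * (\<Sum>j<Suc n. w (ls ! k) (rs ! j)))"
      unfolding sum_distrib_left by (rule sum.swap)
    also have "\<dots> = (\<Sum>k<length ls. w (ls ! k) (rs ! i) * (\<Sum>R\<in>set rs. w (ls ! k) R))"
      by (simp only: sum_rs)
    also have "\<dots> = (\<Sum>L\<in>set ls. w L (rs ! i) * (\<Sum>R\<in>set rs. w L R))"
      by (rule sum_ls[of "\<lambda>L. w L (rs ! i) * (\<Sum>R\<in>set rs. w L R)"])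
    also have "\<dots> = 1" using i n(1) by (intro rows) simp
    finally show ?thesis .
  qed
  have 2: "(\<Sum>k<length ls. (\<Sum>j<Suc n. M $$ (k, j) * x j)\<^sup>2) \<le> c * (\<Sum>j<Suc n. (x j)\<^sup>2)"
    if x: "(\<Sum>j<Suc n. x j) = 0" for x :: "nat \<Rightarrow> real"
  proof -
    define ix where "ix = the_inv_into {..<Suc n} ((!) rs)"
    have ix: "ix (rs ! j) = j" if "j < Suc n" for j
      unfolding ix_def using that n(1) rs(1)
      by (intro the_inv_into_f_f) (auto simp: inj_on_def nth_eq_iff_index_eq)
    have xs: "(\<Sum>R\<in>set rs. x (ix R)) = 0" using x sum_rs[of "\<lambda>R. x (ix R)"] ix by simp
    have "(\<Sum>k<length ls. (\<Sum>j<Suc n. M $$ (k, j) * x j)\<^sup>2)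
        = (\<Sum>k<length ls. (\<Sum>j<Suc n. w (ls ! k) (rs ! j) * x (ix (rs ! j)))\<^sup>2)"
      by (intro sum.cong refl arg_cong[of _ _ "\<lambda>x. x\<^sup>2"]) (simp add: Mij ix)
    also have "\<dots> = (\<Sum>k<length ls. (\<Sum>R\<in>set rs. w (ls ! k) R * x (ix R))\<^sup>2)"
      by (simp only: sum_rs[of "\<lambda>R. w L R * x (ix R)" for L])
    also have "\<dots> = (\<Sum>L\<in>set ls. (\<Sum>R\<in>set rs. w L R * x (ix R))\<^sup>2)"
      by (rule sum_ls[of "\<lambda>L. (\<Sum>R\<in>set rs. w L R * x (ix R))\<^sup>2"])
    also have "\<dots> \<le> c * (\<Sum>R\<in>set rs. (x (ix R))\<^sup>2)" by (rule quad[OF xs])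
    also have "(\<Sum>R\<in>set rs. (x (ix R))\<^sup>2) = (\<Sum>j<Suc n. (x j)\<^sup>2)"
      using sum_rs[of "\<lambda>R. (x (ix R))\<^sup>2"] ix by simp
    finally show ?thesis .
  qed
  show "0 \<le> singular_values M ! 1" "singular_values M ! 1 \<le> sqrt c"
    using second_singular_value_bound[OF M n(2) c 1 2] by auto
qed

lemma enumeration_props:
  assumes "finite S" shows "distinct (enumeration S)" "set (enumeration S) = S"
proof -
  have "\<exists>xs. distinct xs \<and> set xs = S" using finite_distinct_list[OF assms] by blast
  then have "distinct (enumeration S) \<and> set (enumeration S) = S"
    unfolding enumeration_def by (rule someI_ex)
  then show "distinct (enumeration S)" "set (enumeration S) = S" by auto
qed

section \<open>The coset graph in the coordinates of \<open>H \<times> V\<close>\<close>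

context coset_code_setup_ge2
begin

text \<open>The map \<open>x \<mapsto> a (x + v)\<close>. It sends \<open>\<alpha>\<close> to
  \<open>\<omega> a v\<close>, so group elements and evaluation points share their
  coordinates.\<close>

definition \<phi> :: "'a \<times> 'a \<Rightarrow> 'a \<Rightarrow> 'a" where "\<phi> z = aff (fst z) (fst z \<otimes> snd z)"

lemma \<phi>_inj: "inj_on \<phi> (H \<times> V)"
proof (rule inj_onI)
  fix y z assume yz: "y \<in> H \<times> V" "z \<in> H \<times> V" "\<phi> y = \<phi> z"
  obtain a v b w where [simp]: "y = (a, v)" "z = (b, w)" by (cases y; cases z) auto
  have R: "a \<in> carrier R" "v \<in> carrier R" "b \<in> carrier R" "w \<in> carrier R" "a \<in> Units R"
    using yz H_Units V_carrier by auto
  have "a = b \<and> a \<otimes> v = b \<otimes> w"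
  proof (rule aff_inj)
    show "aff a (a \<otimes> v) = aff b (b \<otimes> w)" using yz(3) by (simp add: \<phi>_def)
  qed (use R in auto)
  then have "a = b" "a \<otimes> v = a \<otimes> w" by auto
  then show "y = z" using R Units_l_cancel[of a v w] by simp
qed

lemma shift_inj:
  assumes "a \<in> H" "v \<in> V" "g \<in> G" "h \<in> G" "v \<oplus> inv a \<otimes> g = v \<oplus> inv a \<otimes> h"
  shows "g = h"
proof -
  have R: "inv a \<in> Units R" "inv a \<in> carrier R" "v \<in> carrier R" "g \<in> carrier R" "h \<in> carrier R"
    using assms H_Units[OF H_inv(1)] V_carrier G_carrier by auto
  then have "inv a \<otimes> g = inv a \<otimes> h" using assms(5) by simp
  then show ?thesis using R Units_l_cancel[of "inv a" g h] by simp
qed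

definition left_coset :: "'a \<Rightarrow> 'a \<Rightarrow> ('a \<Rightarrow> 'a) set" where
  "left_coset a v = (\<lambda>g. \<phi> (a, v \<oplus> inv a \<otimes> g)) ` G"

definition right_coset :: "'a \<Rightarrow> ('a \<Rightarrow> 'a) set" where
  "right_coset v = (\<lambda>b. \<phi> (b, v)) ` H"

lemma affs_eq: "affs = \<phi> ` (H \<times> V)"
proof (intro equalityI subsetI)
  fix x assume "x \<in> affs"
  then obtain a b where x: "x = aff a b" "a \<in> H" "b \<in> V" unfolding affs_def by blast
  have "a \<otimes> (inv a \<otimes> b) = b" using x H_inv[of a] H_Units V_carrier by (simp add: m_assoc[symmetric])
  then have "x = \<phi> (a, inv a \<otimes> b)" using x by (simp add: \<phi>_def)
  moreover have "inv a \<otimes> b \<in> V" using x H_inv(1)[of a] H_Units by (intro V_smult) auto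
  ultimately show "x \<in> \<phi> ` (H \<times> V)" using x by auto
next
  fix x assume "x \<in> \<phi> ` (H \<times> V)"
  then obtain a v where x: "a \<in> H" "v \<in> V" "x = aff a (a \<otimes> v)" by (auto simp: \<phi>_def)
  moreover have "a \<otimes> v \<in> V" using x H_Units by (intro V_smult) auto
  ultimately show "x \<in> affs" unfolding affs_def by blast
qed

lemma left_rcosets: "rcosets\<^bsub>A\<^esub> (translation_maps G) = (\<lambda>(a, v). left_coset a v) ` (H \<times> V)"
proof -
  have "translation_maps G #>\<^bsub>A\<^esub> \<phi> (a, v) = left_coset a v" if av: "a \<in> H" "v \<in> V" for a v
  proof -
    have "aff \<one> g \<otimes>\<^bsub>A\<^esub> \<phi> (a, v) = \<phi> (a, v \<oplus> inv a \<otimes> g)" if g: "g \<in> G" for g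
    proof -
      have R: "a \<in> carrier R" "v \<in> carrier R" "g \<in> carrier R" "inv a \<in> carrier R"
        using av g H_Units H_inv(1) V_carrier G_carrier by auto
      have "a \<otimes> (inv a \<otimes> g) = g" using R av H_inv[of a] by (simp add: m_assoc[symmetric])
      then have "a \<otimes> (v \<oplus> inv a \<otimes> g) = a \<otimes> v \<oplus> g" using R by (simp add: r_distr)
      moreover have "aff \<one> g \<otimes>\<^bsub>A\<^esub> aff a (a \<otimes> v) = aff (\<one> \<otimes> a) (\<one> \<otimes> (a \<otimes> v) \<oplus> g)"
        using av g one_H G_subset_V H_Units by (intro A_mult) (auto intro!: V_smult)
      ultimately show ?thesis using R by (simp add: \<phi>_def)
    qed
    then show ?thesis unfolding r_coset_def translation_maps_eq left_coset_def by auto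
  qed
  then show ?thesis unfolding RCOSETS_def A_carrier affs_eq by auto
qed

lemma right_rcosets: "rcosets\<^bsub>A\<^esub> (scaling_maps H) = right_coset ` V"
proof -
  have "scaling_maps H #>\<^bsub>A\<^esub> \<phi> (a, v) = right_coset v" if av: "a \<in> H" "v \<in> V" for a v
  proof -
    have R: "a \<in> carrier R" "v \<in> carrier R" "inv a \<in> H" using av H_Units H_inv(1) V_carrier by auto
    have mult: "aff c \<zero> \<otimes>\<^bsub>A\<^esub> \<phi> (a, v) = \<phi> (c \<otimes> a, v)" if c: "c \<in> H" for c
    proof -
      have "aff c \<zero> \<otimes>\<^bsub>A\<^esub> aff a (a \<otimes> v) = aff (c \<otimes> a) (c \<otimes> (a \<otimes> v) \<oplus> \<zero>)"
        using av c V_zero H_Units by (intro A_mult) (auto intro!: V_smult)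
      then show ?thesis using R H_Units[OF c] by (simp add: \<phi>_def m_assoc)
    qed
    have "scaling_maps H #>\<^bsub>A\<^esub> \<phi> (a, v) = (\<lambda>c. \<phi> (c \<otimes> a, v)) ` H"
      unfolding r_coset_def scaling_maps_eq using mult by auto
    also have "\<dots> = (\<lambda>b. \<phi> (b, v)) ` ((\<lambda>c. c \<otimes> a) ` H)" by (simp add: image_image)
    also have "(\<lambda>c. c \<otimes> a) ` H = H"
    proof (rule endo_inj_surj[OF finite_H])
      show "(\<lambda>c. c \<otimes> a) ` H \<subseteq> H" using H_mult av by auto
      show "inj_on (\<lambda>c. c \<otimes> a) H"
        using H_Units av(1) by (intro inj_onI) (simp add: m_rcancel)
    qed
    finally show ?thesis by (simp add: right_coset_def)
  qed
  then show ?thesis unfolding RCOSETS_def A_carrier affs_eq using one_H by auto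
qed

lemma right_coset_inj: "inj_on right_coset V"
proof (rule inj_onI)
  fix v w assume vw: "v \<in> V" "w \<in> V" "right_coset v = right_coset w"
  then have "\<phi> (\<one>, v) \<in> right_coset w" using one_H by (auto simp: right_coset_def)
  then obtain b where "b \<in> H" "\<phi> (\<one>, v) = \<phi> (b, w)" by (auto simp: right_coset_def)
  then show "v = w" using inj_onD[OF \<phi>_inj, of "(\<one>, v)" "(b, w)"] vw one_H by auto
qed

lemma left_coset_mem_iff:
  assumes av: "a \<in> H" "v \<in> V" and bw: "b \<in> H" "w \<in> V"
  shows "\<phi> (b, w) \<in> left_coset a v \<longleftrightarrow> left_coset b w = left_coset a v"
proof
  assume "left_coset b w = left_coset a v"
  moreover have "\<phi> (b, w) \<in> left_coset b w"
    using bw G_zero V_carrier H_inv(1)[of b] H_Units by (auto simp: left_coset_def intro!: image_eqI[of _ _ \<zero>])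
  ultimately show "\<phi> (b, w) \<in> left_coset a v" by simp
next
  assume "\<phi> (b, w) \<in> left_coset a v"
  then obtain g where g: "g \<in> G" "\<phi> (b, w) = \<phi> (a, v \<oplus> inv a \<otimes> g)" by (auto simp: left_coset_def)
  then have ba: "b = a" and w: "w = v \<oplus> inv a \<otimes> g"
    using inj_onD[OF \<phi>_inj g(2)] bw av shift_V[OF av g(1)] by auto
  have R: "inv a \<in> carrier R" "v \<in> carrier R" "g \<in> carrier R"
    using av g H_inv(1) H_Units V_carrier G_carrier by auto
  have "left_coset b w = (\<lambda>h. \<phi> (a, v \<oplus> inv a \<otimes> (g \<oplus> h))) ` G"
    unfolding left_coset_def ba w using R G_carrier by (intro image_cong) (auto simp: r_distr a_assoc)
  also have "\<dots> = (\<lambda>h. \<phi> (a, v \<oplus> inv a \<otimes> h)) ` ((\<lambda>h. g \<oplus> h) ` G)" by (simp add: image_image)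
  also have "(\<lambda>h. g \<oplus> h) ` G = G"
    using g R G_carrier G_add by (intro endo_inj_surj finite_G) (auto intro!: inj_onI)
  finally show "left_coset b w = left_coset a v" by (simp add: left_coset_def)
qed

text \<open>A left and a right coset share one element if \<open>w\<close> lies in
  \<open>v + inv a G\<close> and none otherwise. The unnormalized adjacency operator is therefore
  \<open>q\<close> times an average.\<close>

lemma sum_left_right:
  assumes av: "a \<in> H" "v \<in> V"
  shows "(\<Sum>w\<in>V. real (card (left_coset a v \<inter> right_coset w)) * x w) = real q * avg (inv a) x v"
proof -
  let ?s = "\<lambda>g. v \<oplus> inv a \<otimes> g"
  have s: "?s g \<in> V" if "g \<in> G" for g using shift_V[OF av that] .
  have "card (left_coset a v \<inter> right_coset w) = card {g \<in> G. ?s g = w}" if w: "w \<in> V" for w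
  proof -
    have "left_coset a v \<inter> right_coset w = (\<lambda>g. \<phi> (a, ?s g)) ` {g \<in> G. ?s g = w}"
    proof (intro equalityI subsetI)
      fix x assume "x \<in> left_coset a v \<inter> right_coset w"
      then obtain g b where gb: "g \<in> G" "x = \<phi> (a, ?s g)" "b \<in> H" "x = \<phi> (b, w)"
        by (auto simp: left_coset_def right_coset_def)
      then have "?s g = w" using inj_onD[OF \<phi>_inj, of "(a, ?s g)" "(b, w)"] s av w by auto
      then show "x \<in> (\<lambda>g. \<phi> (a, ?s g)) ` {g \<in> G. ?s g = w}" using gb by auto
    next
      fix x assume "x \<in> (\<lambda>g. \<phi> (a, ?s g)) ` {g \<in> G. ?s g = w}"
      then show "x \<in> left_coset a v \<inter> right_coset w"
        using av by (auto simp: left_coset_def right_coset_def)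
    qed
    moreover have "inj_on (\<lambda>g. \<phi> (a, ?s g)) {g \<in> G. ?s g = w}"
      by (rule inj_onI) (use shift_inj[OF av] in auto)
    ultimately show ?thesis by (metis (no_types, lifting) card_image)
  qed
  then have "(\<Sum>w\<in>V. real (card (left_coset a v \<inter> right_coset w)) * x w) = (\<Sum>w\<in>V. \<Sum>g\<in>{g \<in> G. ?s g = w}. x (?s g))"
    by (intro sum.cong refl) simp
  also have "\<dots> = (\<Sum>g\<in>G. x (?s g))"
    by (rule sum.group[OF finite_G finite_V]) (use s in auto)
  finally show ?thesis using q_ge(3) by (simp add: avg_def)
qed

lemma finite_lefts: "finite ((\<lambda>(a, v). left_coset a v) ` (H \<times> V))"
  using finite_H finite_V by auto

lemma card_left_coset:
  assumes "a \<in> H" "v \<in> V" shows "card (left_coset a v) = q"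
proof -
  have "left_coset a v = \<phi> ` (\<lambda>g. (a, v \<oplus> inv a \<otimes> g)) ` G" by (simp add: left_coset_def image_image)
  also have "card \<dots> = card ((\<lambda>g. (a, v \<oplus> inv a \<otimes> g)) ` G)"
    using assms shift_V by (intro card_image inj_on_subset[OF \<phi>_inj]) auto
  also have "\<dots> = card G"
    by (rule card_image, rule inj_onI) (use shift_inj[OF assms] in auto)
  finally show ?thesis by (simp add: card_G)
qed

lemma left_fibre:
  assumes "a \<in> H" "v \<in> V"
  shows "card {z \<in> H \<times> V. left_coset (fst z) (snd z) = left_coset a v} = q"
proof -
  have "left_coset a v \<subseteq> \<phi> ` (H \<times> V)" using assms shift_V by (auto simp: left_coset_def)
  then have "left_coset a v = \<phi> ` {z \<in> H \<times> V. \<phi> z \<in> left_coset a v}" by auto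
  also have "{z \<in> H \<times> V. \<phi> z \<in> left_coset a v} = {z \<in> H \<times> V. left_coset (fst z) (snd z) = left_coset a v}"
    using left_coset_mem_iff[OF assms] by auto
  finally have "card (left_coset a v) = card {z \<in> H \<times> V. left_coset (fst z) (snd z) = left_coset a v}"
    using card_image[OF inj_on_subset[OF \<phi>_inj], of "{z \<in> H \<times> V. left_coset (fst z) (snd z) = left_coset a v}"] by auto
  then show ?thesis using card_left_coset[OF assms] by simp
qed

text \<open>Every left coset is represented by \<open>q\<close> pairs, so sums over left cosets can
  be computed on \<open>H \<times> V\<close>.\<close>

lemma sum_lefts:
  fixes F :: "('a \<Rightarrow> 'a) set \<Rightarrow> real"
  shows "real q * (\<Sum>L\<in>(\<lambda>(a, v). left_coset a v) ` (H \<times> V). F L) = (\<Sum>a\<in>H. \<Sum>v\<in>V. F (left_coset a v))"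
proof -
  let ?f = "\<lambda>z. left_coset (fst z) (snd z)"
  have img: "(\<lambda>(a, v). left_coset a v) = ?f" by auto
  have "(\<Sum>a\<in>H. \<Sum>v\<in>V. F (left_coset a v)) = (\<Sum>z\<in>H \<times> V. F (?f z))"
    by (simp add: sum.cartesian_product split_def)
  also have "\<dots> = (\<Sum>L\<in>?f ` (H \<times> V). \<Sum>z\<in>{z \<in> H \<times> V. ?f z = L}. F (?f z))"
    using finite_H finite_V by (intro sum.image_gen) auto
  also have "\<dots> = (\<Sum>L\<in>?f ` (H \<times> V). real q * F L)"
  proof (rule sum.cong[OF refl])
    fix L assume "L \<in> ?f ` (H \<times> V)"
    then obtain a v where av: "a \<in> H" "v \<in> V" "L = left_coset a v" by auto
    have "(\<Sum>z\<in>{z \<in> H \<times> V. ?f z = L}. F (?f z)) = (\<Sum>z\<in>{z \<in> H \<times> V. ?f z = L}. F L)"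
      by (intro sum.cong refl) simp
    then show "(\<Sum>z\<in>{z \<in> H \<times> V. ?f z = L}. F (?f z)) = real q * F L"
      using left_fibre[OF av(1,2)] av(3) by simp
  qed
  finally show ?thesis by (simp add: img sum_distrib_left)
qed

text \<open>With \<open>s^2 = q (q - 1)\<close> the normalized quadratic form equals
  \<open>q / s^2 = 1 / (q - 1)\<close> times the sum of the squared norms of the averages, and the
  bound \<open>(q - 1)/p\<close> on that sum leaves \<open>1/p\<close>.\<close>

lemma second_singular_value:
  "0 \<le> singular_values (biadjacency G H) ! 1"
  "singular_values (biadjacency G H) ! 1 \<le> sqrt (1 / real p)"
proof -
  define Ls where "Ls = (\<lambda>(a, v). left_coset a v) ` (H \<times> V)"
  define ls where "ls = enumeration Ls"
  define rs where "rs = enumeration (right_coset ` V)"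
  define s where "s = sqrt (real q * real (q - 1))"
  define w where "w L R = real (card (L \<inter> R)) / s" for L R :: "('a \<Rightarrow> 'a) set"
  have ls: "distinct ls" "set ls = Ls"
    using enumeration_props[OF finite_lefts] by (auto simp: ls_def Ls_def)
  have rs: "distinct rs" "set rs = right_coset ` V"
    using enumeration_props[of "right_coset ` V"] finite_V by (auto simp: rs_def)
  have "length rs = card V" using rs distinct_card[of rs] card_image[OF right_coset_inj] by simp
  also have "\<dots> \<ge> 2"
  proof -
    have "q ^ 1 \<le> q ^ m" using q_ge(3) m_ge_2 by (intro power_increasing) auto
    then show ?thesis using q_ge(3) by (simp add: card_V)
  qed
  finally have len: "2 \<le> length rs" .
  have biadj: "biadjacency G H = mat (length ls) (length rs) (\<lambda>(i, j). w (ls ! i) (rs ! j))"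
    unfolding biadjacency_def Let_def A_def[symmetric] left_rcosets right_rcosets
    by (simp add: ls_def Ls_def rs_def w_def s_def card_G card_H)
  have s2: "s * s = real q * real (q - 1)" "0 < s" using q_ge(3) by (auto simp: s_def)
  have sum_R: "(\<Sum>R\<in>set rs. w L R * x R) = (\<Sum>v\<in>V. real (card (L \<inter> right_coset v)) * x (right_coset v)) / s" for L x
    unfolding rs(2) by (subst sum.reindex[OF right_coset_inj]) (simp add: w_def sum_divide_distrib)
  have row: "(\<Sum>L\<in>set ls. w L R * (\<Sum>R'\<in>set rs. w L R')) = 1" if R: "R \<in> set rs" for R
  proof -
    obtain v where v: "v \<in> V" "R = right_coset v" using R rs(2) by auto
    have inner: "(\<Sum>R'\<in>set rs. w L R') = real q / s" if L: "L \<in> Ls" for L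
    proof -
      obtain b u where bu: "b \<in> H" "u \<in> V" "L = left_coset b u" using L by (auto simp: Ls_def)
      show ?thesis using sum_R[of L "\<lambda>_. 1"] sum_left_right[OF bu(1,2), of "\<lambda>_. 1"] bu(3) by (simp add: avg_const)
    qed
    have "real q * (\<Sum>L\<in>Ls. real (card (L \<inter> R))) = (\<Sum>a\<in>H. \<Sum>u\<in>V. real (card (left_coset a u \<inter> R)))"
      unfolding Ls_def by (rule sum_lefts)
    \<comment> \<open>The intersection with one right coset is the operator applied to a point mass.
      Averaging keeps its total mass one, so each \<open>a\<close> contributes
      \<open>q\<close>.\<close>
    also have "\<dots> = (\<Sum>a\<in>H. \<Sum>u\<in>V. real q * avg (inv a) (\<lambda>w. if w = v then 1 else 0) u)"
    proof (intro sum.cong refl)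
      fix a u assume au: "a \<in> H" "u \<in> V"
      have "real q * avg (inv a) (\<lambda>w. if w = v then 1 else 0) u
          = (\<Sum>w\<in>V. real (card (left_coset a u \<inter> right_coset w)) * (if w = v then 1 else 0))"
        by (rule sum_left_right[OF au, symmetric])
      also have "\<dots> = (\<Sum>w\<in>V. if w = v then real (card (left_coset a u \<inter> right_coset w)) else 0)"
        by (intro sum.cong) auto
      also have "\<dots> = real (card (left_coset a u \<inter> R))" using v finite_V by simp
      finally show "real (card (left_coset a u \<inter> R)) = real q * avg (inv a) (\<lambda>w. if w = v then 1 else 0) u" by simp
    qed
    also have "\<dots> = (\<Sum>a\<in>H. real q * (\<Sum>u\<in>V. avg (inv a) (\<lambda>w. if w = v then 1 else 0) u))"
      by (simp add: sum_distrib_left)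
    also have "\<dots> = (\<Sum>a\<in>H. real q)"
      using H_Units H_inv(1) v finite_V by (intro sum.cong refl) (subst sum_avg, auto)
    also have "\<dots> = real q * real (q - 1)" by (simp add: card_H)
    finally have cardsum: "(\<Sum>L\<in>Ls. real (card (L \<inter> R))) = real (q - 1)" using q_ge(3) by simp
    have "(\<Sum>L\<in>set ls. w L R * (\<Sum>R'\<in>set rs. w L R')) = (\<Sum>L\<in>Ls. real (card (L \<inter> R)) * (real q / (s * s)))"
      unfolding ls(2) by (intro sum.cong refl) (simp add: inner, simp add: w_def)
    also have "\<dots> = real (q - 1) * (real q / (s * s))" by (simp only: sum_distrib_right[symmetric] cardsum)
    also have "\<dots> = 1" unfolding s2(1) using q_ge(3) by simp
    finally show ?thesis .
  qed
  have quad: "(\<Sum>L\<in>set ls. (\<Sum>R\<in>set rs. w L R * x R)\<^sup>2) \<le> 1 / real p * (\<Sum>R\<in>set rs. (x R)\<^sup>2)"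
    if x0: "(\<Sum>R\<in>set rs. x R) = 0" for x
  proof -
    define y where "y v = x (right_coset v)" for v
    have y0: "(\<Sum>v\<in>V. y v) = 0" using x0 unfolding rs(2) y_def by (simp add: sum.reindex[OF right_coset_inj])
    have ny: "nrm y = (\<Sum>R\<in>set rs. (x R)\<^sup>2)"
      unfolding rs(2) nrm_def y_def by (simp add: sum.reindex[OF right_coset_inj])
    have "real q * (\<Sum>L\<in>set ls. (\<Sum>R\<in>set rs. w L R * x R)\<^sup>2)
        = (\<Sum>a\<in>H. \<Sum>v\<in>V. (\<Sum>R\<in>set rs. w (left_coset a v) R * x R)\<^sup>2)"
      unfolding ls(2) Ls_def by (rule sum_lefts)
    also have "\<dots> = (\<Sum>a\<in>H. \<Sum>v\<in>V. (real q * real q / (s * s)) * (avg (inv a) y v)\<^sup>2)"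
    proof (intro sum.cong refl)
      fix a v assume av: "a \<in> H" "v \<in> V"
      have "(\<Sum>R\<in>set rs. w (left_coset a v) R * x R) = real q * avg (inv a) y v / s"
        using sum_R[of "left_coset a v" x] sum_left_right[OF av, of y] by (simp add: y_def)
      then show "(\<Sum>R\<in>set rs. w (left_coset a v) R * x R)\<^sup>2 = (real q * real q / (s * s)) * (avg (inv a) y v)\<^sup>2"
        by (simp add: power2_eq_square)
    qed
    also have "\<dots> = (real q * real q / (s * s)) * (\<Sum>a\<in>H. nrm (avg (inv a) y))"
      by (simp add: nrm_def sum_distrib_left)
    also have "(\<Sum>a\<in>H. nrm (avg (inv a) y)) = (\<Sum>a\<in>H. nrm (avg a y))" by (rule sum_inv_H[of "\<lambda>a. nrm (avg a y)"])
    also have "(real q * real q / (s * s)) * \<dots> \<le> (real q * real q / (s * s)) * (real (q - 1) / real p * nrm y)"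
      by (rule mult_left_mono[OF sum_nrm_avg_le[OF y0]]) simp
    also have "\<dots> = real q * (1 / real p * nrm y)" unfolding s2(1) using q_ge(3) by simp
    finally have "real q * (\<Sum>L\<in>set ls. (\<Sum>R\<in>set rs. w L R * x R)\<^sup>2) \<le> real q * (1 / real p * nrm y)" .
    then have "(\<Sum>L\<in>set ls. (\<Sum>R\<in>set rs. w L R * x R)\<^sup>2) \<le> 1 / real p * nrm y"
      using q_ge(3) by (subst (asm) mult_le_cancel_left_pos) auto
    then show ?thesis by (simp only: ny)
  qed
  show "0 \<le> singular_values (biadjacency G H) ! 1"
    "singular_values (biadjacency G H) ! 1 \<le> sqrt (1 / real p)"
    unfolding biadj using p_ge_2
    by (intro second_singular_value_bound_sets[OF ls(1) rs(1) len _ _ row quad]; simp)+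
qed

end

section \<open>The rate\<close>

lemma digit_sum_less:
  fixes e :: "nat \<Rightarrow> nat"
  assumes "\<And>k. k < N \<Longrightarrow> e k < p"
  shows "(\<Sum>k<N. e k * p ^ k) < p ^ N"
  using assms
proof (induction N)
  case (Suc N)
  have "(\<Sum>k<Suc N. e k * p ^ k) < p ^ N + e N * p ^ N" using Suc by simp
  also have "\<dots> = Suc (e N) * p ^ N" by simp
  also have "\<dots> \<le> p * p ^ N" using Suc.prems[of N] by (intro mult_right_mono) auto
  finally show ?case by simp
qed simp

lemma digit_sum_inj:
  fixes e f :: "nat \<Rightarrow> nat"
  assumes "\<And>k. k < N \<Longrightarrow> e k < p" "\<And>k. k < N \<Longrightarrow> f k < p"
    and "(\<Sum>k<N. e k * p ^ k) = (\<Sum>k<N. f k * p ^ k)" "k < N"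
  shows "e k = f k"
  using assms
proof (induction N arbitrary: k)
  case (Suc N)
  let ?S = "\<lambda>e. \<Sum>k<N. e k * p ^ k"
  have lt: "?S e < p ^ N" "?S f < p ^ N" using Suc.prems by (auto intro!: digit_sum_less)
  have eq: "?S e + e N * p ^ N = ?S f + f N * p ^ N" using Suc.prems(3) by simp
  have "(?S e + e N * p ^ N) div p ^ N = e N" "(?S f + f N * p ^ N) div p ^ N = f N"
    using lt Suc.prems(1)[of N] by (simp_all add: div_add1_eq)
  then have N: "e N = f N" using eq by simp
  then have "?S e = ?S f" using eq by simp
  then have "\<And>k. k < N \<Longrightarrow> e k = f k" using Suc.prems(1,2) by (intro Suc.IH) auto
  then show ?case using N Suc.prems(4) by (cases "k = N") auto
qed simp

text \<open>The source of the factorial in the rate: the number of k-tuples of exponents with sum at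
  most \<open>B\<close> is at least \<open>B^k / k!\<close>.\<close>

lemma binomial_ge_power: "B ^ k \<le> fact k * ((B + k) choose k)"
proof (induction k)
  case (Suc k)
  have "B ^ Suc k \<le> (B + Suc k) * (fact k * ((B + k) choose k))"
    using mult_le_mono[OF _ Suc, of B "B + Suc k"] by simp
  also have "\<dots> = fact k * (Suc (B + k) * ((B + k) choose k))" by (simp only: mult_ac add_Suc_right)
  also have "Suc (B + k) * ((B + k) choose k) = Suc k * (Suc (B + k) choose Suc k)"
    by (metis Suc_times_binomial_eq mult.commute)
  finally show ?case by (simp only: fact_Suc mult_ac add_Suc_right of_nat_id)
qed simp

text \<open>Stars and bars on \<open>J\<close>, free choice elsewhere. As \<open>B < p\<close>, the
  bound on the sum already keeps the exponents on \<open>J\<close> in range.\<close>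

lemma card_bounded_exponents:
  fixes I J :: "nat set"
  assumes I: "finite I" and J: "J \<subseteq> I" and B: "B < p"
  shows "((B + card J) choose card J) * p ^ card (I - J) \<le> card {e \<in> I \<rightarrow>\<^sub>E {..<p}. (\<Sum>k\<in>J. e k) \<le> B}"
proof -
  let ?k = "card J"
  have finJ: "finite J" using I J finite_subset by blast
  obtain ix where ix: "bij_betw ix J {..<?k}"
    using ex_bij_betw_finite_nat[OF finJ] by (auto simp: atLeast0LessThan)
  \<comment> \<open>The additional last entry is the slack that raises the sum to exactly
    \<open>B\<close>.\<close>
  let ?Ls = "{l :: nat list. length l = Suc ?k \<and> sum_list l = B}"
  let ?Es = "(I - J) \<rightarrow>\<^sub>E {..<p}"
  let ?T = "{e \<in> I \<rightarrow>\<^sub>E {..<p}. (\<Sum>k\<in>J. e k) \<le> B}"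
  define h where "h = (\<lambda>(l, e'). \<lambda>k\<in>I. if k \<in> J then l ! ix k else e' k :: nat)"
  have sumJ: "(\<Sum>k\<in>J. l ! ix k) + l ! ?k = B" if "l \<in> ?Ls" for l :: "nat list"
  proof -
    have "(\<Sum>k\<in>J. l ! ix k) = (\<Sum>i<?k. l ! i)" using sum.reindex_bij_betw[OF ix, of "\<lambda>i. l ! i"] .
    moreover have "sum_list l = (\<Sum>i<Suc ?k. l ! i)" using that by (simp add: sum_list_sum_nth atLeast0LessThan)
    ultimately show ?thesis using that by simp
  qed
  have ixk: "ix k < ?k" if "k \<in> J" for k using that ix by (auto simp: bij_betw_def)
  have "inj_on h (?Ls \<times> ?Es)"
  proof (rule inj_onI)
    fix x y assume x: "x \<in> ?Ls \<times> ?Es" and y: "y \<in> ?Ls \<times> ?Es" and hxy: "h x = h y"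
    obtain l e l' e' where [simp]: "x = (l, e)" "y = (l', e')" by (cases x; cases y) auto
    have at: "(if k \<in> J then l ! ix k else e k) = (if k \<in> J then l' ! ix k else e' k)" if "k \<in> I" for k
      using fun_cong[OF hxy, of k] that by (simp add: h_def)
    have "l ! i = l' ! i" if i: "i < ?k" for i
    proof -
      have "i \<in> ix ` J" using i ix by (simp add: bij_betw_def)
      then obtain k where "k \<in> J" "ix k = i" by auto
      then show ?thesis using at[of k] J by auto
    qed
    moreover have "l ! ?k = l' ! ?k"
    proof -
      have "(\<Sum>k\<in>J. l ! ix k) = (\<Sum>k\<in>J. l' ! ix k)" 
      proof (rule sum.cong)
        fix k assume "k \<in> J"
        then show "l ! ix k = l' ! ix k" using at[of k] J by auto
      qed simp
      then show ?thesis using sumJ[of l] sumJ[of l'] x y by simp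
    qed
    ultimately have "l = l'" using x y by (intro nth_equalityI) (auto simp: less_Suc_eq)
    moreover have "e = e'"
    proof (rule ext)
      fix k
      show "e k = e' k"
      proof (cases "k \<in> I - J")
        case True
        then show ?thesis using at[of k] by auto
      next
        case False
        then show ?thesis using x y by (auto simp: PiE_def extensional_def)
      qed
    qed
    ultimately show "x = y" by simp
  qed
  moreover have "h ` (?Ls \<times> ?Es) \<subseteq> ?T"
  proof
    fix y assume "y \<in> h ` (?Ls \<times> ?Es)"
    then obtain l e where le: "l \<in> ?Ls" "e \<in> ?Es" "y = h (l, e)" by auto
    have yJ: "(\<Sum>k\<in>J. y k) = (\<Sum>k\<in>J. l ! ix k)"
      unfolding le(3) h_def using J by (intro sum.cong) auto
    then have yB: "(\<Sum>k\<in>J. y k) \<le> B" using sumJ[OF le(1)] by simp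
    have "y k < p" if "k \<in> I" for k
    proof (cases "k \<in> J")
      case True
      then have "y k \<le> (\<Sum>k\<in>J. y k)" using finJ by (intro member_le_sum) auto
      then show ?thesis using yB B by simp
    next
      case False
      then show ?thesis using le that by (auto simp: h_def PiE_def Pi_def)
    qed
    moreover have "y \<in> extensional I" unfolding le(3) h_def by simp
    ultimately show "y \<in> ?T" using yB by (auto simp: PiE_def)
  qed
  moreover have "finite ?T" using I by (auto intro!: finite_PiE)
  ultimately have "card (?Ls \<times> ?Es) \<le> card ?T" by (rule card_inj_on_le)
  moreover have "card ?Ls = (B + ?k) choose ?k"
    using card_length_sum_list[of "Suc ?k" B] binomial_symmetric[of ?k "B + ?k"] by simp
  moreover have "card ?Es = p ^ card (I - J)" using I by (simp add: card_PiE)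
  ultimately show ?thesis by (simp add: card_cartesian_product)
qed

text \<open>Polynomials of distinct degrees are independent. In counting form: if degree
  \<open>N\<close> occurs, adding all multiples of one such polynomial multiplies the number of
  shorter elements by the size of the field.\<close>

lemma (in field) card_ge_degrees:
  assumes fin: "finite (carrier R)" and W: "W \<subseteq> carrier (poly_ring R)" "[] \<in> W"
    and add: "\<And>f g. f \<in> W \<Longrightarrow> g \<in> W \<Longrightarrow> f \<oplus>\<^bsub>poly_ring R\<^esub> g \<in> W"
    and smult: "\<And>a f. a \<in> carrier R \<Longrightarrow> f \<in> W \<Longrightarrow> poly_of_const a \<otimes>\<^bsub>poly_ring R\<^esub> f \<in> W"
  shows "card (carrier R) ^ card {k. k < N \<and> (\<exists>f\<in>W. length f = Suc k)} \<le> card {f \<in> W. length f \<le> N}"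
proof (induction N)
  case 0
  have "{f \<in> W. length f \<le> 0} = {[]}" using W by auto
  then show ?case by simp
next
  case (Suc N)
  interpret P: domain "poly_ring R" by (rule poly_ring_domain)
  let ?D = "\<lambda>N. {k. k < N \<and> (\<exists>f\<in>W. length f = Suc k)}" and ?W = "\<lambda>N. {f \<in> W. length f \<le> N}"
  have finW: "finite (?W N)" for N
    by (rule finite_subset[OF _ card_low_polys_le(1)[OF fin, of N]]) (use W in auto)
  show ?case
  proof (cases "\<exists>f\<in>W. length f = Suc N")
    case False
    then have "?D (Suc N) = ?D N" using less_Suc_eq by auto
    moreover have "card (?W N) \<le> card (?W (Suc N))" by (rule card_mono[OF finW]) auto
    ultimately show ?thesis using Suc by simp
  next
    case True
    then obtain f0 where f0: "f0 \<in> W" "length f0 = Suc N" by auto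
    have f0P: "f0 \<in> carrier (poly_ring R)" using f0 W by auto
    have D: "?D (Suc N) = insert N (?D N)" using True less_Suc_eq by auto
    let ?h = "\<lambda>(a, f). poly_of_const a \<otimes>\<^bsub>poly_ring R\<^esub> f0 \<oplus>\<^bsub>poly_ring R\<^esub> f"
    have "f0 \<noteq> []" using f0 by auto
    then have lead: "coeff f0 N \<noteq> \<zero>" "coeff f0 N \<in> carrier R"
      using lead_coeff_simp[of f0] f0 f0P univ_poly_carrier[of R "carrier R" f0] by (auto simp: polynomial_def)
    have "inj_on ?h (carrier R \<times> ?W N)"
    proof (rule inj_onI)
      fix x y assume x: "x \<in> carrier R \<times> ?W N" and y: "y \<in> carrier R \<times> ?W N" and hxy: "?h x = ?h y"
      obtain a f b g where [simp]: "x = (a, f)" "y = (b, g)" by (cases x; cases y) auto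
      have R: "a \<in> carrier R" "b \<in> carrier R" "f \<in> carrier (poly_ring R)" "g \<in> carrier (poly_ring R)"
        "length f \<le> N" "length g \<le> N"
        using x y W by auto
      \<comment> \<open>The second summands are too short to reach coefficient \<open>N\<close>, so
        this coefficient determines the scalar.\<close>
      have "coeff (?h x) N = a \<otimes> coeff f0 N" "coeff (?h y) N = b \<otimes> coeff f0 N"
        using R f0P lead coeff_length[OF R(5)] coeff_length[OF R(6)] by (simp_all add: coeff_add coeff_const_mult)
      then have "a \<otimes> coeff f0 N = b \<otimes> coeff f0 N" using hxy by simp
      then have "a = b" using m_rcancel[OF lead R(1,2)] by simp
      then have "f = g" using hxy R f0P P.add.l_cancel[of "poly_of_const b \<otimes>\<^bsub>poly_ring R\<^esub> f0" f g] by simp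
      then show "x = y" using \<open>a = b\<close> by simp
    qed
    moreover have "?h ` (carrier R \<times> ?W N) \<subseteq> ?W (Suc N)"
    proof
      fix y assume "y \<in> ?h ` (carrier R \<times> ?W N)"
      then obtain a f where af: "a \<in> carrier R" "f \<in> W" "length f \<le> N" "y = ?h (a, f)" by auto
      have "length (poly_of_const a \<otimes>\<^bsub>poly_ring R\<^esub> f0) \<le> Suc N"
        using length_mult_le[of "poly_of_const a" f0] length_poly_of_const_le[of a] af(1) f0 f0P by simp
      then have "length y \<le> Suc N"
        using length_add_le[of "poly_of_const a \<otimes>\<^bsub>poly_ring R\<^esub> f0" f] af by simp
      moreover have "y \<in> W" using af add[OF smult[OF af(1) f0(1)] af(2)] by simp
      ultimately show "y \<in> ?W (Suc N)" by simp
    qed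
    ultimately have "card (carrier R \<times> ?W N) \<le> card (?W (Suc N))" using finW by (intro card_inj_on_le)
    then have "card (carrier R) * card (?W N) \<le> card (?W (Suc N))" by (simp add: card_cartesian_product)
    moreover have "card (carrier R) ^ card (?D (Suc N)) = card (carrier R) * card (carrier R) ^ card (?D N)"
      unfolding D by simp
    ultimately show ?thesis using mult_le_mono2[OF Suc, of "card (carrier R)"] by linarith
  qed
qed

section \<open>Polynomials that are cheap in both bases, and their number\<close>

context coset_code_setup_ge2
begin

text \<open>\<open>tau_poly j\<close> is \<open>(1 + \<tau>)\<^sup>j\<close> applied to \<open>X\<close>, where \<open>\<tau>\<close> is the \<open>q\<close>-th power map. It is a combination of the
  \<open>\<tau>\<^sup>a X\<close>, which are congruent to \<open>X\<close> for base \<open>h\<close>; modulo \<open>g\<close> it is \<open>\<plusminus>\<close> the \<open>j\<close>-th power of the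
  Frobenius map applied to \<open>X\<close>. So both of its base degrees are small.\<close>

fun tau_poly :: "nat \<Rightarrow> 'a list" where
  "tau_poly 0 = X"
| "tau_poly (Suc j) = tau_poly j [^]\<^bsub>poly_ring R\<^esub> q \<oplus>\<^bsub>poly_ring R\<^esub> tau_poly j"

lemma tau_poly_closed [simp]: "tau_poly j \<in> carrier (poly_ring R)"
  by (induction j) auto

lemma length_pow:
  assumes "f \<in> carrier (poly_ring R)" "length f = Suc d"
  shows "length (f [^]\<^bsub>poly_ring R\<^esub> (n::nat)) = Suc (n * d)"
proof -
  have "f [^]\<^bsub>poly_ring R\<^esub> n \<noteq> []" using assms by (intro polynomial_pow_not_zero) auto
  then have "0 < length (f [^]\<^bsub>poly_ring R\<^esub> n)" by simp
  moreover have "Polynomials.degree (f [^]\<^bsub>poly_ring R\<^esub> n) = n * d"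
    using polynomial_pow_degree[OF assms(1), of n] assms(2) by simp
  ultimately show ?thesis by linarith
qed

lemma length_tau_poly: "length (tau_poly j) = Suc (q ^ j)"
proof (induction j)
  case 0
  then show ?case by (simp add: var_def)
next
  case (Suc j)
  have "length (tau_poly j [^]\<^bsub>poly_ring R\<^esub> q) = Suc (q * q ^ j)" by (rule length_pow[OF _ Suc]) simp
  moreover have "q ^ j < q * q ^ j" using q_ge(3) by simp
  ultimately show ?case using Suc by (simp add: length_add_lt)
qed

lemma poly_Frobenius:
  "f \<in> carrier (poly_ring R) \<Longrightarrow> g \<in> carrier (poly_ring R) \<Longrightarrow>
    (f \<oplus>\<^bsub>poly_ring R\<^esub> g) [^]\<^bsub>poly_ring R\<^esub> (p ^ k) = f [^]\<^bsub>poly_ring R\<^esub> (p ^ k) \<oplus>\<^bsub>poly_ring R\<^esub> g [^]\<^bsub>poly_ring R\<^esub> (p ^ k)"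
  using cring.frobenius_pow_add[OF domain.axioms(1)[OF poly_ring_domain] p_prime poly_ring_char] .

lemma poly_Frobenius_minus:
  "f \<in> carrier (poly_ring R) \<Longrightarrow> g \<in> carrier (poly_ring R) \<Longrightarrow>
    (f \<ominus>\<^bsub>poly_ring R\<^esub> g) [^]\<^bsub>poly_ring R\<^esub> (p ^ k) = f [^]\<^bsub>poly_ring R\<^esub> (p ^ k) \<ominus>\<^bsub>poly_ring R\<^esub> g [^]\<^bsub>poly_ring R\<^esub> (p ^ k)"
  using cring.frobenius_pow_minus[OF domain.axioms(1)[OF poly_ring_domain] p_prime poly_ring_char] .

lemma poly_pow_pow:
  assumes "f \<in> carrier (poly_ring R)"
  shows "(f [^]\<^bsub>poly_ring R\<^esub> (a::nat)) [^]\<^bsub>poly_ring R\<^esub> (b::nat) = f [^]\<^bsub>poly_ring R\<^esub> (a * b)"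
proof -
  interpret P: domain "poly_ring R" by (rule poly_ring_domain)
  show ?thesis using assms by (rule P.nat_pow_pow)
qed

text \<open>\<open>q\<close> is one modulo \<open>q - 1\<close>. Since \<open>h\<close> is the
  monomial of degree \<open>q - 1\<close>, raising a power of \<open>X\<close> to the
  \<open>q\<close>-th power costs nothing in base \<open>h\<close>.\<close>

lemma exponent_mod_q1: "\<exists>k. p ^ i * q ^ a = p ^ i + (q - 1) * k"
proof (induction a)
  case (Suc a)
  then obtain k where k: "p ^ i * q ^ a = p ^ i + (q - 1) * k" by auto
  have "p ^ i * q ^ Suc a = q * (p ^ i * q ^ a)" by simp
  also have "\<dots> = (1 + (q - 1)) * (p ^ i + (q - 1) * k)" using k q_ge(3) by simp
  also have "\<dots> = p ^ i + (q - 1) * (p ^ i + k + (q - 1) * k)" by (simp add: algebra_simps)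
  finally show ?case by blast
qed auto

lemma X_pow_h_bounded: "X [^]\<^bsub>poly_ring R\<^esub> (p ^ i * q ^ a) \<in> bounded_base (h_poly H) (p ^ i)"
proof -
  interpret P: domain "poly_ring R" by (rule poly_ring_domain)
  obtain k where k: "p ^ i * q ^ a = p ^ i + (q - 1) * k" using exponent_mod_q1 by blast
  have "X [^]\<^bsub>poly_ring R\<^esub> (p ^ i * q ^ a) = X [^]\<^bsub>poly_ring R\<^esub> (p ^ i) \<otimes>\<^bsub>poly_ring R\<^esub> h_poly H [^]\<^bsub>poly_ring R\<^esub> k"
    unfolding k h_poly_def card_H by (simp add: P.nat_pow_mult poly_pow_pow)
  also have "\<dots> \<in> bounded_base (h_poly H) (p ^ i + 0)"
    by (intro bounded_base_mult bounded_base_low pow_u_bounded_base) (auto simp: length_X_pow)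
  finally show ?thesis by simp
qed

text \<open>The statement is for all \<open>a\<close> because one step in \<open>j\<close> raises
  the exponent by a factor \<open>q\<close>. The exponent is a power of p, so it distributes over
  the sum that defines \<open>tau_poly\<close>.\<close>

lemma tau_pow_h_bounded:
  "tau_poly j [^]\<^bsub>poly_ring R\<^esub> (p ^ i * q ^ a) \<in> bounded_base (h_poly H) (p ^ i)"
proof (induction j arbitrary: a)
  case 0
  then show ?case using X_pow_h_bounded by simp
next
  case (Suc j)
  have e: "p ^ i * q ^ a = p ^ (i + m * a)" by (simp add: q_def power_add power_mult)
  have "tau_poly (Suc j) [^]\<^bsub>poly_ring R\<^esub> (p ^ i * q ^ a)
    = (tau_poly j [^]\<^bsub>poly_ring R\<^esub> q) [^]\<^bsub>poly_ring R\<^esub> (p ^ i * q ^ a) \<oplus>\<^bsub>poly_ring R\<^esub> tau_poly j [^]\<^bsub>poly_ring R\<^esub> (p ^ i * q ^ a)"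
    unfolding e by (simp add: poly_Frobenius)
  also have "(tau_poly j [^]\<^bsub>poly_ring R\<^esub> q) [^]\<^bsub>poly_ring R\<^esub> (p ^ i * q ^ a) = tau_poly j [^]\<^bsub>poly_ring R\<^esub> (p ^ i * q ^ Suc a)"
    by (simp add: poly_pow_pow mult_ac)
  finally show ?case using bounded_base_add[OF h_poly_closed Suc[of "Suc a"] Suc[of a]] by simp
qed

lemma X_q_eq: "X [^]\<^bsub>poly_ring R\<^esub> q = g_poly p m \<ominus>\<^bsub>poly_ring R\<^esub> X [^]\<^bsub>poly_ring R\<^esub> p \<ominus>\<^bsub>poly_ring R\<^esub> X"
  and X_q_add: "X [^]\<^bsub>poly_ring R\<^esub> q \<oplus>\<^bsub>poly_ring R\<^esub> X = g_poly p m \<ominus>\<^bsub>poly_ring R\<^esub> X [^]\<^bsub>poly_ring R\<^esub> p"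
proof -
  interpret P: domain "poly_ring R" by (rule poly_ring_domain)
  have 1: "u = u \<oplus>\<^bsub>poly_ring R\<^esub> v \<oplus>\<^bsub>poly_ring R\<^esub> w \<ominus>\<^bsub>poly_ring R\<^esub> v \<ominus>\<^bsub>poly_ring R\<^esub> w"
    "u \<oplus>\<^bsub>poly_ring R\<^esub> w = u \<oplus>\<^bsub>poly_ring R\<^esub> v \<oplus>\<^bsub>poly_ring R\<^esub> w \<ominus>\<^bsub>poly_ring R\<^esub> v"
    if "u \<in> carrier (poly_ring R)" "v \<in> carrier (poly_ring R)" "w \<in> carrier (poly_ring R)" for u v w
    using that by algebra+
  show "X [^]\<^bsub>poly_ring R\<^esub> q = g_poly p m \<ominus>\<^bsub>poly_ring R\<^esub> X [^]\<^bsub>poly_ring R\<^esub> p \<ominus>\<^bsub>poly_ring R\<^esub> X"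
    "X [^]\<^bsub>poly_ring R\<^esub> q \<oplus>\<^bsub>poly_ring R\<^esub> X = g_poly p m \<ominus>\<^bsub>poly_ring R\<^esub> X [^]\<^bsub>poly_ring R\<^esub> p"
    unfolding g_poly_def q_def by (rule 1; simp)+
qed

text \<open>By the definition of \<open>g\<close>, \<open>X^q + X = g - X^p\<close>, so each factor
  \<open>1 + \<tau>\<close> advances the Frobenius power by one and changes the sign. What is
  discarded consists of powers of \<open>g\<close> and has base degree at most 0. The induction
  needs the hypothesis at both \<open>i\<close> and \<open>i + m\<close>.\<close>

lemma tau_pow_mod_g:
  "\<exists>z \<in> bounded_base (g_poly p m) 0. tau_poly j [^]\<^bsub>poly_ring R\<^esub> (p ^ i)
    = (\<ominus>\<^bsub>poly_ring R\<^esub> \<one>\<^bsub>poly_ring R\<^esub>) [^]\<^bsub>poly_ring R\<^esub> j \<otimes>\<^bsub>poly_ring R\<^esub> X [^]\<^bsub>poly_ring R\<^esub> (p ^ (i + j)) \<oplus>\<^bsub>poly_ring R\<^esub> z"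
proof (induction j arbitrary: i)
  case 0
  then show ?case using Nil_bounded_base[OF g_poly_closed]
    by (intro bexI[of _ "[]"]) (auto simp: poly_ring_simps(2) monoid.l_one[OF univ_poly_is_monoid[OF carrier_is_subring], unfolded poly_ring_simps(2)])
next
  case (Suc j)
  interpret P: domain "poly_ring R" by (rule poly_ring_domain)
  let ?c = "(\<ominus>\<^bsub>poly_ring R\<^esub> \<one>\<^bsub>poly_ring R\<^esub>) [^]\<^bsub>poly_ring R\<^esub> j" and ?B = "bounded_base (g_poly p m) 0"
  let ?X = "\<lambda>k. X [^]\<^bsub>poly_ring R\<^esub> (p ^ k)" and ?G = "g_poly p m [^]\<^bsub>poly_ring R\<^esub> (p ^ (i + j))"
  obtain y z where y: "y \<in> ?B" "tau_poly j [^]\<^bsub>poly_ring R\<^esub> (p ^ (i + m)) = ?c \<otimes>\<^bsub>poly_ring R\<^esub> ?X (i + m + j) \<oplus>\<^bsub>poly_ring R\<^esub> y"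
    and z: "z \<in> ?B" "tau_poly j [^]\<^bsub>poly_ring R\<^esub> (p ^ i) = ?c \<otimes>\<^bsub>poly_ring R\<^esub> ?X (i + j) \<oplus>\<^bsub>poly_ring R\<^esub> z"
    using Suc.IH[of "i + m"] Suc.IH[of i] by blast
  have c: "?c \<in> carrier (poly_ring R)" by simp
  have one_B: "\<one>\<^bsub>poly_ring R\<^esub> \<in> ?B" using bounded_base_low[OF g_poly_closed, of "\<one>\<^bsub>poly_ring R\<^esub>" 0] by (simp add: poly_ring_simps(2))
  have cB: "?c \<in> ?B" using bounded_base_pow[OF g_poly_closed bounded_base_minus[OF g_poly_closed one_B], of j] by simp
  have yz: "y \<in> carrier (poly_ring R)" "z \<in> carrier (poly_ring R)"
    using y z bounded_base_closed[OF g_poly_closed] by auto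
  have "?X (i + m + j) = (X [^]\<^bsub>poly_ring R\<^esub> q) [^]\<^bsub>poly_ring R\<^esub> (p ^ (i + j))"
    by (simp add: poly_pow_pow q_def power_add mult_ac)
  then have "?X (i + m + j) \<oplus>\<^bsub>poly_ring R\<^esub> ?X (i + j) = (X [^]\<^bsub>poly_ring R\<^esub> q \<oplus>\<^bsub>poly_ring R\<^esub> X) [^]\<^bsub>poly_ring R\<^esub> (p ^ (i + j))"
    by (simp add: poly_Frobenius)
  also have "\<dots> = ?G \<ominus>\<^bsub>poly_ring R\<^esub> ?X (i + Suc j)"
    unfolding X_q_add by (simp add: poly_Frobenius_minus poly_pow_pow mult_ac)
  finally have XX: "?X (i + m + j) \<oplus>\<^bsub>poly_ring R\<^esub> ?X (i + j) = ?G \<ominus>\<^bsub>poly_ring R\<^esub> ?X (i + Suc j)" .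
  have rearr: "(c \<otimes>\<^bsub>poly_ring R\<^esub> u \<oplus>\<^bsub>poly_ring R\<^esub> y) \<oplus>\<^bsub>poly_ring R\<^esub> (c \<otimes>\<^bsub>poly_ring R\<^esub> v \<oplus>\<^bsub>poly_ring R\<^esub> z)
     = (c \<otimes>\<^bsub>poly_ring R\<^esub> \<ominus>\<^bsub>poly_ring R\<^esub> \<one>\<^bsub>poly_ring R\<^esub>) \<otimes>\<^bsub>poly_ring R\<^esub> w \<oplus>\<^bsub>poly_ring R\<^esub> (c \<otimes>\<^bsub>poly_ring R\<^esub> t \<oplus>\<^bsub>poly_ring R\<^esub> (y \<oplus>\<^bsub>poly_ring R\<^esub> z))"
    if "{c, u, v, w, t, y, z} \<subseteq> carrier (poly_ring R)" "u \<oplus>\<^bsub>poly_ring R\<^esub> v = t \<ominus>\<^bsub>poly_ring R\<^esub> w" for c u v w t y z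
  proof -
    have "(c \<otimes>\<^bsub>poly_ring R\<^esub> u \<oplus>\<^bsub>poly_ring R\<^esub> y) \<oplus>\<^bsub>poly_ring R\<^esub> (c \<otimes>\<^bsub>poly_ring R\<^esub> v \<oplus>\<^bsub>poly_ring R\<^esub> z)
      = c \<otimes>\<^bsub>poly_ring R\<^esub> (u \<oplus>\<^bsub>poly_ring R\<^esub> v) \<oplus>\<^bsub>poly_ring R\<^esub> (y \<oplus>\<^bsub>poly_ring R\<^esub> z)"
      using that(1) by (simp add: P.r_distr P.a_ac)
    also have "\<dots> = (c \<otimes>\<^bsub>poly_ring R\<^esub> \<ominus>\<^bsub>poly_ring R\<^esub> \<one>\<^bsub>poly_ring R\<^esub>) \<otimes>\<^bsub>poly_ring R\<^esub> w \<oplus>\<^bsub>poly_ring R\<^esub> (c \<otimes>\<^bsub>poly_ring R\<^esub> t \<oplus>\<^bsub>poly_ring R\<^esub> (y \<oplus>\<^bsub>poly_ring R\<^esub> z))"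
      unfolding that(2) using that(1) by (simp add: a_minus_def P.r_distr P.a_ac P.r_minus P.l_minus)
    finally show ?thesis .
  qed
  have "tau_poly (Suc j) [^]\<^bsub>poly_ring R\<^esub> (p ^ i)
      = tau_poly j [^]\<^bsub>poly_ring R\<^esub> (p ^ (i + m)) \<oplus>\<^bsub>poly_ring R\<^esub> tau_poly j [^]\<^bsub>poly_ring R\<^esub> (p ^ i)"
    by (simp add: poly_Frobenius poly_pow_pow q_def power_add mult_ac)
  also have "\<dots> = (?c \<otimes>\<^bsub>poly_ring R\<^esub> \<ominus>\<^bsub>poly_ring R\<^esub> \<one>\<^bsub>poly_ring R\<^esub>) \<otimes>\<^bsub>poly_ring R\<^esub> ?X (i + Suc j)
      \<oplus>\<^bsub>poly_ring R\<^esub> (?c \<otimes>\<^bsub>poly_ring R\<^esub> ?G \<oplus>\<^bsub>poly_ring R\<^esub> (y \<oplus>\<^bsub>poly_ring R\<^esub> z))"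
    unfolding y(2) z(2) using yz by (intro rearr[OF _ XX]) simp
  finally have eq: "tau_poly (Suc j) [^]\<^bsub>poly_ring R\<^esub> (p ^ i) = (\<ominus>\<^bsub>poly_ring R\<^esub> \<one>\<^bsub>poly_ring R\<^esub>) [^]\<^bsub>poly_ring R\<^esub> Suc j \<otimes>\<^bsub>poly_ring R\<^esub> ?X (i + Suc j)
      \<oplus>\<^bsub>poly_ring R\<^esub> (?c \<otimes>\<^bsub>poly_ring R\<^esub> ?G \<oplus>\<^bsub>poly_ring R\<^esub> (y \<oplus>\<^bsub>poly_ring R\<^esub> z))"
    by simp
  have "?c \<otimes>\<^bsub>poly_ring R\<^esub> ?G \<oplus>\<^bsub>poly_ring R\<^esub> (y \<oplus>\<^bsub>poly_ring R\<^esub> z) \<in> ?B"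
    using bounded_base_mult[OF g_poly_closed cB pow_u_bounded_base[OF g_poly_closed, of "p ^ (i + j)"]] y z
    by (intro bounded_base_add) auto
  then show ?case using eq by blast
qed

text \<open>The exponent of the base-\<open>g\<close> cost of \<open>X^(p^k)\<close>. Below m
  nothing is reduced. For k = m + i the power is replaced by those with exponents i + 1 and i, up to
  a power of \<open>g\<close>. At k = 2m - 1 the exponent i + 1 equals m and is reduced once more,
  which leaves m - 1.\<close>

definition gexp :: "nat \<Rightarrow> nat" where
  "gexp k = (if k < m then k else if k = 2 * m - 1 then m - 1 else k - m + 1)"

lemma X_pow_low: "k < m \<Longrightarrow> X [^]\<^bsub>poly_ring R\<^esub> (p ^ k) \<in> bounded_base (g_poly p m) (p ^ k)"
  by (intro bounded_base_low) (auto simp: length_X_pow)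

lemma X_pow_g_bounded:
  assumes k: "k \<le> 2 * m - 1"
  shows "X [^]\<^bsub>poly_ring R\<^esub> (p ^ k) \<in> bounded_base (g_poly p m) (p ^ gexp k)"
proof (cases "k < m")
  case True
  then show ?thesis using X_pow_low by (simp add: gexp_def)
next
  case False
  let ?X = "\<lambda>k. X [^]\<^bsub>poly_ring R\<^esub> (p ^ k)" and ?B = "bounded_base (g_poly p m)"
  have reduce: "?X (m + i) \<in> ?B d" if "?X (Suc i) \<in> ?B d" "?X i \<in> ?B d" for i d
  proof -
    have "?X (m + i) = (X [^]\<^bsub>poly_ring R\<^esub> q) [^]\<^bsub>poly_ring R\<^esub> (p ^ i)"
      by (simp add: poly_pow_pow q_def power_add)
    also have "\<dots> = g_poly p m [^]\<^bsub>poly_ring R\<^esub> (p ^ i) \<ominus>\<^bsub>poly_ring R\<^esub> ?X (Suc i) \<ominus>\<^bsub>poly_ring R\<^esub> ?X i"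
      unfolding X_q_eq by (simp add: poly_Frobenius_minus poly_pow_pow)
    also have "\<dots> \<in> ?B d"
      unfolding a_minus_def using that
      by (intro bounded_base_add bounded_base_minus bounded_base_mono[OF g_poly_closed pow_u_bounded_base[OF g_poly_closed]]) auto
    finally show ?thesis .
  qed
  have mono: "?X i \<in> ?B (p ^ d)" if "i < m" "i \<le> d" for i d
    using bounded_base_mono[OF g_poly_closed X_pow_low[OF that(1)] power_increasing[OF that(2)]] p_ge_2 by simp
  obtain i where i: "k = m + i" using False by (metis le_add_diff_inverse linorder_not_less)
  show ?thesis
  proof (cases "Suc i < m")
    case True
    then have "gexp k = Suc i" using i by (auto simp: gexp_def)
    then show ?thesis unfolding i using reduce[of i "p ^ Suc i"] mono[of i "Suc i"] mono[of "Suc i" "Suc i"] True i by simp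
  next
    case False
    then have i': "Suc i = m" "i = m - 1" using k i m_ge_2 by auto
    then have g: "gexp k = m - 1" using i by (auto simp: gexp_def)
    \<comment> \<open>The second reduction in the extreme case: it leaves exponents 1 and 0, both at
      most m - 1 because m is at least 2.\<close>
    have "?X (m + 0) \<in> ?B (p ^ (m - 1))"
      using m_ge_2 by (intro reduce mono) auto
    then have 1: "?X (Suc i) \<in> ?B (p ^ (m - 1))" using i'(1) by simp
    have 2: "?X i \<in> ?B (p ^ (m - 1))" using m_ge_2 i' by (intro mono) auto
    show ?thesis using reduce[OF 1 2] unfolding g i by (simp only: g[unfolded i])
  qed
qed

lemma tau_pow_g_bounded:
  assumes "i < m" "j \<le> m"
  shows "tau_poly j [^]\<^bsub>poly_ring R\<^esub> (p ^ i) \<in> bounded_base (g_poly p m) (p ^ gexp (i + j))"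
proof -
  let ?B = "bounded_base (g_poly p m)"
  obtain z where z: "z \<in> ?B 0" "tau_poly j [^]\<^bsub>poly_ring R\<^esub> (p ^ i)
    = (\<ominus>\<^bsub>poly_ring R\<^esub> \<one>\<^bsub>poly_ring R\<^esub>) [^]\<^bsub>poly_ring R\<^esub> j \<otimes>\<^bsub>poly_ring R\<^esub> X [^]\<^bsub>poly_ring R\<^esub> (p ^ (i + j)) \<oplus>\<^bsub>poly_ring R\<^esub> z"
    using tau_pow_mod_g[of j i] by blast
  have one_B: "\<one>\<^bsub>poly_ring R\<^esub> \<in> ?B 0"
    using bounded_base_low[OF g_poly_closed, of "\<one>\<^bsub>poly_ring R\<^esub>" 0] by (simp add: poly_ring_simps(2))
  have "(\<ominus>\<^bsub>poly_ring R\<^esub> \<one>\<^bsub>poly_ring R\<^esub>) [^]\<^bsub>poly_ring R\<^esub> j \<in> ?B 0"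
    using bounded_base_pow[OF g_poly_closed bounded_base_minus[OF g_poly_closed one_B], of j] by simp
  moreover have "X [^]\<^bsub>poly_ring R\<^esub> (p ^ (i + j)) \<in> ?B (p ^ gexp (i + j))"
    using assms by (intro X_pow_g_bounded) auto
  ultimately have "(\<ominus>\<^bsub>poly_ring R\<^esub> \<one>\<^bsub>poly_ring R\<^esub>) [^]\<^bsub>poly_ring R\<^esub> j \<otimes>\<^bsub>poly_ring R\<^esub> X [^]\<^bsub>poly_ring R\<^esub> (p ^ (i + j)) \<in> ?B (0 + p ^ gexp (i + j))"
    by (rule bounded_base_mult[OF g_poly_closed])
  then show ?thesis unfolding z(2)
    using bounded_base_mono[OF g_poly_closed z(1)] by (intro bounded_base_add) auto
qed

text \<open>The pair (i, j) is coded as k = j m + i; the degree is then \<open>p^k\<close>. Products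
  with exponents below p thus have the exponents as base-p digits of their degree.\<close>

definition lin_poly :: "nat \<Rightarrow> 'a list" where
  "lin_poly k = tau_poly (k div m) [^]\<^bsub>poly_ring R\<^esub> (p ^ (k mod m))"

definition prod_poly :: "(nat \<Rightarrow> nat) \<Rightarrow> nat \<Rightarrow> 'a list" where
  "prod_poly e N = rec_nat [\<one>] (\<lambda>k f. f \<otimes>\<^bsub>poly_ring R\<^esub> lin_poly k [^]\<^bsub>poly_ring R\<^esub> e k) N"

lemma prod_poly_simps:
  "prod_poly e 0 = [\<one>]"
  "prod_poly e (Suc k) = prod_poly e k \<otimes>\<^bsub>poly_ring R\<^esub> lin_poly k [^]\<^bsub>poly_ring R\<^esub> e k"
  by (simp_all add: prod_poly_def)

lemma lin_poly_closed [simp]: "lin_poly k \<in> carrier (poly_ring R)" by (simp add: lin_poly_def)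

lemma prod_poly_closed [simp]: "prod_poly e N \<in> carrier (poly_ring R)"
  by (induction N) (auto simp: prod_poly_simps)

lemma length_lin_poly: "length (lin_poly k) = Suc (p ^ k)"
proof -
  have "p ^ (k mod m) * q ^ (k div m) = p ^ (k mod m + m * (k div m))" by (simp only: q_def power_add power_mult)
  also have "k mod m + m * (k div m) = k" by simp
  finally show ?thesis using length_pow[OF tau_poly_closed length_tau_poly] by (simp add: lin_poly_def)
qed

lemma length_prod_poly: "length (prod_poly e N) = Suc (\<Sum>k<N. e k * p ^ k)"
proof (induction N)
  case (Suc N)
  have "length (lin_poly N [^]\<^bsub>poly_ring R\<^esub> e N) = Suc (e N * p ^ N)"
    by (rule length_pow[OF lin_poly_closed length_lin_poly])
  then show ?case
    using Suc length_mult(1)[of "prod_poly e N" "lin_poly N [^]\<^bsub>poly_ring R\<^esub> e N"]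
    by (force simp: prod_poly_simps)
qed (simp add: prod_poly_simps)

lemma prod_poly_bounded:
  assumes u: "u \<in> carrier (poly_ring R)" and "\<And>k. k < N \<Longrightarrow> lin_poly k \<in> bounded_base u (d k)"
  shows "prod_poly e N \<in> bounded_base u (\<Sum>k<N. e k * d k)"
  using assms(2)
proof (induction N)
  case 0
  then show ?case using bounded_base_low[OF u, of "[\<one>]" 0] by (simp add: prod_poly_simps)
next
  case (Suc N)
  then show ?case
    using bounded_base_mult[OF u _ bounded_base_pow[OF u]] by (simp add: prod_poly_simps)
qed

text \<open>The indices whose cost reaches \<open>p^(m-1)\<close> in base \<open>h\<close> (i = m -
  1) or in base \<open>g\<close> (i + j among m - 1, 2m - 2 and 2m - 1). Apart from pairs with i = m
  - 1, the last two sums leave only i = m - 2 and j = m.\<close>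

definition dom_idx :: "nat set" where
  "dom_idx = {k. k < m * (m + 1) \<and> (k mod m = m - 1 \<or> k mod m + k div m = m - 1 \<or> k = m * m + (m - 2))}"

lemma card_dom_idx: "card dom_idx = 2 * m + 1"
proof -
  \<comment> \<open>The m + 1 pairs with i = m - 1, the m - 1 pairs with i + j = m - 1 and smaller
    i, and the isolated pair (m - 2, m).\<close>
  let ?A = "(\<lambda>j. j * m + (m - 1)) ` {..m}" and ?B = "(\<lambda>i. (m - 1 - i) * m + i) ` {..<m - 1}" and ?c = "m * m + (m - 2)"
  have dm: "(j * m + i) mod m = i" "(j * m + i) div m = j" if "i < m" for i j
    using that by auto
  have lt: "j * m + i < m * (m + 1)" if "i < m" "j \<le> m" for i j
  proof -
    have "j * m + i < j * m + m" using that by simp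
    also have "\<dots> = (j + 1) * m" by simp
    also have "\<dots> \<le> (m + 1) * m" using that by (intro mult_right_mono) auto
    finally show ?thesis by (simp add: mult.commute)
  qed
  have eq: "dom_idx = insert ?c (?A \<union> ?B)"
  proof (intro equalityI subsetI)
    fix k assume "k \<in> dom_idx"
    then have k: "k < m * (m + 1)" "k mod m = m - 1 \<or> k mod m + k div m = m - 1 \<or> k = ?c" by (auto simp: dom_idx_def)
    have kk: "k = (k div m) * m + k mod m" by simp
    have "k div m < m + 1" using k(1) by (intro less_mult_imp_div_less) (simp add: mult.commute)
    then have dl: "k div m \<le> m" by simp
    consider "k mod m = m - 1" | "k mod m \<noteq> m - 1" "k mod m + k div m = m - 1" | "k = ?c" using k(2) by auto
    then show "k \<in> insert ?c (?A \<union> ?B)"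
    proof cases
      case 1
      then have "k = (k div m) * m + (m - 1)" using kk by simp
      then show ?thesis using dl by blast
    next
      case 2
      have "k mod m < m" using m_ge_2 by simp
      then have "k mod m < m - 1" "k div m = m - 1 - k mod m" using 2 by auto
      then have "k = (m - 1 - k mod m) * m + k mod m" using kk by simp
      then show ?thesis using \<open>k mod m < m - 1\<close> by blast
    next
      case 3
      then show ?thesis by simp
    qed
  next
    fix k assume "k \<in> insert ?c (?A \<union> ?B)"
    then consider "k = ?c" | j where "j \<le> m" "k = j * m + (m - 1)" | i where "i < m - 1" "k = (m - 1 - i) * m + i" by auto
    then show "k \<in> dom_idx"
    proof cases
      case 1
      then show ?thesis using lt[of "m - 2" m] m_ge_2 by (simp add: dom_idx_def)
    next
      case 2
      then show ?thesis using lt[of "m - 1" j] dm[of "m - 1" j] m_ge_2 by (simp add: dom_idx_def)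
    next
      case 3
      then show ?thesis using lt[of i "m - 1 - i"] dm[of i "m - 1 - i"] by (simp add: dom_idx_def)
    qed
  qed
  have injA: "inj_on (\<lambda>j. j * m + (m - 1)) {..m}" 
  proof (rule inj_onI)
    fix x y assume "x * m + (m - 1) = y * m + (m - 1)"
    then show "x = y" using dm(2)[of "m - 1" x] dm(2)[of "m - 1" y] m_ge_2 by simp
  qed
  have injB: "inj_on (\<lambda>i. (m - 1 - i) * m + i) {..<m - 1}"
  proof (rule inj_onI)
    fix x y assume xy: "x \<in> {..<m - 1}" "y \<in> {..<m - 1}" "(m - 1 - x) * m + x = (m - 1 - y) * m + y"
    have "((m - 1 - x) * m + x) mod m = x" "((m - 1 - y) * m + y) mod m = y"
      by (rule dm(1), use xy in simp)+
    then show "x = y" using xy(3) by metis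
  qed
  have disj: "?A \<inter> ?B = {}"
  proof -
    have "j * m + (m - 1) \<noteq> (m - 1 - i) * m + i" if "i < m - 1" for i j
    proof -
      have "(j * m + (m - 1)) mod m = m - 1" "((m - 1 - i) * m + i) mod m = i"
        by (rule dm(1), use that m_ge_2 in simp)+
      then show ?thesis using that by (metis less_irrefl)
    qed
    then show ?thesis by blast
  qed
  have c: "?c \<notin> ?A \<union> ?B"
  proof -
    have "m * m + (m - 2) \<noteq> j * m + (m - 1)" for j
      using dm(1)[of "m - 1" j] dm(1)[of "m - 2" m] m_ge_2 by auto
    moreover have "m * m + (m - 2) \<noteq> (m - 1 - i) * m + i" if "i < m - 1" for i
      using dm(2)[of i "m - 1 - i"] dm(2)[of "m - 2" m] m_ge_2 that by auto
    ultimately show ?thesis by blast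
  qed
  have "card (?A \<union> ?B) = card ?A + card ?B" using disj by (intro card_Un_disjoint) auto
  also have "\<dots> = (m + 1) + (m - 1)" using card_image[OF injA] card_image[OF injB] by simp
  finally show ?thesis unfolding eq using c m_ge_2 by (subst card_insert_disjoint) auto
qed

lemma weights:
  assumes k: "k < m * (m + 1)"
  shows "k mod m \<le> m - 1" "gexp (k mod m + k div m) \<le> m - 1" "k div m \<le> m"
    and "k \<notin> dom_idx \<Longrightarrow> k mod m \<le> m - 2 \<and> gexp (k mod m + k div m) \<le> m - 2"
proof -
  have "k mod m < m" using m_ge_2 by simp
  then show i: "k mod m \<le> m - 1" by simp
  have "k div m < m + 1" using k by (intro less_mult_imp_div_less) (simp add: mult.commute)
  then show j: "k div m \<le> m" by simp
  show "gexp (k mod m + k div m) \<le> m - 1"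
    using i j m_ge_2 by (auto simp: gexp_def)
  assume "k \<notin> dom_idx"
  then have ne: "k mod m \<noteq> m - 1" "k mod m + k div m \<noteq> m - 1" "k \<noteq> m * m + (m - 2)"
    using k by (auto simp: dom_idx_def)
  have kk: "k = (k div m) * m + k mod m" by simp
  have "\<not> (k mod m = m - 2 \<and> k div m = m)" using ne(3) kk by metis
  then show "k mod m \<le> m - 2 \<and> gexp (k mod m + k div m) \<le> m - 2"
    using i j ne(1,2) m_ge_2 by (auto simp: gexp_def)
qed

text \<open>Dominant indices contribute at most \<open>B p^(m-1)\<close> altogether. Every other one
  contributes at most \<open>p * p^(m-2)\<close>, which is negligible as there are at most m(m+1) of
  them.\<close>

lemma weighted_sum_bound:
  assumes e: "\<And>k. k < m * (m + 1) \<Longrightarrow> e k < p" and B: "(\<Sum>k\<in>dom_idx. e k) \<le> B"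
    and w: "\<And>k. k < m * (m + 1) \<Longrightarrow> w k \<le> m - 1" "\<And>k. k < m * (m + 1) \<Longrightarrow> k \<notin> dom_idx \<Longrightarrow> w k \<le> m - 2"
  shows "(\<Sum>k<m * (m + 1). e k * p ^ w k) \<le> (B + m * (m + 1)) * p ^ (m - 1)"
proof -
  let ?I = "{..<m * (m + 1)}"
  have J: "dom_idx \<subseteq> ?I" by (auto simp: dom_idx_def)
  have "(\<Sum>k\<in>?I. e k * p ^ w k) = (\<Sum>k\<in>dom_idx. e k * p ^ w k) + (\<Sum>k\<in>?I - dom_idx. e k * p ^ w k)"
    using sum.subset_diff[OF J, of "\<lambda>k. e k * p ^ w k"] by simp
  also have "(\<Sum>k\<in>dom_idx. e k * p ^ w k) \<le> (\<Sum>k\<in>dom_idx. e k * p ^ (m - 1))"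
    using J w p_ge_2 by (intro sum_mono mult_left_mono power_increasing) auto
  also have "\<dots> \<le> B * p ^ (m - 1)" using B by (simp add: sum_distrib_right[symmetric])
  also have "(\<Sum>k\<in>?I - dom_idx. e k * p ^ w k) \<le> (\<Sum>k\<in>?I - dom_idx. p ^ (m - 1))"
  proof (rule sum_mono)
    fix k assume k: "k \<in> ?I - dom_idx"
    have "e k * p ^ w k \<le> p * p ^ (m - 2)"
      using k e[of k] w[of k] p_ge_2 by (intro mult_mono power_increasing) auto
    also have "\<dots> = p ^ (m - 1)" using m_ge_2 by (metis Suc_diff_Suc Suc_le_lessD numeral_2_eq_2 power_Suc One_nat_def)
    finally show "e k * p ^ w k \<le> p ^ (m - 1)" .
  qed
  also have "\<dots> \<le> m * (m + 1) * p ^ (m - 1)"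
    using card_mono[of ?I "?I - dom_idx"] by simp
  finally show ?thesis by (simp add: distrib_right)
qed

text \<open>The factor \<open>p - 1\<close> in the hypothesis leaves a margin of
  \<open>r p^(m-1)\<close>, enough to reach the smaller of the two local bounds,
  \<open>r (q - 1)\<close>; the bound for \<open>g\<close> follows.\<close>

lemma prod_poly_in_W:
  assumes r: "0 < r" "r < 1" and e: "\<And>k. k < m * (m + 1) \<Longrightarrow> e k < p" and B: "(\<Sum>k\<in>dom_idx. e k) \<le> B"
    and Br: "real B + real (m * (m + 1)) < r * real (p - 1)"
  shows "prod_poly e (m * (m + 1)) \<in> W_space p m H r (Coset.order A)"
    and "(\<Sum>k<m * (m + 1). e k * p ^ k) < card \<Omega>"
proof -
  let ?N = "m * (m + 1)" and ?f = "prod_poly e (m * (m + 1))"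
  let ?w = "\<lambda>k. gexp (k mod m + k div m)"
  define Sh where "Sh = (\<Sum>k<?N. e k * p ^ (k mod m))"
  define Sg where "Sg = (\<Sum>k<?N. e k * p ^ ?w k)"
  have fh: "?f \<in> bounded_base (h_poly H) Sh"
    unfolding Sh_def using tau_pow_h_bounded[of _ _ 0] by (intro prod_poly_bounded) (auto simp: lin_poly_def)
  have fg: "?f \<in> bounded_base (g_poly p m) Sg"
    unfolding Sg_def using weights m_ge_2 by (intro prod_poly_bounded) (auto simp: lin_poly_def intro!: tau_pow_g_bounded)
  have le: "Sh \<le> (B + ?N) * p ^ (m - 1)" "Sg \<le> (B + ?N) * p ^ (m - 1)"
    unfolding Sh_def Sg_def using weights by (intro weighted_sum_bound[OF e B]; auto)+
  have pm: "p * p ^ (m - 1) = q" using m_ge_2 unfolding q_def by (metis One_nat_def Suc_diff_Suc Suc_le_lessD diff_zero numeral_2_eq_2 power_Suc Suc_lessD)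
  have pp: "1 \<le> p ^ (m - 1)" using p_ge_2 by simp
  have ppr: "1 \<le> real p ^ (m - 1)" using p_ge_2 by (intro one_le_power) simp
  have "real ((B + ?N) * p ^ (m - 1)) = (real B + real ?N) * real (p ^ (m - 1))" by simp
  also have "\<dots> < r * real (p - 1) * real (p ^ (m - 1))"
    using Br pp p_ge_2 by (intro mult_strict_right_mono) auto
  also have "\<dots> = r * (real q - real (p ^ (m - 1)))"
    unfolding pm[symmetric] using p_ge_2 by (simp add: of_nat_diff algebra_simps)
  also have "\<dots> \<le> r * (real q - 1)" using r ppr by (intro mult_left_mono diff_left_mono) auto
  also have "\<dots> = r * real (q - 1)" using q_ge(3) by (simp add: of_nat_diff)
  finally have bound: "real ((B + ?N) * p ^ (m - 1)) < r * real (q - 1)" .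
  have S: "real Sh < r * real (q - 1)" "real Sg < r * real (q - 1)"
    using le bound by (meson le_less_trans of_nat_le_iff)+
  have r1: "r * real (q - 1) \<le> real (q - 1)" "r * real (q - 1) \<le> r * real q"
    using r by (auto simp: mult_left_le_one_le)
  have "base_deg (h_poly H) ?f < ereal (r * real (card H))"
  proof (rule bounded_base_base_deg[OF h_poly_closed fh])
    show "Sh < Polynomials.degree (h_poly H)" unfolding degree_h using S r1 by linarith
    show "real Sh < r * real (card H)" using S by (simp add: card_H)
  qed
  moreover have "base_deg (g_poly p m) ?f < ereal (r * real (card (g_roots p m)))"
  proof (rule bounded_base_base_deg[OF g_poly_closed fg])
    show "Sg < Polynomials.degree (g_poly p m)" unfolding degree_g using S r1 by linarith
    show "real Sg < r * real (card (g_roots p m))" using S r1 card_G by (simp add: G_def)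
  qed
  \<comment> \<open>The top digit belongs to a dominant index and is at most \<open>B\<close>, hence
    at most p - 2. With \<open>M = m * m + (m - 1)\<close> the degree is therefore below
    \<open>(p - 1) p^M\<close>, and this is at most \<open>q^(m+1) - q^m = n\<close>.\<close>
  moreover show small: "(\<Sum>k<?N. e k * p ^ k) < card \<Omega>"
  proof -
    define M where "M = ?N - 1"
    have N: "?N = Suc M" using m_ge_2 by (simp add: M_def)
    have "0 < ?N" using N by simp
    have "M div m = m" "M mod m = m - 1"
    proof -
      have M: "M = m * m + (m - 1)" using m_ge_2 by (simp add: M_def)
      show "M div m = m" unfolding M by (rule div_nat_eqI) (use m_ge_2 in auto)
      have "(m - 1 + m * m) mod m = (m - 1) mod m" by (rule mod_mult_self2)
      then show "M mod m = m - 1" unfolding M using m_ge_2 by (simp only: add.commute mod_less)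
    qed
    then have "M \<in> dom_idx" using N by (simp add: dom_idx_def)
    moreover have finJ: "finite dom_idx" by (rule finite_subset[of _ "{..<?N}"]) (auto simp: dom_idx_def)
    ultimately have "e M \<le> (\<Sum>k\<in>dom_idx. e k)" by (intro member_le_sum) auto
    then have "e M \<le> B" using B by simp
    moreover have "B + 1 < p"
    proof -
      have "real B + real ?N < real (p - 1)" using Br r mult_right_mono[of r 1 "real (p - 1)"] by simp
      then have "B + ?N < p - 1" by linarith
      then show ?thesis by simp
    qed
    ultimately have eM: "Suc (e M) \<le> p - 1" by simp
    have "(\<Sum>k<?N. e k * p ^ k) = (\<Sum>k<M. e k * p ^ k) + e M * p ^ M" unfolding N by simp
    also have "\<dots> < p ^ M + e M * p ^ M" using digit_sum_less[of M e p] e N by simp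
    also have "\<dots> = Suc (e M) * p ^ M" by simp
    also have "\<dots> \<le> (p - 1) * p ^ M" using eM by (rule mult_right_mono) simp
    also have "\<dots> = p ^ ?N - p ^ M" unfolding N by (simp add: diff_mult_distrib)
    also have "\<dots> \<le> p ^ ?N - p ^ (m * m)"
      using p_ge_2 m_ge_2 by (intro diff_le_mono2 power_increasing) (auto simp: M_def)
    also have "\<dots> = (q - 1) * q ^ m"
      by (simp add: q_def power_mult[symmetric] diff_mult_distrib power_add[symmetric] add.commute)
    finally show ?thesis by (simp add: card_\<Omega>)
  qed
  moreover have "pdeg ?f < ereal (real (Coset.order A))"
  proof -
    have n: "card \<Omega> = Coset.order A" by (simp add: order_A card_\<Omega>)
    have "length ?f < Coset.order A + 1" using small length_prod_poly[of e ?N] n by simp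
    then have "real (length ?f) < real (Coset.order A) + 1" by linarith
    then show ?thesis using small n by (subst pdeg_less_iff) simp_all
  qed
  ultimately show "?f \<in> W_space p m H r (Coset.order A)" by (simp add: W_space_def)
qed

text \<open>Admissible exponent vectors have distinct degrees below n, so their number is a lower
  bound for the dimension.\<close>

lemma rate_bound:
  assumes r: "0 < r" "r < 1" and Br: "real B + real (m * (m + 1)) < r * real (p - 1)"
  shows "(real B / real p) ^ (2 * m + 1) / fact (2 * m + 1) \<le> code_rate \<Omega> (coset_code p m H \<alpha> r (Coset.order A))"
proof -
  let ?N = "m * (m + 1)" and ?n = "card \<Omega>" and ?C = "coset_code p m H \<alpha> r (Coset.order A)"
  let ?W = "W_space p m H r (Coset.order A)" and ?J = "dom_idx"
  \<comment> \<open>Closed under addition and scalars because the Tanner code is; linearity of the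
    base-degree conditions need not be treated separately.\<close>
  define W where "W = {f \<in> carrier (poly_ring R). length f \<le> ?n \<and> (\<lambda>x\<in>\<Omega>. eval f x) \<in> ?C}"
  have CT: "?C = tanner_code G H \<alpha> r" by (rule coset_code_eq_tanner[OF r])
  note closed = tanner_closed[OF r(1), folded CT]
  have dim: "card ?C = card (carrier R) ^ vectorspace.dim R ((func_space \<Omega>)\<lparr>carrier := ?C\<rparr>)"
    by (rule card_code_dim[OF finite_carrier finite_\<Omega> closed(1,2,4,5)])
  have finC: "finite ?C" using finite_subset[OF closed(1) finite_PiE[OF finite_\<Omega>]] finite_carrier by auto
  have W_sub: "W \<subseteq> carrier (poly_ring R)" by (auto simp: W_def)
  have W_Nil: "[] \<in> W" using closed(2) by (simp add: W_def)
  have W_add: "f \<oplus>\<^bsub>poly_ring R\<^esub> g \<in> W" if "f \<in> W" "g \<in> W" for f g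
  proof -
    have "(\<lambda>x\<in>\<Omega>. eval (f \<oplus>\<^bsub>poly_ring R\<^esub> g) x) = (\<lambda>x\<in>\<Omega>. (\<lambda>x\<in>\<Omega>. eval f x) x \<oplus> (\<lambda>x\<in>\<Omega>. eval g x) x)"
      using that \<Omega>_carrier by (auto simp: W_def restrict_def fun_eq_iff)
    then show ?thesis using that closed(4)[of "\<lambda>x\<in>\<Omega>. eval f x" "\<lambda>x\<in>\<Omega>. eval g x"] length_add_le[of f g]
      by (auto simp: W_def)
  qed
  have W_smult: "poly_of_const a \<otimes>\<^bsub>poly_ring R\<^esub> f \<in> W" if "a \<in> carrier R" "f \<in> W" for a f
  proof -
    have "(\<lambda>x\<in>\<Omega>. eval (poly_of_const a \<otimes>\<^bsub>poly_ring R\<^esub> f) x) = (\<lambda>x\<in>\<Omega>. a \<otimes> (\<lambda>x\<in>\<Omega>. eval f x) x)"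
      using that \<Omega>_carrier by (auto simp: W_def restrict_def fun_eq_iff)
    moreover have "length (poly_of_const a \<otimes>\<^bsub>poly_ring R\<^esub> f) \<le> length f"
      using length_mult_le[of "poly_of_const a" f] length_poly_of_const_le[of a] that W_sub by fastforce
    ultimately show ?thesis using that closed(5)[of a "\<lambda>x\<in>\<Omega>. eval f x"] by (auto simp: W_def)
  qed
  have "card {f \<in> W. length f \<le> ?n} \<le> card ?C"
  proof (rule card_inj_on_le[OF _ _ finC])
    show "inj_on (\<lambda>f. \<lambda>x\<in>\<Omega>. eval f x) {f \<in> W. length f \<le> ?n}"
    proof (rule inj_onI)
      fix f g assume fg: "f \<in> {f \<in> W. length f \<le> ?n}" "g \<in> {f \<in> W. length f \<le> ?n}"
        "(\<lambda>x\<in>\<Omega>. eval f x) = (\<lambda>x\<in>\<Omega>. eval g x)"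
      have "eval f x = eval g x" if "x \<in> \<Omega>" for x using fun_cong[OF fg(3), of x] that by simp
      then show "f = g" using fg W_sub by (intro poly_eq_if_agree[OF _ _ \<Omega>_carrier finite_\<Omega>]) auto
    qed
  qed (auto simp: W_def)
  moreover have "card (carrier R) ^ card {k. k < ?n \<and> (\<exists>f\<in>W. length f = Suc k)} \<le> card {f \<in> W. length f \<le> ?n}"
    by (rule card_ge_degrees[OF finite_carrier W_sub W_Nil W_add W_smult])
  ultimately have "card (carrier R) ^ card {k. k < ?n \<and> (\<exists>f\<in>W. length f = Suc k)}
      \<le> card (carrier R) ^ vectorspace.dim R ((func_space \<Omega>)\<lparr>carrier := ?C\<rparr>)"
    unfolding dim by (rule le_trans[rotated])
  then have "card {k. k < ?n \<and> (\<exists>f\<in>W. length f = Suc k)} \<le> vectorspace.dim R ((func_space \<Omega>)\<lparr>carrier := ?C\<rparr>)"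
    by (rule power_le_imp_le_exp[OF card_carrier_gt_1[OF finite_carrier]])
  moreover have "card {e \<in> {..<?N} \<rightarrow>\<^sub>E {..<p}. (\<Sum>k\<in>?J. e k) \<le> B} \<le> card {k. k < ?n \<and> (\<exists>f\<in>W. length f = Suc k)}"
  proof (rule card_inj_on_le)
    let ?E = "{e \<in> {..<?N} \<rightarrow>\<^sub>E {..<p}. (\<Sum>k\<in>?J. e k) \<le> B}" and ?h = "\<lambda>e. \<Sum>k<?N. e k * p ^ k"
    show "inj_on ?h ?E"
    proof (rule inj_onI)
      fix e f assume ef: "e \<in> ?E" "f \<in> ?E" "?h e = ?h f"
      show "e = f"
      proof (rule ext)
        fix k
        show "e k = f k"
        proof (cases "k < ?N")
          case True
          show ?thesis
            by (rule digit_sum_inj[OF _ _ ef(3) True]) (use ef in \<open>auto simp: PiE_def Pi_def\<close>)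
        next
          case False
          then show ?thesis using ef by (auto simp: PiE_def extensional_def)
        qed
      qed
    qed
    show "?h ` ?E \<subseteq> {k. k < ?n \<and> (\<exists>f\<in>W. length f = Suc k)}"
    proof
      fix d assume "d \<in> ?h ` ?E"
      then obtain e where e: "e \<in> ?E" "d = ?h e" by auto
      have e1: "e k < p" if "k < ?N" for k using e that by (auto simp: PiE_def Pi_def)
      have e2: "(\<Sum>k\<in>?J. e k) \<le> B" using e by simp
      have f: "prod_poly e ?N \<in> ?W" and d: "d < ?n" using prod_poly_in_W[OF r e1 e2 Br] e(2) by auto
      have len: "length (prod_poly e ?N) = Suc d" using length_prod_poly e(2) by simp
      have "(\<lambda>x\<in>\<Omega>. eval (prod_poly e ?N) x) \<in> ?C"
        unfolding coset_code_def evaluations_def using f by (auto simp: \<Omega>_def G_def)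
      then have "prod_poly e ?N \<in> W" using len d by (simp add: W_def)
      then show "d \<in> {k. k < ?n \<and> (\<exists>f\<in>W. length f = Suc k)}" using d len by auto
    qed
  qed auto
  moreover have "((B + card ?J) choose card ?J) * p ^ card ({..<?N} - ?J) \<le> card {e \<in> {..<?N} \<rightarrow>\<^sub>E {..<p}. (\<Sum>k\<in>?J. e k) \<le> B}"
  proof (rule card_bounded_exponents)
    show "?J \<subseteq> {..<?N}" by (auto simp: dom_idx_def)
    have "real B + real ?N < real (p - 1)" using Br r mult_right_mono[of r 1 "real (p - 1)"] by simp
    then show "B < p" by linarith
  qed simp
  ultimately have dim_ge: "((B + (2 * m + 1)) choose (2 * m + 1)) * p ^ card ({..<?N} - ?J) \<le> vectorspace.dim R ((func_space \<Omega>)\<lparr>carrier := ?C\<rparr>)"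
    unfolding card_dom_idx by linarith
  have p0: "0 < real p" and n0: "0 < real ?n" using p_ge_2 q_ge(3) by (auto simp: card_\<Omega>)
  \<comment> \<open>The unrestricted digits cancel against the length, and the 2m + 1 dominant
    digits leave the factor \<open>(B/p)^(2m+1)\<close>.\<close>
  have n_le: "real ?n \<le> real p ^ card ({..<?N} - ?J) * real p ^ (2 * m + 1)"
  proof -
    have J: "?J \<subseteq> {..<?N}" by (auto simp: dom_idx_def)
    then have "card ({..<?N} - ?J) + (2 * m + 1) = ?N"
      using card_mono[OF _ J] card_Diff_subset[OF finite_subset[OF J] J] card_dom_idx by simp
    then have "p ^ card ({..<?N} - ?J) * p ^ (2 * m + 1) = p ^ ?N" by (metis power_add)
    moreover have "?n \<le> q * q ^ m" unfolding card_\<Omega> by (intro mult_right_mono) auto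
    moreover have "q * q ^ m = p ^ ?N" by (simp add: q_def power_mult[symmetric] power_add[symmetric] add.commute)
    ultimately have "?n \<le> p ^ card ({..<?N} - ?J) * p ^ (2 * m + 1)" by simp
    then show ?thesis by (simp only: of_nat_le_iff flip: of_nat_mult of_nat_power)
  qed
  have fk: "(0::real) < fact (2 * m + 1)" by simp
  have "(real B / real p) ^ (2 * m + 1) / fact (2 * m + 1) * real ?n
     \<le> (real B / real p) ^ (2 * m + 1) / fact (2 * m + 1) * (real p ^ card ({..<?N} - ?J) * real p ^ (2 * m + 1))"
    using n_le by (intro mult_left_mono) auto
  also have "\<dots> = real B ^ (2 * m + 1) / fact (2 * m + 1) * real p ^ card ({..<?N} - ?J)"
    using p0 by (simp add: power_divide)
  also have "\<dots> \<le> real ((B + (2 * m + 1)) choose (2 * m + 1)) * real p ^ card ({..<?N} - ?J)"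
  proof (rule mult_right_mono)
    have "real (B ^ (2 * m + 1)) \<le> real (fact (2 * m + 1) * ((B + (2 * m + 1)) choose (2 * m + 1)))"
      using binomial_ge_power of_nat_le_iff by blast
    then have "real B ^ (2 * m + 1) \<le> real ((B + (2 * m + 1)) choose (2 * m + 1)) * fact (2 * m + 1)"
      by (simp only: of_nat_power of_nat_mult of_nat_fact mult.commute)
    then show "real B ^ (2 * m + 1) / fact (2 * m + 1) \<le> real ((B + (2 * m + 1)) choose (2 * m + 1))"
      using fk by (subst pos_divide_le_eq)
  qed simp
  also have "\<dots> \<le> real (vectorspace.dim R ((func_space \<Omega>)\<lparr>carrier := ?C\<rparr>))"
    using dim_ge by (simp only: of_nat_le_iff flip: of_nat_mult of_nat_power)
  finally show ?thesis unfolding code_rate_def using n0 by (simp add: pos_le_divide_eq)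
qed

end

section \<open>Asymptotics\<close>

context coset_code_setup_ge2
begin

lemma left_orbit_props:
  assumes "S \<in> left_orbits G H \<alpha>"
  shows "card S = q" "S \<subseteq> \<Omega>" "finite S" "S \<noteq> {}" "S \<subseteq> carrier R"
proof -
  obtain a v where S: "a \<in> H" "v \<in> V" "S = left_orb a v" using assms left_orbits_eq by auto
  show c: "card S = q" using S card_left_orb by simp
  show sub: "S \<subseteq> \<Omega>" using S left_orb_subset by simp
  show "finite S" using sub finite_\<Omega> by (rule finite_subset)
  show "S \<noteq> {}" using c q_ge(3) by auto
  show "S \<subseteq> carrier R" using sub \<Omega>_carrier by blast
qed

lemma right_orbit_props:
  assumes "S \<in> right_orbits G H \<alpha>"
  shows "card S = q - 1" "S \<subseteq> \<Omega>" "finite S" "S \<noteq> {}" "S \<subseteq> carrier R"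
proof -
  obtain v where S: "v \<in> V" "S = right_orb v" using assms right_orbits_eq by auto
  show c: "card S = q - 1" using S card_right_orb by simp
  show sub: "S \<subseteq> \<Omega>" using S right_orb_subset by simp
  show "finite S" using sub finite_\<Omega> by (rule finite_subset)
  show "S \<noteq> {}" using c q_ge(3) by auto
  show "S \<subseteq> carrier R" using sub \<Omega>_carrier by blast
qed

text \<open>The rounding loss \<open>1 / card S\<close> is at most \<open>1/p\<close> on both sides,
  since already \<open>q - 1\<close> is at least p.\<close>

lemma local_codes:
  assumes r: "0 < r"
  shows "S \<in> left_orbits G H \<alpha> \<Longrightarrow> code_rate S (RS_code S (r * real (card G))) \<le> r + 1 / real p"
    "S \<in> left_orbits G H \<alpha> \<Longrightarrow> 1 - r \<le> rel_min_dist S (RS_code S (r * real (card G)))"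
    "S \<in> right_orbits G H \<alpha> \<Longrightarrow> code_rate S (RS_code S (r * real (card H))) \<le> r + 1 / real p"
    "S \<in> right_orbits G H \<alpha> \<Longrightarrow> 1 - r \<le> rel_min_dist S (RS_code S (r * real (card H)))"
proof -
  have le: "1 / real k \<le> 1 / real p" if "p \<le> k" for k
    using that p_ge_2 by (intro divide_left_mono) auto
  { assume S: "S \<in> left_orbits G H \<alpha>"
    note props = left_orbit_props[OF S]
    have c: "card G = card S" using props by (simp add: card_G)
    have "1 / real (card S) \<le> 1 / real p" using q_ge(2) props(1) by (intro le) simp
    then show "code_rate S (RS_code S (r * real (card G))) \<le> r + 1 / real p"
      using RS_rate[OF finite_carrier r props(5,4)] unfolding c by linarith
    show "1 - r \<le> rel_min_dist S (RS_code S (r * real (card G)))"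
      unfolding c by (rule RS_rel_min_dist[OF r props(3,5,4)]) }
  { assume S: "S \<in> right_orbits G H \<alpha>"
    note props = right_orbit_props[OF S]
    have c: "card H = card S" using props by (simp add: card_H)
    have "1 / real (card S) \<le> 1 / real p" using q_ge(2) props(1) by (intro le) simp
    then show "code_rate S (RS_code S (r * real (card H))) \<le> r + 1 / real p"
      using RS_rate[OF finite_carrier r props(5,4)] unfolding c by linarith
    show "1 - r \<le> rel_min_dist S (RS_code S (r * real (card H)))"
      unfolding c by (rule RS_rel_min_dist[OF r props(3,5,4)]) }
qed

text \<open>The positions where two codewords differ fill at least the fraction 1 - r of every orbit
  they touch, by the distance of the local codes; this is the case \<open>\<kappa> = 1 - r\<close>
  of \<open>distance_bound\<close>.\<close>

lemma code_rel_min_dist: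
  assumes r: "0 < r" "r < 1"
  shows "(1 - r) * (1 - r - 1 / sqrt (real p)) \<le> rel_min_dist \<Omega> (tanner_code G H \<alpha> r)"
proof (rule rel_min_dist_ge[OF finite_\<Omega> tanner_closed(2,3)[OF r(1)]])
  have \<Omega>_ne: "\<Omega> \<noteq> {}" using q_ge(3) card_\<Omega> by auto
  then show "(\<lambda>x\<in>\<Omega>. \<zero>) \<noteq> (\<lambda>x\<in>\<Omega>. \<one>)" by (rule constant_words_distinct)
  show "\<Omega> \<noteq> {}" by (rule \<Omega>_ne)
next
  fix c d assume c: "c \<in> tanner_code G H \<alpha> r" and d: "d \<in> tanner_code G H \<alpha> r" and ne: "c \<noteq> d"
  define Z where "Z = {x \<in> \<Omega>. c x \<noteq> d x}"
  have ext: "c \<in> \<Omega> \<rightarrow>\<^sub>E carrier R" "d \<in> \<Omega> \<rightarrow>\<^sub>E carrier R" using c d tanner_closed(1)[OF r(1)] by auto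
  have Z_ne: "Z \<noteq> {}" using ne PiE_ext[OF ext] by (auto simp: Z_def)
  have local: "(1 - r) * real (card S) \<le> real (card (S \<inter> Z))"
    if S: "S \<subseteq> \<Omega>" "finite S" "S \<subseteq> carrier R" and RS: "restrict c S \<in> RS_code S (r * real (card S))"
      "restrict d S \<in> RS_code S (r * real (card S))" and SZ: "S \<inter> Z \<noteq> {}" for S
  proof -
    obtain x where x: "x \<in> S" "c x \<noteq> d x" using SZ by (auto simp: Z_def)
    then have "restrict c S x \<noteq> restrict d S x" by simp
    then have neq: "restrict c S \<noteq> restrict d S" by metis
    have "0 < card S" using x(1) S(2) by (auto simp: card_gt_0_iff)
    then have "0 < r * real (card S)" using r by simp
    from RS_dist[OF this S(2,3) RS neq]
    have "real (card S) - r * real (card S) \<le> real (card {x \<in> S. restrict c S x \<noteq> restrict d S x})" .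
    also have "{x \<in> S. restrict c S x \<noteq> restrict d S x} = S \<inter> Z" using S(1) by (auto simp: Z_def)
    finally show ?thesis by (simp add: left_diff_distrib)
  qed
  have left: "(1 - r) * real q \<le> real (card (left_orb a v \<inter> Z))"
    if "a \<in> H" "v \<in> V" "left_orb a v \<inter> Z \<noteq> {}" for a v
  proof -
    have S: "left_orb a v \<in> left_orbits G H \<alpha>" using that left_orbits_eq by auto
    note props = left_orbit_props[OF S]
    have cG: "card G = card (left_orb a v)" using props(1) by (simp add: card_G)
    show ?thesis using local[OF props(2,3,5) _ _ that(3)] c d S props(1) cG
      by (simp add: tanner_code_def)
  qed
  have right: "(1 - r) * real (q - 1) \<le> real (card (right_orb v \<inter> Z))"
    if "v \<in> V" "right_orb v \<inter> Z \<noteq> {}" for v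
  proof -
    have S: "right_orb v \<in> right_orbits G H \<alpha>" using that right_orbits_eq by auto
    note props = right_orbit_props[OF S]
    have cH: "card H = card (right_orb v)" using props(1) by (simp add: card_H)
    have "restrict c (right_orb v) \<in> RS_code (right_orb v) (r * real (card (right_orb v)))"
      "restrict d (right_orb v) \<in> RS_code (right_orb v) (r * real (card (right_orb v)))"
      using c d S unfolding cH[symmetric] by (auto simp: tanner_code_def)
    from local[OF props(2,3,5) this that(2)] show ?thesis unfolding props(1) .
  qed
  show "(1 - r) * (1 - r - 1 / sqrt (real p)) * real (card \<Omega>) \<le> real (card {x \<in> \<Omega>. c x \<noteq> d x})"
    using distance_bound[OF _ Z_ne _ left right] r unfolding Z_def by auto
qed

text \<open>The length \<open>(q - 1) q^m\<close> lies between \<open>(q/2)^(m+1)\<close> and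
  \<open>q^(m+1)\<close>.\<close>

lemma length_root_bounds:
  "real q / 2 \<le> real (card \<Omega>) powr (1 / real (m + 1))"
  "real (card \<Omega>) powr (1 / real (m + 1)) \<le> real q"
proof -
  let ?e = "1 / real (m + 1)"
  have root: "(x ^ (m + 1)) powr ?e = x" if "0 < x" for x :: real
    using that by (simp add: powr_realpow[symmetric] powr_powr del: power_Suc)
  have n: "real (card \<Omega>) = (real q - 1) * real q ^ m" using q_ge(3) by (simp add: card_\<Omega> of_nat_diff)
  have q0: "0 < real q" "2 \<le> real q" using q_ge(3) by auto
  have "(real q / 2) ^ (m + 1) = (real q / 2) * (real q / 2) ^ m" by simp
  also have "\<dots> \<le> (real q - 1) * real q ^ m" using q0 by (intro mult_mono power_mono) auto
  finally have "((real q / 2) ^ (m + 1)) powr ?e \<le> real (card \<Omega>) powr ?e"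
    unfolding n using q0 by (intro powr_mono2) auto
  moreover have "((real q / 2) ^ (m + 1)) powr ?e = real q / 2" using q0 by (intro root) simp
  ultimately show "real q / 2 \<le> real (card \<Omega>) powr ?e" by (simp only:)
  have "(real q - 1) * real q ^ m \<le> real q ^ (m + 1)" using q0 by (simp add: mult_right_mono)
  then have "real (card \<Omega>) powr ?e \<le> (real q ^ (m + 1)) powr ?e"
    unfolding n using q0 by (intro powr_mono2) auto
  moreover have "(real q ^ (m + 1)) powr ?e = real q" using q0 by (intro root) simp
  ultimately show "real (card \<Omega>) powr ?e \<le> real q" by (simp only:)
qed

end

lemma eventually_primes_at_top:
  "eventually P primes_at_top \<longleftrightarrow> eventually (\<lambda>p. prime p \<longrightarrow> P p) at_top"
  by (simp add: primes_at_top_def eventually_inf_principal)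

lemma tendsto_primes_at_top: "(f \<longlongrightarrow> l) at_top \<Longrightarrow> (f \<longlongrightarrow> l) primes_at_top"
  unfolding primes_at_top_def by (rule tendsto_mono[OF inf_le1])

text \<open>A limit coincides with the \<open>Liminf\<close> only along a nontrivial filter; the
  infinitude of the primes supplies this.\<close>

lemma primes_at_top_ne_bot: "primes_at_top \<noteq> bot"
proof
  assume "primes_at_top = bot"
  then have "eventually (\<lambda>p. False) primes_at_top" by simp
  then obtain N where "\<forall>p\<ge>N. \<not> prime (p :: nat)"
    by (auto simp: eventually_primes_at_top eventually_at_top_linorder)
  then show False using bigger_prime[of N] by (meson less_imp_le)
qed

lemma Liminf_primes_ge:
  fixes f g :: "nat \<Rightarrow> real"
  assumes "(g \<longlongrightarrow> l) at_top" and "eventually (\<lambda>p. prime p \<longrightarrow> g p \<le> f p) at_top"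
  shows "ereal l \<le> Liminf primes_at_top (\<lambda>p. ereal (f p))"
proof -
  have "((\<lambda>p. ereal (g p)) \<longlongrightarrow> ereal l) primes_at_top" using tendsto_primes_at_top[OF assms(1)] by simp
  then have "ereal l = Liminf primes_at_top (\<lambda>p. ereal (g p))"
    using lim_imp_Liminf[OF primes_at_top_ne_bot] by metis
  also have "\<dots> \<le> Liminf primes_at_top (\<lambda>p. ereal (f p))"
    using assms(2) by (intro Liminf_mono) (simp add: eventually_primes_at_top)
  finally show ?thesis .
qed

theorem theorem4p2:
  fixes m :: nat and r :: real
    and F :: "nat \<Rightarrow> ('a, 'b) ring_scheme"
    and K :: "nat \<Rightarrow> 'a set"
    and \<alpha> :: "nat \<Rightarrow> 'a"
  assumes "m \<ge> 2" and "0 < r" and "r < 1"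
    and "\<And>p. prime p \<Longrightarrow> coset_code_setup (F p) p m (K p) (\<alpha> p)"
  defines "G \<equiv> \<lambda>p. ring.g_roots (F p) p m"
    and "H \<equiv> \<lambda>p. K p - {\<zero>\<^bsub>F p\<^esub>}"
  defines "n \<equiv> \<lambda>p. Coset.order (ring.aff_group (F p) (G p) (H p))"
    and "\<Omega> \<equiv> \<lambda>p. ring.eval_set (F p) (G p) (H p) (\<alpha> p)"
    and "L \<equiv> \<lambda>p. ring.left_orbits (F p) (G p) (H p) (\<alpha> p)"
    and "Q \<equiv> \<lambda>p. ring.right_orbits (F p) (G p) (H p) (\<alpha> p)"
  defines "C \<equiv> \<lambda>p. ring.coset_code (F p) p m (H p) (\<alpha> p) r (n p)"
  shows
    "(\<forall>p. prime p \<longrightarrow> card (\<Omega> p) = n p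
         \<and> C p = ring.tanner_code (F p) (G p) (H p) (\<alpha> p) r) \<and>
     (((\<lambda>p. singular_values (ring.biadjacency (F p) (G p) (H p)) ! 1) \<longlongrightarrow> 0) primes_at_top) \<and>
     (\<forall>p. prime p \<longrightarrow> card (G p) = p ^ m \<and> card (H p) = p ^ m - 1
         \<and> (\<forall>S\<in>L p. card S = card (G p)) \<and> (\<forall>S\<in>Q p. card S = card (H p))) \<and>
     ((\<lambda>p. real (card (G p))) \<in> \<Theta>[primes_at_top](\<lambda>p. real (n p) powr (1 / real (m + 1)))) \<and>
     ((\<lambda>p. real (card (H p))) \<in> \<Theta>[primes_at_top](\<lambda>p. real (n p) powr (1 / real (m + 1)))) \<and>
     (\<exists>\<epsilon> :: nat \<Rightarrow> real. (\<epsilon> \<longlongrightarrow> 0) primes_at_top \<and>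
        (\<forall>p. prime p \<longrightarrow>
           (\<forall>S\<in>L p. ring.code_rate (F p) S (ring.RS_code (F p) S (r * real (card (G p)))) \<le> r + \<epsilon> p
              \<and> rel_min_dist S (ring.RS_code (F p) S (r * real (card (G p)))) \<ge> 1 - r - \<epsilon> p) \<and>
           (\<forall>S\<in>Q p. ring.code_rate (F p) S (ring.RS_code (F p) S (r * real (card (H p)))) \<le> r + \<epsilon> p
              \<and> rel_min_dist S (ring.RS_code (F p) S (r * real (card (H p)))) \<ge> 1 - r - \<epsilon> p))) \<and>
     (Liminf primes_at_top (\<lambda>p. ereal (rel_min_dist (\<Omega> p) (C p))) \<ge> ereal ((1 - r)\<^sup>2)) \<and>
     (Liminf primes_at_top (\<lambda>p. ereal (ring.code_rate (F p) (\<Omega> p) (C p)))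
        \<ge> ereal (r ^ (2 * m + 1) / fact (2 * m + 1)))"
proof -
  have csetup: "coset_code_setup_ge2 (F p) p m (K p) (\<alpha> p)" if "prime p" for p
    using assms(1) assms(4)[OF that]
    by (intro coset_code_setup_ge2.intro coset_code_setup_ge2_axioms.intro)
  note r = assms(2,3)
  note defs = coset_code_setup_ge2.G_def[OF csetup] coset_code_setup_ge2.H_def[OF csetup]
    coset_code_setup_ge2.A_def[OF csetup] coset_code_setup_ge2.\<Omega>_def[OF csetup] coset_code_setup_ge2.q_def[OF csetup]
  have G: "coset_code_setup_ge2.G (F p) p m = G p" if "prime p" for p
    using defs(1)[OF that] by (simp add: G_def)
  have H: "coset_code_setup_ge2.H (F p) (K p) = H p" if "prime p" for p
    using defs(2)[OF that] by (simp add: H_def)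
  have A: "Coset.order (coset_code_setup_ge2.A (F p) p m (K p)) = n p" if "prime p" for p
    using defs(3)[OF that] by (simp add: n_def G[OF that] H[OF that])
  have \<Omega>: "coset_code_setup_ge2.\<Omega> (F p) p m (K p) (\<alpha> p) = \<Omega> p" if "prime p" for p
    using defs(4)[OF that] by (simp add: \<Omega>_def G[OF that] H[OF that])
  note q = defs(5)
  have card_\<Omega>: "card (\<Omega> p) = n p" if "prime p" for p
    using coset_code_setup_ge2.card_\<Omega>[OF csetup[OF that]] coset_code_setup_ge2.order_A[OF csetup[OF that]]
    by (simp add: \<Omega>[OF that] A[OF that])
  have tanner: "C p = ring.tanner_code (F p) (G p) (H p) (\<alpha> p) r" if "prime p" for p
    using coset_code_setup_ge2.coset_code_eq_tanner[OF csetup[OF that] r]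
    by (simp add: C_def G[OF that] H[OF that] A[OF that])
  have card_G: "card (G p) = p ^ m" and card_H: "card (H p) = p ^ m - 1" if "prime p" for p
    using coset_code_setup_ge2.card_G[OF csetup[OF that]] coset_code_setup_ge2.card_H[OF csetup[OF that]]
    by (simp_all add: G[OF that] H[OF that] q[OF that])
  have orbits: "(\<forall>S\<in>L p. card S = card (G p)) \<and> (\<forall>S\<in>Q p. card S = card (H p))" if "prime p" for p
    using coset_code_setup_ge2.left_orbit_props(1)[OF csetup[OF that]] coset_code_setup_ge2.right_orbit_props(1)[OF csetup[OF that]]
    by (simp add: L_def Q_def G[OF that] H[OF that] q[OF that] card_G[OF that] card_H[OF that])
  have inv_p: "((\<lambda>p. 1 / real p) \<longlongrightarrow> 0) at_top" by (rule lim_1_over_n)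
  have inv_sqrt: "((\<lambda>p. 1 / sqrt (real p)) \<longlongrightarrow> 0) at_top"
    using tendsto_real_sqrt[OF inv_p] by (simp add: real_sqrt_divide)
  have sv: "0 \<le> singular_values (ring.biadjacency (F p) (G p) (H p)) ! 1"
      "singular_values (ring.biadjacency (F p) (G p) (H p)) ! 1 \<le> 1 / sqrt (real p)" if "prime p" for p
    using coset_code_setup_ge2.second_singular_value[OF csetup[OF that]]
    by (simp_all add: G[OF that] H[OF that] real_sqrt_divide)
  have "((\<lambda>p. singular_values (ring.biadjacency (F p) (G p) (H p)) ! 1) \<longlongrightarrow> 0) primes_at_top"
    by (rule tendsto_sandwich[OF _ _ tendsto_const tendsto_primes_at_top[OF inv_sqrt]])
      (use sv in \<open>auto simp: eventually_primes_at_top\<close>)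
  moreover have root: "real (p ^ m) / 2 \<le> real (n p) powr (1 / real (m + 1))"
      "real (n p) powr (1 / real (m + 1)) \<le> real (p ^ m)" if "prime p" for p
    using coset_code_setup_ge2.length_root_bounds[OF csetup[OF that]] card_\<Omega>[OF that]
    by (simp_all only: \<Omega>[OF that] q[OF that])
  have p_ge: "2 \<le> p ^ m" if "prime p" for p :: nat
  proof -
    have "p ^ 1 \<le> p ^ m" using prime_ge_2_nat[OF that] assms(1) by (intro power_increasing) auto
    then show ?thesis using prime_ge_2_nat[OF that] by simp
  qed
  have "(\<lambda>p. real (card (G p))) \<in> \<Theta>[primes_at_top](\<lambda>p. real (n p) powr (1 / real (m + 1)))"
  proof (rule bigthetaI')
    show "\<forall>\<^sub>F p in primes_at_top. 1 * norm (real (n p) powr (1 / real (m + 1))) \<le> norm (real (card (G p)))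
      \<and> norm (real (card (G p))) \<le> 2 * norm (real (n p) powr (1 / real (m + 1)))"
      unfolding eventually_primes_at_top
    proof (intro always_eventually allI impI)
      fix p :: nat assume p: "prime p"
      show "1 * norm (real (n p) powr (1 / real (m + 1))) \<le> norm (real (card (G p)))
        \<and> norm (real (card (G p))) \<le> 2 * norm (real (n p) powr (1 / real (m + 1)))"
        using root[OF p] card_G[OF p] by simp
    qed
  qed simp_all
  moreover have "(\<lambda>p. real (card (H p))) \<in> \<Theta>[primes_at_top](\<lambda>p. real (n p) powr (1 / real (m + 1)))"
  proof (rule bigthetaI')
    show "\<forall>\<^sub>F p in primes_at_top. 1 / 2 * norm (real (n p) powr (1 / real (m + 1))) \<le> norm (real (card (H p)))
      \<and> norm (real (card (H p))) \<le> 2 * norm (real (n p) powr (1 / real (m + 1)))"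
      unfolding eventually_primes_at_top
    proof (intro always_eventually allI impI)
      fix p :: nat assume p: "prime p"
      have "real (card (H p)) = real (p ^ m) - 1" using p_ge[OF p] card_H[OF p] by (simp only: of_nat_diff of_nat_1)
      moreover have "2 \<le> real (p ^ m)" using p_ge[OF p] by linarith
      moreover have "norm (real (n p) powr (1 / real (m + 1))) = real (n p) powr (1 / real (m + 1))" by simp
      moreover have "norm (real (card (H p))) = real (card (H p))" by simp
      ultimately show "1 / 2 * norm (real (n p) powr (1 / real (m + 1))) \<le> norm (real (card (H p)))
        \<and> norm (real (card (H p))) \<le> 2 * norm (real (n p) powr (1 / real (m + 1)))"
        using root[OF p] by linarith
    qed
  qed simp_all
  moreover have "\<exists>\<epsilon> :: nat \<Rightarrow> real. (\<epsilon> \<longlongrightarrow> 0) primes_at_top \<and>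
        (\<forall>p. prime p \<longrightarrow>
           (\<forall>S\<in>L p. ring.code_rate (F p) S (ring.RS_code (F p) S (r * real (card (G p)))) \<le> r + \<epsilon> p
              \<and> rel_min_dist S (ring.RS_code (F p) S (r * real (card (G p)))) \<ge> 1 - r - \<epsilon> p) \<and>
           (\<forall>S\<in>Q p. ring.code_rate (F p) S (ring.RS_code (F p) S (r * real (card (H p)))) \<le> r + \<epsilon> p
              \<and> rel_min_dist S (ring.RS_code (F p) S (r * real (card (H p)))) \<ge> 1 - r - \<epsilon> p))"
  proof (intro exI[of _ "\<lambda>p. 1 / real p"] conjI allI impI ballI)
    show "((\<lambda>p. 1 / real p) \<longlongrightarrow> 0) primes_at_top" by (rule tendsto_primes_at_top[OF inv_p])
  next
    fix p :: nat and S assume p: "prime p"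
    note codes = coset_code_setup_ge2.local_codes[OF csetup[OF p] r(1), unfolded G[OF p] H[OF p]]
    have p0: "0 \<le> 1 / real p" by simp
    { assume "S \<in> L p"
      then show "ring.code_rate (F p) S (ring.RS_code (F p) S (r * real (card (G p)))) \<le> r + 1 / real p"
        "rel_min_dist S (ring.RS_code (F p) S (r * real (card (G p)))) \<ge> 1 - r - 1 / real p"
        using codes(1,2)[of S] p0 unfolding L_def by linarith+ }
    { assume "S \<in> Q p"
      then show "ring.code_rate (F p) S (ring.RS_code (F p) S (r * real (card (H p)))) \<le> r + 1 / real p"
        "rel_min_dist S (ring.RS_code (F p) S (r * real (card (H p)))) \<ge> 1 - r - 1 / real p"
        using codes(3,4)[of S] p0 unfolding Q_def by linarith+ }
  qed
  moreover have "ereal ((1 - r)\<^sup>2) \<le> Liminf primes_at_top (\<lambda>p. ereal (rel_min_dist (\<Omega> p) (C p)))"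
  proof (rule Liminf_primes_ge)
    have "((\<lambda>p. (1 - r) * (1 - r - 1 / sqrt (real p))) \<longlongrightarrow> (1 - r) * (1 - r - 0)) at_top"
      by (intro tendsto_intros inv_sqrt)
    then show "((\<lambda>p. (1 - r) * (1 - r - 1 / sqrt (real p))) \<longlongrightarrow> (1 - r)\<^sup>2) at_top" by (simp add: power2_eq_square)
    have "(1 - r) * (1 - r - 1 / sqrt (real p)) \<le> rel_min_dist (\<Omega> p) (C p)" if "prime p" for p
      using coset_code_setup_ge2.code_rel_min_dist[OF csetup[OF that] r]
      by (simp only: \<Omega>[OF that] tanner[OF that] G[OF that] H[OF that])
    then show "\<forall>\<^sub>F p in at_top. prime p \<longrightarrow> (1 - r) * (1 - r - 1 / sqrt (real p)) \<le> rel_min_dist (\<Omega> p) (C p)"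
      by simp
  qed
  moreover have "ereal (r ^ (2 * m + 1) / fact (2 * m + 1)) \<le> Liminf primes_at_top (\<lambda>p. ereal (ring.code_rate (F p) (\<Omega> p) (C p)))"
  proof (rule Liminf_primes_ge)
    \<comment> \<open>Chosen so that the floor in \<open>B\<close> leaves
      \<open>B p + m(m+1) \<le> r p - r - 1\<close>, strictly below \<open>r (p - 1)\<close>, while
      \<open>B p\<close> still differs from \<open>r p\<close> by at most the constant
      \<open>s\<close>.\<close>
    define s where "s = real (m * (m + 1)) + 2 + r"
    define B where "B p = nat \<lfloor>r * real p - s + 1\<rfloor>" for p :: nat
    have lim_s: "((\<lambda>p. r - s * (1 / real p)) \<longlongrightarrow> r - s * 0) at_top" by (intro tendsto_intros inv_p)
    have lim_g: "((\<lambda>p. (r - s * (1 / real p)) ^ (2 * m + 1) / fact (2 * m + 1)) \<longlongrightarrow> (r - s * 0) ^ (2 * m + 1) / fact (2 * m + 1)) at_top"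
      by (intro tendsto_intros lim_s) simp
    then show "((\<lambda>p. (r - s * (1 / real p)) ^ (2 * m + 1) / fact (2 * m + 1)) \<longlongrightarrow> r ^ (2 * m + 1) / fact (2 * m + 1)) at_top"
      by simp
    \<comment> \<open>From this point on \<open>r p - s\<close> is nonnegative, so
      \<open>nat\<close> does not truncate and the power is monotone.\<close>
    have ev: "\<forall>\<^sub>F p in at_top. s / r \<le> real p"
      using filterlim_real_sequentially by (simp add: filterlim_at_top)
    show "\<forall>\<^sub>F p in at_top. prime p \<longrightarrow> (r - s * (1 / real p)) ^ (2 * m + 1) / fact (2 * m + 1) \<le> ring.code_rate (F p) (\<Omega> p) (C p)"
      using ev
    proof (eventually_elim, intro impI)
      fix p :: nat assume sp: "s / r \<le> real p" and p: "prime p"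
      have p2: "2 \<le> p" using prime_ge_2_nat[OF p] .
      have s: "s \<le> r * real p" using sp r by (simp add: pos_divide_le_eq mult.commute)
      have B: "r * real p - s \<le> real (B p)" "real (B p) \<le> r * real p - s + 1"
        using s unfolding B_def by linarith+
      have rp: "r * real (p - 1) = r * real p - r" using p2 by (simp add: of_nat_diff right_diff_distrib)
      have "real (B p) + real (m * (m + 1)) < r * real (p - 1)" using B(2) unfolding s_def rp by linarith
      from coset_code_setup_ge2.rate_bound[OF csetup[OF p] r this]
      have bound: "(real (B p) / real p) ^ (2 * m + 1) / fact (2 * m + 1) \<le> ring.code_rate (F p) (\<Omega> p) (C p)"
        by (simp only: \<Omega>[OF p] A[OF p] H[OF p] C_def)
      have "r - s * (1 / real p) = (r * real p - s) / real p" using p2 by (simp add: field_simps)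
      also have "\<dots> \<le> real (B p) / real p" using B(1) by (intro divide_right_mono) auto
      finally have le: "r - s * (1 / real p) \<le> real (B p) / real p" .
      have "0 \<le> (r * real p - s) / real p" using s by (intro divide_nonneg_nonneg) auto
      then have "0 \<le> r - s * (1 / real p)" using p2 by (simp add: field_simps)
      then have "(r - s * (1 / real p)) ^ (2 * m + 1) / fact (2 * m + 1) \<le> (real (B p) / real p) ^ (2 * m + 1) / fact (2 * m + 1)"
        using le by (intro divide_right_mono power_mono) auto
      then show "(r - s * (1 / real p)) ^ (2 * m + 1) / fact (2 * m + 1) \<le> ring.code_rate (F p) (\<Omega> p) (C p)"
        using bound by linarith
    qed
  qed
  ultimately show ?thesis using card_\<Omega> tanner card_G card_H orbits by blast
qed

end
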